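(* Let $F$ be a non-discrete locally compact non-archimedean field of characteristic $\neq 2$, with residue field of characteristic $p$ and cardinality $q$. Let $R$ be an integral domain with $p\in R^\times$, containing a square root of $q$, and let $\chi:F\to R^\times$ be a non-trivial smooth character. Let $X$ be a finite-dimensional $F$-vector space, $W=X\times X^*$, and let $\mathrm{Mp}(W)$ be the metaplectic group attached to $R$ and $\chi$, with $\pi:\mathrm{Mp}(W)\to\mathrm{Sp}(W)$, $\pi(\sigma,\mathbf s)=\sigma$. Then the sequence $$1\longrightarrow R^\times\longrightarrow\mathrm{Mp}(W)\overset{\pi}{\longrightarrow}\mathrm{Sp}(W)\longrightarrow1$$ is exact, where $R^\times$ injects in $\mathrm{Mp}(W)$ by $t\mapsto(\mathrm{id},t\cdot\mathrm{id}_{\mathcal S(X)})$.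
   Context: A smooth character of $F$ is a group homomorphism $F\to R^\times$ with open kernel. $X^*=\mathrm{Hom}_F(X,F)$; $[x,x^*]=x^*(x)$ and $\langle x,x^*\rangle=\chi([x,x^*])$. On $W=X\times X^*$ put $\mathcal B((x_1,x_1^* ),(x_2,x_2^* ))=[x_1,x_2^*]$ and $\mathcal F=\chi\circ\mathcal B$. $\mathrm{Sp}(W)$ is the group of $F$-linear automorphisms $\sigma$ of $W$ preserving the form $(w_1,w_2)\mapsto\mathcal B(w_1,w_2)-\mathcal B(w_2,w_1)$. For $\sigma\in\mathrm{Sp}(W)$ put $f_\sigma(w)=\frac12(\mathcal B(\sigma w,\sigma w)-\mathcal B(w,w))$. $A(W)$ is the set $W\times R^\times$ with group law $(w_1,t_1)(w_2,t_2)=(w_1+w_2,t_1t_2\mathcal F(w_1,w_2))$; its center is $Z=\{(0,t):t\in R^\times\}$. $B_0(W)$ is the group of automorphisms of $A(W)$ acting trivially on $Z$. $\mathcal S(X)$ is the $R$-module of locally constant compactly supported functions $X\to R$, and $\mathrm{Aut}(\mathcal S(X))$ its group of $R$-linear automorphisms. For $w=(v,v^* )\in W$ and $t\in R^\times$, $U(w,t)\in\mathrm{Aut}(\mathcal S(X))$ is $(U(w,t)\Phi)(x)=t\,\Phi(x+v)\langle x,v^*\rangle$; the map $U$ is an isomorphism from $A(W)$ onto a subgroup $\mathbb A(W)$ of $\mathrm{Aut}(\mathcal S(X))$. $\mathbb B_0(W)$ is the normalizer of $\mathbb A(W)$ in $\mathrm{Aut}(\mathcal S(X))$. The homomorphism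 $\pi_0:\mathbb B_0(W)\to B_0(W)$ sends $\mathbf s$ to conjugation by $\mathbf s$ on $\mathbb A(W)\cong A(W)$ (identified via $U$). The homomorphism $\mu:\mathrm{Sp}(W)\to B_0(W)$ sends $\sigma$ to the automorphism $(w,t)\mapsto(\sigma(w),\chi(f_\sigma(w))t)$. The metaplectic group is $\mathrm{Mp}(W)=\{(\sigma,\mathbf s)\in\mathrm{Sp}(W)\times\mathbb B_0(W):\mu(\sigma)=\pi_0(\mathbf s)\}$. *)

theory Defs
  imports "HOL-Analysis.Analysis" "HOL-Algebra.Group_Action" "HOL-Algebra.QuotRing"
begin

section \<open>The field F\<close>

definition field_topology :: "('f::field \<Rightarrow> real) \<Rightarrow> 'f topology" where
  "field_topology absv = Metric_space.mtopology UNIV (\<lambda>x y. absv (x - y))"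

locale nonarch_abs_value =
  fixes absv :: "'f::field \<Rightarrow> real"
  assumes absv_nonneg: "0 \<le> absv x"
    and absv_eq_0_iff: "absv x = 0 \<longleftrightarrow> x = 0"
    and absv_mult: "absv (x * y) = absv x * absv y"
    and absv_ultrametric: "absv (x + y) \<le> max (absv x) (absv y)"

locale nonarch_local_field = nonarch_abs_value absv for absv :: "'f::field \<Rightarrow> real" +
  assumes locally_compact: "locally_compact_space (field_topology absv)"
    and non_discrete: "field_topology absv \<noteq> discrete_topology UNIV"

definition valuation_ring :: "('f::field \<Rightarrow> real) \<Rightarrow> 'f ring" where
  "valuation_ring absv =
     \<lparr>carrier = {x. absv x \<le> 1}, mult = (*), one = 1, zero = 0, add = (+)\<rparr>"

definition residue_field :: "('f::field \<Rightarrow> real) \<Rightarrow> 'f set ring" where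
  "residue_field absv = valuation_ring absv Quot {x. absv x < 1}"

definition residue_card :: "('f::field \<Rightarrow> real) \<Rightarrow> nat" where
  "residue_card absv = card (carrier (residue_field absv))"

text \<open>The residue field of a local field is finite, so the least positive annihilator of
  its unit exists.\<close>
definition residue_char :: "('f::field \<Rightarrow> real) \<Rightarrow> nat" where
  "residue_char absv = (LEAST n. 0 < n \<and>
     add_pow (residue_field absv) n \<one>\<^bsub>residue_field absv\<^esub> = \<zero>\<^bsub>residue_field absv\<^esub>)"

section \<open>Smooth characters\<close>

definition additive_group :: "'f::ab_group_add monoid" where
  "additive_group = \<lparr>carrier = UNIV, mult = (+), one = 0\<rparr>"

definition unit_group :: "'r::idom monoid" where
  "unit_group = \<lparr>carrier = {t. t dvd 1}, mult = (*), one = 1\<rparr>"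

definition smooth_character :: "('f::field \<Rightarrow> real) \<Rightarrow> ('f \<Rightarrow> 'r::idom) \<Rightarrow> bool" where
  "smooth_character absv chi \<longleftrightarrow>
     chi \<in> hom additive_group unit_group \<and>
     openin (field_topology absv) (kernel additive_group unit_group chi)"

section \<open>The vector space X, its dual, and Schwartz functions\<close>

text \<open>Throughout, X is the whole type \<open>'x\<close> with scalar multiplication \<open>smul\<close>.\<close>

definition dual :: "('f::field \<Rightarrow> 'x::ab_group_add \<Rightarrow> 'x) \<Rightarrow> ('x \<Rightarrow> 'f) set" where
  "dual smul = {l. Vector_Spaces.linear smul (*) l}"

text \<open>The canonical topology of a finite-dimensional space, given without choosing a basis as
  the coarsest one making all linear forms continuous. Lemma \<open>openin_space_topology_iff\<close> below
  identifies it with the product topology in the coordinates of any basis.\<close>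
definition space_topology ::
  "('f::field \<Rightarrow> real) \<Rightarrow> ('f \<Rightarrow> 'x::ab_group_add \<Rightarrow> 'x) \<Rightarrow> 'x topology" where
  "space_topology absv smul =
     topology_generated_by {l -` V | l V. l \<in> dual smul \<and> openin (field_topology absv) V}"

definition schwartz_space ::
  "('f::field \<Rightarrow> real) \<Rightarrow> ('f \<Rightarrow> 'x::ab_group_add \<Rightarrow> 'x) \<Rightarrow> ('x \<Rightarrow> 'r::idom) set" where
  "schwartz_space absv smul =
     {\<Phi>. (\<forall>x. \<exists>N. openin (space_topology absv smul) N \<and> x \<in> N \<and> (\<forall>y\<in>N. \<Phi> y = \<Phi> x)) \<and>
         compactin (space_topology absv smul)
           (space_topology absv smul closure_of {x. \<Phi> x \<noteq> 0})}"

definition Aut_S ::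
  "('f::field \<Rightarrow> real) \<Rightarrow> ('f \<Rightarrow> 'x::ab_group_add \<Rightarrow> 'x) \<Rightarrow>
     (('x \<Rightarrow> 'r::idom) \<Rightarrow> ('x \<Rightarrow> 'r)) monoid" where
  "Aut_S absv smul = BijGroup (schwartz_space absv smul)
     \<lparr>carrier := {T \<in> Bij (schwartz_space absv smul).
        (\<forall>\<Phi>\<in>schwartz_space absv smul. \<forall>\<Psi>\<in>schwartz_space absv smul.
           T (\<lambda>x. \<Phi> x + \<Psi> x) = (\<lambda>x. T \<Phi> x + T \<Psi> x)) \<and>
        (\<forall>c. \<forall>\<Phi>\<in>schwartz_space absv smul. T (\<lambda>x. c * \<Phi> x) = (\<lambda>x. c * T \<Phi> x))}\<rparr>"

section \<open>The symplectic group\<close>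

definition W :: "('f::field \<Rightarrow> 'x::ab_group_add \<Rightarrow> 'x) \<Rightarrow> ('x \<times> ('x \<Rightarrow> 'f)) set" where
  "W smul = UNIV \<times> dual smul"

definition W_zero :: "'x::ab_group_add \<times> ('x \<Rightarrow> 'f::field)" where
  "W_zero = (0, \<lambda>x. 0)"

definition W_add :: "'x::ab_group_add \<times> ('x \<Rightarrow> 'f::field) \<Rightarrow> 'x \<times> ('x \<Rightarrow> 'f) \<Rightarrow> 'x \<times> ('x \<Rightarrow> 'f)" where
  "W_add w1 w2 = (fst w1 + fst w2, \<lambda>x. snd w1 x + snd w2 x)"

definition W_scale :: "('f::field \<Rightarrow> 'x::ab_group_add \<Rightarrow> 'x) \<Rightarrow> 'f \<Rightarrow> 'x \<times> ('x \<Rightarrow> 'f) \<Rightarrow> 'x \<times> ('x \<Rightarrow> 'f)" where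
  "W_scale smul c w = (smul c (fst w), \<lambda>x. c * snd w x)"

definition form_B :: "'x::ab_group_add \<times> ('x \<Rightarrow> 'f::field) \<Rightarrow> 'x \<times> ('x \<Rightarrow> 'f) \<Rightarrow> 'f" where
  "form_B w1 w2 = snd w2 (fst w1)"

text \<open>As in \<^const>\<open>BijGroup\<close>, maps are taken extensional on their carrier, so that equality of
  group elements is equality of maps on W.\<close>
definition Sp :: "('f::field \<Rightarrow> 'x::ab_group_add \<Rightarrow> 'x) \<Rightarrow>
    ('x \<times> ('x \<Rightarrow> 'f) \<Rightarrow> 'x \<times> ('x \<Rightarrow> 'f)) monoid" where
  "Sp smul = BijGroup (W smul)
     \<lparr>carrier := {\<sigma> \<in> Bij (W smul).
        (\<forall>w1\<in>W smul. \<forall>w2\<in>W smul. \<sigma> (W_add w1 w2) = W_add (\<sigma> w1) (\<sigma> w2)) \<and>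
        (\<forall>c. \<forall>w\<in>W smul. \<sigma> (W_scale smul c w) = W_scale smul c (\<sigma> w)) \<and>
        (\<forall>w1\<in>W smul. \<forall>w2\<in>W smul.
           form_B (\<sigma> w1) (\<sigma> w2) - form_B (\<sigma> w2) (\<sigma> w1) = form_B w1 w2 - form_B w2 w1)}\<rparr>"

definition f_quad :: "('x::ab_group_add \<times> ('x \<Rightarrow> 'f::field) \<Rightarrow> 'x \<times> ('x \<Rightarrow> 'f)) \<Rightarrow>
    'x \<times> ('x \<Rightarrow> 'f) \<Rightarrow> 'f" where
  "f_quad \<sigma> w = (form_B (\<sigma> w) (\<sigma> w) - form_B w w) / 2"

section \<open>The Heisenberg group and its automorphisms\<close>

definition A_grp :: "('f::field \<Rightarrow> 'x::ab_group_add \<Rightarrow> 'x) \<Rightarrow> ('f \<Rightarrow> 'r::idom) \<Rightarrow>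
    (('x \<times> ('x \<Rightarrow> 'f)) \<times> 'r) monoid" where
  "A_grp smul chi =
     \<lparr>carrier = W smul \<times> carrier unit_group,
      mult = (\<lambda>(w1, t1) (w2, t2). (W_add w1 w2, t1 * t2 * chi (form_B w1 w2))),
      one = (W_zero, 1)\<rparr>"

definition B0_grp :: "('f::field \<Rightarrow> 'x::ab_group_add \<Rightarrow> 'x) \<Rightarrow> ('f \<Rightarrow> 'r::idom) \<Rightarrow>
    (('x \<times> ('x \<Rightarrow> 'f)) \<times> 'r \<Rightarrow> ('x \<times> ('x \<Rightarrow> 'f)) \<times> 'r) monoid" where
  "B0_grp smul chi = AutoGroup (A_grp smul chi)
     \<lparr>carrier := {s \<in> auto (A_grp smul chi).
        \<forall>t \<in> carrier unit_group. s (W_zero, t) = (W_zero, t)}\<rparr>"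

definition mu :: "('f::field \<Rightarrow> 'x::ab_group_add \<Rightarrow> 'x) \<Rightarrow> ('f \<Rightarrow> 'r::idom) \<Rightarrow>
    ('x \<times> ('x \<Rightarrow> 'f) \<Rightarrow> 'x \<times> ('x \<Rightarrow> 'f)) \<Rightarrow>
    ('x \<times> ('x \<Rightarrow> 'f)) \<times> 'r \<Rightarrow> ('x \<times> ('x \<Rightarrow> 'f)) \<times> 'r" where
  "mu smul chi \<sigma> = (\<lambda>(w, t) \<in> carrier (A_grp smul chi). (\<sigma> w, chi (f_quad \<sigma> w) * t))"

section \<open>The operator groups and the metaplectic group\<close>

definition U_op :: "('f::field \<Rightarrow> real) \<Rightarrow> ('f \<Rightarrow> 'x::ab_group_add \<Rightarrow> 'x) \<Rightarrow> ('f \<Rightarrow> 'r::idom) \<Rightarrow>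
    ('x \<times> ('x \<Rightarrow> 'f)) \<times> 'r \<Rightarrow> ('x \<Rightarrow> 'r) \<Rightarrow> ('x \<Rightarrow> 'r)" where
  "U_op absv smul chi = (\<lambda>((v, v'), t). \<lambda>\<Phi> \<in> schwartz_space absv smul.
     (\<lambda>x. t * \<Phi> (x + v) * chi (v' x)))"

definition AA :: "('f::field \<Rightarrow> real) \<Rightarrow> ('f \<Rightarrow> 'x::ab_group_add \<Rightarrow> 'x) \<Rightarrow> ('f \<Rightarrow> 'r::idom) \<Rightarrow>
    (('x \<Rightarrow> 'r) \<Rightarrow> ('x \<Rightarrow> 'r)) set" where
  "AA absv smul chi = U_op absv smul chi ` carrier (A_grp smul chi)"

definition BB0 :: "('f::field \<Rightarrow> real) \<Rightarrow> ('f \<Rightarrow> 'x::ab_group_add \<Rightarrow> 'x) \<Rightarrow> ('f \<Rightarrow> 'r::idom) \<Rightarrow>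
    (('x \<Rightarrow> 'r) \<Rightarrow> ('x \<Rightarrow> 'r)) monoid" where
  "BB0 absv smul chi = Aut_S absv smul
     \<lparr>carrier := normalizer (Aut_S absv smul) (AA absv smul chi)\<rparr>"

definition pi0 :: "('f::field \<Rightarrow> real) \<Rightarrow> ('f \<Rightarrow> 'x::ab_group_add \<Rightarrow> 'x) \<Rightarrow> ('f \<Rightarrow> 'r::idom) \<Rightarrow>
    (('x \<Rightarrow> 'r) \<Rightarrow> ('x \<Rightarrow> 'r)) \<Rightarrow>
    ('x \<times> ('x \<Rightarrow> 'f)) \<times> 'r \<Rightarrow> ('x \<times> ('x \<Rightarrow> 'f)) \<times> 'r" where
  "pi0 absv smul chi s = (\<lambda>a \<in> carrier (A_grp smul chi).
     inv_into (carrier (A_grp smul chi)) (U_op absv smul chi)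
       (s \<otimes>\<^bsub>Aut_S absv smul\<^esub> U_op absv smul chi a \<otimes>\<^bsub>Aut_S absv smul\<^esub>
        inv\<^bsub>Aut_S absv smul\<^esub> s))"

definition Mp :: "('f::field \<Rightarrow> real) \<Rightarrow> ('f \<Rightarrow> 'x::ab_group_add \<Rightarrow> 'x) \<Rightarrow> ('f \<Rightarrow> 'r::idom) \<Rightarrow>
    (('x \<times> ('x \<Rightarrow> 'f) \<Rightarrow> 'x \<times> ('x \<Rightarrow> 'f)) \<times> (('x \<Rightarrow> 'r) \<Rightarrow> ('x \<Rightarrow> 'r))) monoid" where
  "Mp absv smul chi = (Sp smul \<times>\<times> BB0 absv smul chi)
     \<lparr>carrier := {(\<sigma>, s). \<sigma> \<in> carrier (Sp smul) \<and> s \<in> carrier (BB0 absv smul chi) \<and>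
        mu smul chi \<sigma> = pi0 absv smul chi s}\<rparr>"

definition Mp_scalar :: "('f::field \<Rightarrow> real) \<Rightarrow> ('f \<Rightarrow> 'x::ab_group_add \<Rightarrow> 'x) \<Rightarrow> 'r::idom \<Rightarrow>
    ('x \<times> ('x \<Rightarrow> 'f) \<Rightarrow> 'x \<times> ('x \<Rightarrow> 'f)) \<times> (('x \<Rightarrow> 'r) \<Rightarrow> ('x \<Rightarrow> 'r))" where
  "Mp_scalar absv smul t =
     ((\<lambda>w \<in> W smul. w), (\<lambda>\<Phi> \<in> schwartz_space absv smul. (\<lambda>x. t * \<Phi> x)))"

section \<open>The topology of X in coordinates\<close>

context nonarch_abs_value
begin

lemma absv_one: "absv 1 = 1"
  using absv_mult[of 1 1] absv_eq_0_iff[of 1] by simp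

lemma absv_zero: "absv 0 = 0"
  by (simp add: absv_eq_0_iff)

lemma absv_minus: "absv (- x) = absv x"
proof -
  have "absv (-1) * absv (-1) = 1" using absv_mult[of "-1" "-1"] absv_one by simp
  then have "absv (-1) = 1"
    using absv_nonneg[of "-1"] by (simp add: square_eq_1_iff)
  then show ?thesis using absv_mult[of "-1" x] by simp
qed

lemma Metric_space_absv: "Metric_space UNIV (\<lambda>x y. absv (x - y))"
proof
  show "absv (x - z) \<le> absv (x - y) + absv (y - z)" for x y z
    using absv_ultrametric[of "x - y" "y - z"] absv_nonneg[of "x - y"] absv_nonneg[of "y - z"] by simp
  show "absv (x - y) = absv (y - x)" for x y
    using absv_minus[of "x - y"] by simp
qed (simp_all add: absv_nonneg absv_eq_0_iff)

lemma openin_field_topology_iff: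
  "openin (field_topology absv) V \<longleftrightarrow> (\<forall>x\<in>V. \<exists>r>0. \<forall>y. absv (y - x) < r \<longrightarrow> y \<in> V)"
proof -
  interpret Metric_space UNIV "\<lambda>x y. absv (x - y)" by (rule Metric_space_absv)
  have "absv (x - y) = absv (y - x)" for x y using absv_minus[of "x - y"] by simp
  then show ?thesis
    unfolding field_topology_def openin_mtopology by (auto simp: mball_def subset_iff)
qed

lemma absv_sum_less:
  assumes "finite B" "0 < r" "\<And>b. b \<in> B \<Longrightarrow> absv (g b) < r"
  shows "absv (\<Sum>b\<in>B. g b) < r"
  using assms(1,3)
proof (induction B rule: finite_induct)
  case empty then show ?case using assms(2) by (simp add: absv_zero)
next
  case (insert b B)
  then have "absv (g b) < r" "absv (sum g B) < r" by simp_all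
  then have "absv (g b + sum g B) < r" using absv_ultrametric[of "g b" "sum g B"] by linarith
  with insert.hyps show ?case by simp
qed

lemma openin_space_topology_iff:
  fixes smul :: "'f \<Rightarrow> 'x::ab_group_add \<Rightarrow> 'x"
  assumes "finite_dimensional_vector_space smul B"
  shows "openin (space_topology absv smul) S \<longleftrightarrow>
    (\<forall>x\<in>S. \<exists>e>0. \<forall>y. (\<forall>b\<in>B. absv (module.representation smul B y b -
        module.representation smul B x b) < e) \<longrightarrow> y \<in> S)" (is "_ \<longleftrightarrow> ?P S")
proof
  interpret finite_dimensional_vector_space smul B by fact
  let ?c = "representation B"
  assume "openin (space_topology absv smul) S"
  then have "generate_topology_on {l -` V | l V. l \<in> dual smul \<and> openin (field_topology absv) V} S"
    unfolding space_topology_def openin_topology_generated_by_iff .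
  then show "?P S"
  proof induction
    case Empty show ?case by simp
  next
    case (Int S T)
    show ?case
    proof
      fix x assume "x \<in> S \<inter> T"
      then obtain d e where "d > 0" "e > 0"
        "\<And>y. (\<forall>b\<in>B. absv (?c y b - ?c x b) < d) \<Longrightarrow> y \<in> S"
        "\<And>y. (\<forall>b\<in>B. absv (?c y b - ?c x b) < e) \<Longrightarrow> y \<in> T"
        using Int.IH(1)[rule_format, of x] Int.IH(2)[rule_format, of x] by blast
      then show "\<exists>e>0. \<forall>y. (\<forall>b\<in>B. absv (?c y b - ?c x b) < e) \<longrightarrow> y \<in> S \<inter> T"
        by (intro exI[of _ "min d e"]) auto
    qed
  next
    case (UN K)
    show ?case
    proof
      fix x assume "x \<in> \<Union>K"
      then obtain s where s: "s \<in> K" "x \<in> s" by blast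
      then obtain e where "e > 0" "\<forall>y. (\<forall>b\<in>B. absv (?c y b - ?c x b) < e) \<longrightarrow> y \<in> s"
        using UN.IH[OF s(1)] by blast
      with s(1) show "\<exists>e>0. \<forall>y. (\<forall>b\<in>B. absv (?c y b - ?c x b) < e) \<longrightarrow> y \<in> \<Union>K"
        by blast
    qed
  next
    case (Basis s)
    then obtain l V where s: "s = l -` V" and l: "Vector_Spaces.linear smul (*) l"
      and V: "openin (field_topology absv) V" by (auto simp: dual_def)
    interpret l: Vector_Spaces.linear smul "(*)" l by fact
    show ?case
    proof
      fix x assume "x \<in> s"
      then obtain r where r: "r > 0" "\<And>z. absv (z - l x) < r \<Longrightarrow> z \<in> V"
        using V s unfolding openin_field_topology_iff by auto
      define M where "M = 1 + (\<Sum>b\<in>B. absv (l b))"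
      have M: "absv (l b) < M" if "b \<in> B" for b
        using member_le_sum[of b B "\<lambda>b. absv (l b)"] that finite_Basis absv_nonneg by (force simp: M_def)
      have M0: "M > 0" unfolding M_def by (simp add: absv_nonneg sum_nonneg add_pos_nonneg)
      have "y \<in> s" if y: "\<forall>b\<in>B. absv (?c y b - ?c x b) < r / M" for y
      proof -
        have e: "z = (\<Sum>b\<in>B. smul (?c z b) b)" for z
          using sum_representation_eq[of B z B] independent_Basis span_Basis finite_Basis by simp
        have lz: "l z = (\<Sum>b\<in>B. ?c z b * l b)" for z
          using arg_cong[OF e[of z], of l] by (simp add: l.sum l.scale)
        have "l y - l x = (\<Sum>b\<in>B. (?c y b - ?c x b) * l b)"
          by (simp add: lz[of y] lz[of x] sum_subtractf left_diff_distrib)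
        moreover have "absv ((?c y b - ?c x b) * l b) < r" if "b \<in> B" for b
        proof -
          have "absv (?c y b - ?c x b) * absv (l b) \<le> absv (?c y b - ?c x b) * M"
            using M[OF that] absv_nonneg by (simp add: mult_left_mono)
          also have "\<dots> < r" using y that M0 by (simp add: pos_less_divide_eq)
          finally show ?thesis by (simp add: absv_mult)
        qed
        ultimately have "absv (l y - l x) < r"
          using absv_sum_less[OF finite_Basis r(1), of "\<lambda>b. (?c y b - ?c x b) * l b"] by simp
        then show ?thesis using r(2) s by simp
      qed
      then show "\<exists>e>0. \<forall>y. (\<forall>b\<in>B. absv (?c y b - ?c x b) < e) \<longrightarrow> y \<in> s"
        using r(1) M0 by (intro exI[of _ "r / M"]) auto
    qed
  qed
next
  interpret finite_dimensional_vector_space smul B by fact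
  let ?c = "representation B"
  let ?T = "space_topology absv smul"
  interpret F: vector_space "(*) :: 'f \<Rightarrow> 'f \<Rightarrow> 'f"
    by unfold_locales (auto simp: algebra_simps)
  have lin: "(\<lambda>x. ?c x b) \<in> dual smul" for b
  proof -
    have "Vector_Spaces.linear smul (*) (\<lambda>x. ?c x b)"
      by unfold_locales
        (simp_all add: representation_add representation_scale independent_Basis span_Basis)
    then show ?thesis by (simp add: dual_def)
  qed
  have sub: "openin ?T (l -` V)" if "l \<in> dual smul" "openin (field_topology absv) V" for l V
    unfolding space_topology_def by (rule topology_generated_by_Basis) (use that in auto)
  assume P: "?P S"
  show "openin ?T S"
  proof (subst openin_subopen, intro ballI)
    fix x assume "x \<in> S"
    then obtain e where e: "e > 0" "\<And>y. (\<forall>b\<in>B. absv (?c y b - ?c x b) < e) \<Longrightarrow> y \<in> S"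
      using P by meson
    have ball: "openin (field_topology absv) {z. absv (z - a) < e}" for a
      unfolding openin_field_topology_iff
    proof
      fix z assume z: "z \<in> {z. absv (z - a) < e}"
      have "absv (y - a) < e" if "absv (y - z) < e" for y
        using absv_ultrametric[of "y - z" "z - a"] that z by simp
      then show "\<exists>r>0. \<forall>y. absv (y - z) < r \<longrightarrow> y \<in> {z. absv (z - a) < e}"
        using e(1) by auto
    qed
    have univ: "openin ?T UNIV"
      using sub[OF lin, of UNIV undefined] by (simp add: openin_field_topology_iff gt_ex)
    define N where "N = UNIV \<inter> (\<Inter>b\<in>B. (\<lambda>y. ?c y b) -` {z. absv (z - ?c x b) < e})"
    have "openin ?T N"
    proof (cases "B = {}")
      case True then show ?thesis using univ by (simp add: N_def)
    next
      case False
      then show ?thesis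
        using openin_Inter[of "(\<lambda>b. (\<lambda>y. ?c y b) -` {z. absv (z - ?c x b) < e}) ` B" ?T]
          finite_Basis sub[OF lin ball] by (auto simp: N_def)
    qed
    moreover have "x \<in> N" "N \<subseteq> S"
      using e by (auto simp: N_def absv_zero)
    ultimately show "\<exists>T. openin ?T T \<and> x \<in> T \<and> T \<subseteq> S" by blast
  qed
qed

end

end

theory Submission
  imports Defs "HOL-Algebra.Sylow" "HOL-Algebra.Multiplicative_Group"
begin

text \<open>With the symmetrised Weyl operators \<open>V(v, v\<^sup>*) \<Phi>(x) = \<chi>(v\<^sup>*(x) + v\<^sup>*(v)/2) \<Phi>(x + v)\<close>, the condition
  \<open>\<mu>(\<sigma>) = \<pi>\<^sub>0(s)\<close> becomes \<open>s V(w) = V(\<sigma> w) s\<close>. The kernel is then given by a form of Schur's lemma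
  valid over any domain. For surjectivity, the \<open>\<sigma>\<close> that can be implemented form a group. It contains the
  transvections along \<open>(0, e)\<close>, implemented by multiplication with \<open>\<chi>(-k e\<^sup>2/2)\<close>, and the plane
  rotations exchanging a vector v with a form l such that \<open>l(v) = 1\<close>, implemented by a partial
  Fourier transform; conjugation yields all transvections, and these generate the symplectic group.
  Inversion of the Fourier transform comes for free from Schur's lemma: the double transform is a
  scalar, computed on one test function, and it is a unit because the indices of lattices in
  F only involve primes that are invertible in R.\<close>

section \<open>Sums over cosets\<close>

text \<open>Over a domain two tools of the complex theory are missing: a Haar measure with real
  values, and unitarity. The measure is replaced by counting cosets of small balls. The arithmetic
  input is that a finite quotient of two lattices of F is killed by a power of p, so that its order
  is a unit of R by Cauchy's theorem. Only one direction of X is transformed at a time, which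
  confines this integral to F. Unitarity is replaced by applying Schur's lemma to the pair of signs
  \<epsilon> and -\<epsilon>, whose rotations are inverse to each other. The symmetrisation is what
  removes \<open>f_quad\<close>: the operators V(w) compose with the cocycle chi(omega/2), which
  depends on the symplectic form alone, whereas the cocycle of \<open>U_op\<close> involves the
  non-invariant form \<open>form_B\<close>, and \<open>f_quad\<close> measures the defect.\<close>

definition add_subgroup :: "'a::ab_group_add set \<Rightarrow> bool" where
  "add_subgroup L \<longleftrightarrow> 0 \<in> L \<and> (\<forall>x\<in>L. \<forall>y\<in>L. x - y \<in> L)"

lemma add_subgroupD:
  assumes "add_subgroup L"
  shows "0 \<in> L"
    and "x \<in> L \<Longrightarrow> - x \<in> L"
    and "x \<in> L \<Longrightarrow> y \<in> L \<Longrightarrow> x + y \<in> L"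
    and "x \<in> L \<Longrightarrow> y \<in> L \<Longrightarrow> x - y \<in> L"
proof -
  show 0: "0 \<in> L" and diff: "\<And>x y. x \<in> L \<Longrightarrow> y \<in> L \<Longrightarrow> x - y \<in> L"
    using assms by (auto simp: add_subgroup_def)
  show uminus: "\<And>x. x \<in> L \<Longrightarrow> - x \<in> L"
    using diff[OF 0] by force
  show "x \<in> L \<Longrightarrow> y \<in> L \<Longrightarrow> x + y \<in> L"
    using diff[of x "- y"] uminus[of y] by simp
qed

definition coset_rep :: "'a::ab_group_add set \<Rightarrow> 'a \<Rightarrow> 'a" where
  "coset_rep L x = (SOME y. y - x \<in> L)"

definition periodic :: "'a::ab_group_add set \<Rightarrow> ('a \<Rightarrow> 'r) \<Rightarrow> bool" where
  "periodic L \<phi> \<longleftrightarrow> (\<forall>x. \<forall>y\<in>L. \<phi> (x + y) = \<phi> x)"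

lemma periodicD: "periodic L \<phi> \<Longrightarrow> y \<in> L \<Longrightarrow> \<phi> (x + y) = \<phi> x"
  unfolding periodic_def by blast

lemma periodic_mono: "periodic L \<phi> \<Longrightarrow> L' \<subseteq> L \<Longrightarrow> periodic L' \<phi>"
  unfolding periodic_def by blast

text \<open>Meant for L-periodic \<open>\<phi>\<close>, where the choice of representatives does not
  matter. Restricting the index to the support makes the sum finite as soon as \<open>\<phi>\<close>
  lives on finitely many cosets.\<close>

definition coset_sum :: "'a::ab_group_add set \<Rightarrow> ('a \<Rightarrow> 'r::comm_ring_1) \<Rightarrow> 'r" where
  "coset_sum L \<phi> = (\<Sum>c\<in>{c \<in> range (coset_rep L). \<phi> c \<noteq> 0}. \<phi> c)"

definition finite_mod :: "'a::ab_group_add set \<Rightarrow> 'a set \<Rightarrow> bool" where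
  "finite_mod L K \<longleftrightarrow> finite (coset_rep L ` K)"

lemma finite_mod_subset: "finite_mod L K \<Longrightarrow> K' \<subseteq> K \<Longrightarrow> finite_mod L K'"
  unfolding finite_mod_def by (meson finite_subset image_mono)

lemma finite_mod_Un: "finite_mod L K \<Longrightarrow> finite_mod L K' \<Longrightarrow> finite_mod L (K \<union> K')"
  unfolding finite_mod_def by (simp add: image_Un)

context
  fixes L :: "'a::ab_group_add set"
  assumes L: "add_subgroup L"
begin

lemma coset_rep_mem: "coset_rep L x - x \<in> L"
  unfolding coset_rep_def by (rule someI[of _ x]) (simp add: add_subgroupD(1)[OF L])

lemma coset_rep_eq_iff: "coset_rep L x = coset_rep L y \<longleftrightarrow> x - y \<in> L"
proof
  assume "coset_rep L x = coset_rep L y"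
  then show "x - y \<in> L"
    using add_subgroupD(4)[OF L coset_rep_mem[of y] coset_rep_mem[of x]] by (simp add: algebra_simps)
next
  assume xy: "x - y \<in> L"
  have "z - x \<in> L \<longleftrightarrow> z - y \<in> L" for z
    using add_subgroupD(3)[OF L _ xy, of "z - x"] add_subgroupD(4)[OF L _ xy, of "z - y"] by auto
  then show "coset_rep L x = coset_rep L y"
    unfolding coset_rep_def by simp
qed

lemma coset_rep_idem: "c \<in> range (coset_rep L) \<Longrightarrow> coset_rep L c = c"
  using coset_rep_mem coset_rep_eq_iff by auto

lemma inj_on_coset_rep: "inj_on (\<lambda>x. {y. y - x \<in> L}) (range (coset_rep L))"
proof (rule inj_onI)
  fix c d assume cd: "c \<in> range (coset_rep L)" "d \<in> range (coset_rep L)" "{y. y - c \<in> L} = {y. y - d \<in> L}"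
  have "c \<in> {y. y - c \<in> L}" using add_subgroupD(1)[OF L] by simp
  then have "c - d \<in> L" unfolding cd(3) by simp
  then have "coset_rep L c = coset_rep L d" by (simp add: coset_rep_eq_iff)
  then show "c = d" by (simp only: coset_rep_idem[OF cd(1)] coset_rep_idem[OF cd(2)])
qed

lemma periodic_coset_rep: "periodic L \<phi> \<Longrightarrow> \<phi> (coset_rep L x) = \<phi> x"
  unfolding periodic_def using coset_rep_mem[of x] by (metis add.commute diff_add_cancel)

lemma coset_rep_image_memI:
  assumes "c \<in> range (coset_rep L)" "c \<in> K"
  shows "c \<in> coset_rep L ` K"
  using coset_rep_idem[OF assms(1)] assms(2) by (metis imageI)

lemma coset_sum_eq:
  assumes "finite_mod L K" "\<And>x. x \<notin> K \<Longrightarrow> \<phi> x = 0"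
  shows "coset_sum L \<phi> = sum \<phi> (coset_rep L ` K)"
  unfolding coset_sum_def
proof (rule sum.mono_neutral_left)
  show "finite (coset_rep L ` K)" using assms(1) by (simp add: finite_mod_def)
  show "{c \<in> range (coset_rep L). \<phi> c \<noteq> 0} \<subseteq> coset_rep L ` K"
    using assms(2) coset_rep_image_memI by blast
qed auto

lemma coset_sum_add:
  assumes "finite_mod L {x. \<phi> x \<noteq> 0}" "finite_mod L {x. \<psi> x \<noteq> 0}"
  shows "coset_sum L (\<lambda>x. \<phi> x + \<psi> x) = coset_sum L \<phi> + coset_sum L \<psi>"
proof -
  have K: "finite_mod L ({x. \<phi> x \<noteq> 0} \<union> {x. \<psi> x \<noteq> 0})"
    using finite_mod_Un[OF assms] .
  show ?thesis
    by (subst (1 2 3) coset_sum_eq[OF K]) (auto simp: sum.distrib)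
qed

lemma coset_sum_mult:
  assumes "finite_mod L {x. \<phi> x \<noteq> 0}"
  shows "coset_sum L (\<lambda>x. c * \<phi> x) = c * coset_sum L \<phi>"
  by (subst (1 2) coset_sum_eq[OF assms]) (auto simp: sum_distrib_left)

text \<open>Translation permutes the cosets. On representatives the permutation is
  \<open>coset_rep L (c + h)\<close>, and periodicity absorbs its difference from c + h.\<close>

lemma coset_sum_translate:
  assumes "periodic L \<phi>"
  shows "coset_sum L (\<lambda>x. \<phi> (x + h)) = coset_sum L \<phi>"
  unfolding coset_sum_def
proof (rule sum.reindex_bij_witness[where i = "\<lambda>c. coset_rep L (c - h)" and j = "\<lambda>c. coset_rep L (c + h)"])
  have eq: "coset_rep L (coset_rep L (c + h) - h) = c" if "c \<in> range (coset_rep L)" for c h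
    using coset_rep_mem[of "c + h"] coset_rep_eq_iff[of "coset_rep L (c + h) - h" c] coset_rep_idem[OF that]
    by (simp add: algebra_simps)
  show "coset_rep L (coset_rep L (c + h) - h) = c"
    if "c \<in> {c \<in> range (coset_rep L). \<phi> (c + h) \<noteq> 0}" for c using eq that by blast
  show "coset_rep L (coset_rep L (c - h) + h) = c"
    if "c \<in> {c \<in> range (coset_rep L). \<phi> c \<noteq> 0}" for c using eq[of c "-h"] that by simp
  have p: "\<phi> (coset_rep L x) = \<phi> x" for x
    using periodic_coset_rep[OF assms] .
  show "\<phi> (coset_rep L (c + h)) = \<phi> (c + h)" for c by (rule p)
  show "coset_rep L (c + h) \<in> {c \<in> range (coset_rep L). \<phi> c \<noteq> 0}"
    if "c \<in> {c \<in> range (coset_rep L). \<phi> (c + h) \<noteq> 0}" for c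
    using that p by simp
  show "coset_rep L (c - h) \<in> {c \<in> range (coset_rep L). \<phi> (c + h) \<noteq> 0}"
    if c: "c \<in> {c \<in> range (coset_rep L). \<phi> c \<noteq> 0}" for c
  proof -
    have "\<phi> (coset_rep L (c - h) + h) = \<phi> c"
      using p[of "coset_rep L (c - h) + h"] eq[of c "-h"] c by simp
    then show ?thesis using c by simp
  qed
qed

lemma coset_decomposition:
  fixes \<phi> :: "'a \<Rightarrow> 'r::comm_ring_1"
  assumes "periodic L \<phi>" "finite_mod L {x. \<phi> x \<noteq> 0}"
  shows "\<phi> x = (\<Sum>c\<in>coset_rep L ` {x. \<phi> x \<noteq> 0}. \<phi> c * of_bool (x - c \<in> L))"
proof -
  let ?A = "coset_rep L ` {x. \<phi> x \<noteq> 0}"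
  have fin: "finite ?A" using assms(2) by (simp add: finite_mod_def)
  have "x - c \<in> L \<longleftrightarrow> c = coset_rep L x" if "c \<in> ?A" for c
    using that coset_rep_eq_iff[of x c] coset_rep_idem[of c] by auto
  then have "(\<Sum>c\<in>?A. \<phi> c * of_bool (x - c \<in> L)) = (\<Sum>c\<in>?A. if c = coset_rep L x then \<phi> c else 0)"
    by (intro sum.cong) auto
  also have "\<dots> = \<phi> x"
    using periodic_coset_rep[OF assms(1)] by (auto simp: sum.delta[OF fin])
  finally show ?thesis by simp
qed

lemma coset_sum_indicator:
  assumes "finite_mod L M" and M: "\<And>x y. x \<in> M \<Longrightarrow> y \<in> L \<Longrightarrow> x + y \<in> M"
  shows "coset_sum L (\<lambda>x. of_bool (x \<in> M)) = of_nat (card (coset_rep L ` M))"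
proof -
  have "c \<in> M" if "c \<in> coset_rep L ` M" for c
    using that M coset_rep_mem by (metis add.commute diff_add_cancel imageE)
  then show ?thesis
    using coset_sum_eq[OF assms(1), of "\<lambda>x. of_bool (x \<in> M)"] by simp
qed

end

text \<open>Expand \<open>\<phi>\<close> in indicators of cosets of L and exchange the sums: by
  translation invariance every coset of L contains equally many cosets of L'. When finite, the index
  of L' in L, read in the ring, is the factor on the right.\<close>

lemma coset_sum_refine:
  assumes L: "add_subgroup L" and L': "add_subgroup L'" and "L' \<subseteq> L"
    and per: "periodic L \<phi>" and fin': "finite_mod L' {x. \<phi> x \<noteq> 0}"
  shows "coset_sum L' \<phi> = coset_sum L' (\<lambda>x. of_bool (x \<in> L)) * coset_sum L \<phi>"
proof -
  let ?K = "{x. \<phi> x \<noteq> 0}"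
  let ?A' = "coset_rep L' ` ?K" and ?A = "coset_rep L ` ?K"
  have "coset_rep L (coset_rep L' x) = coset_rep L x" for x
    using coset_rep_mem[OF L', of x] assms(3) by (auto simp: coset_rep_eq_iff[OF L])
  then have "?A = coset_rep L ` ?A'" by (simp add: image_image)
  then have fin: "finite_mod L ?K" using fin' by (simp add: finite_mod_def)
  have "coset_sum L' \<phi> = (\<Sum>d\<in>?A'. \<phi> d)" by (rule coset_sum_eq[OF L' fin']) simp
  also have "\<dots> = (\<Sum>d\<in>?A'. \<Sum>c\<in>?A. \<phi> c * of_bool (d - c \<in> L))"
    by (intro sum.cong[OF refl] coset_decomposition[OF L per fin])
  also have "\<dots> = (\<Sum>c\<in>?A. \<phi> c * (\<Sum>d\<in>?A'. of_bool (d - c \<in> L)))"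
    by (subst sum.swap) (simp add: sum_distrib_left)
  also have "\<dots> = (\<Sum>c\<in>?A. \<phi> c * coset_sum L' (\<lambda>x. of_bool (x \<in> L)))"
  proof (intro sum.cong[OF refl] arg_cong[where f = "(*) _"])
    fix c assume "c \<in> ?A"
    then have c: "\<phi> c \<noteq> 0" using periodic_coset_rep[OF L per] by auto
    \<comment> \<open>The support of \<open>\<phi>\<close> is a union of cosets of L, so the index
      set \<open>?A'\<close> already contains every representative lying in c + L.\<close>
    have "\<phi> x \<noteq> 0" if "x - c \<in> L" for x
      using per c that unfolding periodic_def by (metis add.commute diff_add_cancel)
    then have "(\<Sum>d\<in>?A'. of_bool (d - c \<in> L)) = coset_sum L' (\<lambda>x. of_bool (x + (- c) \<in> L) :: 'b)"
      by (subst coset_sum_eq[OF L' fin']) auto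
    also have "\<dots> = coset_sum L' (\<lambda>x. of_bool (x \<in> L))"
    proof (rule coset_sum_translate[OF L'])
      have "x + y \<in> L \<longleftrightarrow> x \<in> L" if "y \<in> L'" for x y
        using that assms(3) add_subgroupD(3,4)[OF L, of _ y] by fastforce
      then show "periodic L' (\<lambda>x. of_bool (x \<in> L) :: 'b)" by (simp add: periodic_def)
    qed
    finally show "(\<Sum>d\<in>?A'. of_bool (d - c \<in> L)) = coset_sum L' (\<lambda>x. of_bool (x \<in> L) :: 'b)" .
  qed
  also have "\<dots> = coset_sum L' (\<lambda>x. of_bool (x \<in> L)) * coset_sum L \<phi>"
    using coset_sum_eq[OF L fin, of \<phi>] by (simp add: sum_distrib_right[symmetric] mult.commute)
  finally show ?thesis .
qed

section \<open>Orders of finite groups as units of the coefficient ring\<close>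

lemma of_nat_unit_if_prime_divisors_unit:
  assumes "N > 0" "\<And>l. prime l \<Longrightarrow> l dvd N \<Longrightarrow> (of_nat l :: 'r::comm_semiring_1) dvd 1"
  shows "(of_nat N :: 'r) dvd 1"
  using assms
proof (induction N rule: prime_divisors_induct)
  case (factor l N)
  have "(of_nat N :: 'r) dvd 1" using factor by auto
  moreover have "(of_nat l :: 'r) dvd 1" using factor by auto
  ultimately show ?case using mult_dvd_mono[of "of_nat l :: 'r" 1 "of_nat N" 1] by simp
qed auto

text \<open>By Cauchy's theorem every prime divisor of the order divides the exponent n, and a
  divisor of a unit is a unit. Thus the order is a unit although its value stays unknown.\<close>

lemma (in group) order_unit_if_exponent_unit:
  assumes "finite (carrier G)" "\<And>x. x \<in> carrier G \<Longrightarrow> x [^] n = \<one>"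
    and n: "(of_nat n :: 'r::comm_semiring_1) dvd 1"
  shows "(of_nat (order G) :: 'r) dvd 1"
proof (rule of_nat_unit_if_prime_divisors_unit)
  show "order G > 0" using assms(1) order_gt_0_iff_finite by blast
  fix l assume l: "prime l" "l dvd order G"
  show "(of_nat l :: 'r) dvd 1"
  proof (rule ccontr)
    assume nl: "\<not> (of_nat l :: 'r) dvd 1"
    have "\<not> l dvd n"
    proof
      assume "l dvd n"
      then have "(of_nat l :: 'r) dvd of_nat n" by (auto simp: dvd_def)
      with n nl show False using dvd_trans by blast
    qed
    then have cop: "coprime l n" using l(1) prime_imp_coprime by blast
    \<comment> \<open>Sylow's theorem with exponent 1 gives a subgroup of order exactly l, which is
      Cauchy's theorem.\<close>
    obtain m where "order G = l ^ 1 * m" using l(2) by auto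
    then obtain H where H: "subgroup H G" "card H = l ^ 1"
      using sylow_thm[OF l(1) is_group _ assms(1)] by blast
    have "\<exists>x\<in>H. x \<noteq> \<one>"
    proof (rule ccontr)
      assume "\<not> (\<exists>x\<in>H. x \<noteq> \<one>)"
      then have "H \<subseteq> {\<one>}" by blast
      then have "card H \<le> 1" using card_mono[of "{\<one>}" H] by simp
      with H(2) prime_gt_1_nat[OF l(1)] show False by simp
    qed
    then obtain x where x: "x \<in> H" "x \<noteq> \<one>" by blast
    have xG: "x \<in> carrier G" by (rule subgroup.mem_carrier[OF H(1) x(1)])
    interpret H: group "G\<lparr>carrier := H\<rparr>" by (rule subgroup_imp_group[OF H(1)])
    have "order (G\<lparr>carrier := H\<rparr>) = l" using H(2) by (simp add: order_def)
    moreover have "x [^]\<^bsub>G\<lparr>carrier := H\<rparr>\<^esub> order (G\<lparr>carrier := H\<rparr>) = \<one>\<^bsub>G\<lparr>carrier := H\<rparr>\<^esub>"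
      by (rule H.pow_order_eq_1) (simp add: x(1))
    ultimately have "x [^] l = \<one>"
      unfolding nat_pow_consistent[of x l H] by simp
    then have "ord x dvd l" "ord x dvd n"
      using assms(2)[OF xG] xG by (simp_all add: pow_eq_id)
    with cop have "ord x = 1" using coprime_common_divisor_nat by blast
    with x(2) xG show False using ord_eq_1[OF xG] by blast
  qed
qed

text \<open>The quotient M / L is killed by n, so the bound through exponents applies to it. The
  additive group is recast as a monoid record to reach quotient groups, whose elements are then
  matched with coset representatives.\<close>

lemma coset_count_unit:
  fixes L M :: "'a::comm_ring_1 set"
  assumes L: "add_subgroup L" and M: "add_subgroup M" and "L \<subseteq> M" "finite_mod L M"
    and exp: "\<And>x. x \<in> M \<Longrightarrow> of_nat n * x \<in> L"
    and n: "(of_nat n :: 'r::comm_semiring_1) dvd 1"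
  shows "(of_nat (card (coset_rep L ` M)) :: 'r) dvd 1"
proof -
  define G where "G = \<lparr>carrier = M, mult = (+), one = (0::'a)\<rparr>"
  have "comm_group G"
  proof (rule comm_groupI)
    show "\<exists>y\<in>carrier G. y \<otimes>\<^bsub>G\<^esub> x = \<one>\<^bsub>G\<^esub>" if "x \<in> carrier G" for x
      using add_subgroupD(2)[OF M, of x] that by (intro bexI[of _ "- x"]) (auto simp: G_def)
  qed (use add_subgroupD[OF M] in \<open>auto simp: G_def algebra_simps\<close>)
  then interpret G: comm_group G .
  have inv: "inv\<^bsub>G\<^esub> x = - x" if "x \<in> M" for x
    by (rule G.inv_equality) (use add_subgroupD[OF M] that in \<open>auto simp: G_def\<close>)
  have "subgroup L G"
    by (rule G.subgroupI) (use add_subgroupD[OF L] \<open>L \<subseteq> M\<close> inv in \<open>auto simp: G_def\<close>)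
  then interpret N: normal L G by (rule G.subgroup_imp_normal)
  interpret Q: group "G Mod L" by (rule N.factorgroup_is_group)
  have coset: "L #>\<^bsub>G\<^esub> x = {y. y - x \<in> L}" for x
  proof -
    have "\<exists>h\<in>L. y = h + x" if "y - x \<in> L" for y
      using that by (intro bexI[of _ "y - x"]) auto
    then show ?thesis by (auto simp: r_coset_def G_def)
  qed
  have Q: "carrier (G Mod L) = (\<lambda>x. {y. y - x \<in> L}) ` coset_rep L ` M"
  proof -
    have "{y. y - coset_rep L x \<in> L} = {y. y - x \<in> L}" for x
    proof (intro Collect_cong)
      fix y
      show "y - coset_rep L x \<in> L \<longleftrightarrow> y - x \<in> L"
        using add_subgroupD(3)[OF L _ coset_rep_mem[OF L, of x], of "y - coset_rep L x"]
          add_subgroupD(4)[OF L _ coset_rep_mem[OF L, of x], of "y - x"] by auto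
    qed
    then show ?thesis
      by (simp add: carrier_FactGroup coset image_image) (simp add: G_def)
  qed
  have "inj_on (\<lambda>x. {y. y - x \<in> L}) (coset_rep L ` M)"
    by (rule inj_on_subset[OF inj_on_coset_rep[OF L] image_mono[OF subset_UNIV]])
  then have "order (G Mod L) = card (coset_rep L ` M)"
    unfolding order_def Q by (rule card_image)
  moreover have "(of_nat (order (G Mod L)) :: 'r) dvd 1"
  proof (rule Q.order_unit_if_exponent_unit[OF _ _ n])
    show "finite (carrier (G Mod L))" using assms(4) Q by (simp add: finite_mod_def)
    fix C assume "C \<in> carrier (G Mod L)"
    then obtain x where x: "x \<in> M" "C = L #>\<^bsub>G\<^esub> x" by (auto simp: carrier_FactGroup G_def)
    have pow: "x [^]\<^bsub>G\<^esub> k = of_nat k * x" for k :: nat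
      by (induction k) (simp_all add: G_def nat_pow_def algebra_simps)
    have "C [^]\<^bsub>G Mod L\<^esub> n = L #>\<^bsub>G\<^esub> (of_nat n * x)"
      using N.FactGroup_pow[of x n] x pow by (simp add: G_def)
    also have "\<dots> = L"
      by (rule N.rcos_const[OF G.is_group exp[OF x(1)]])
    finally show "C [^]\<^bsub>G Mod L\<^esub> n = \<one>\<^bsub>G Mod L\<^esub>" by simp
  qed
  ultimately show ?thesis by simp
qed

section \<open>Balls in the field and in finite-dimensional spaces\<close>

text \<open>The cosets of L form an open cover of K, and a finite subcover names the finitely many
  cosets that K meets.\<close>

lemma finite_mod_compact:
  assumes L: "add_subgroup L" and K: "compactin T K" and "\<And>x. openin T {y. y - x \<in> L}"
  shows "finite_mod L K"
proof -
  have "K \<subseteq> \<Union>(range (\<lambda>x. {y. y - x \<in> L}))"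
  proof
    fix y assume "y \<in> K"
    have "y \<in> {z. z - y \<in> L}" using add_subgroupD(1)[OF L] by simp
    then show "y \<in> \<Union>(range (\<lambda>x. {y. y - x \<in> L}))" by blast
  qed
  then obtain \<F> where "finite \<F>" "\<F> \<subseteq> range (\<lambda>x. {y. y - x \<in> L})" "K \<subseteq> \<Union>\<F>"
    using compactinD[OF K, of "range (\<lambda>x. {y. y - x \<in> L})"] assms(3) by blast
  then obtain A where "finite A" "\<F> = (\<lambda>x. {y. y - x \<in> L}) ` A"
    using finite_subset_image[of \<F> "\<lambda>x. {y. y - x \<in> L}" UNIV] by blast
  with \<open>K \<subseteq> \<Union>\<F>\<close> have A: "finite A" "K \<subseteq> (\<Union>x\<in>A. {y. y - x \<in> L})" by simp_all
  have "coset_rep L ` K \<subseteq> coset_rep L ` A"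
  proof
    fix c assume "c \<in> coset_rep L ` K"
    then obtain y x where "c = coset_rep L y" "x \<in> A" "y - x \<in> L" using A(2) by auto
    then have "c = coset_rep L x" by (simp add: coset_rep_eq_iff[OF L])
    with \<open>x \<in> A\<close> show "c \<in> coset_rep L ` A" by (rule rev_image_eqI)
  qed
  with A(1) show ?thesis unfolding finite_mod_def by (meson finite_imageI finite_subset)
qed

context nonarch_abs_value
begin

lemma absv_diff_le: "absv (x - y) \<le> max (absv x) (absv y)"
  using absv_ultrametric[of x "- y"] by (simp add: absv_minus)

lemma absv_pos: "x \<noteq> 0 \<Longrightarrow> 0 < absv x"
  using absv_nonneg[of x] absv_eq_0_iff[of x] by linarith

lemma absv_power: "absv (x ^ n) = absv x ^ n"
  by (induction n) (simp_all add: absv_one absv_mult)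

lemma absv_divide: "absv (x / y) = absv x / absv y"
proof (cases "y = 0")
  case False
  then have "absv (x / y) * absv y = absv x" by (simp flip: absv_mult)
  with False show ?thesis by (simp add: absv_eq_0_iff eq_divide_eq)
qed (simp add: absv_zero)

lemma absv_sqrt_1: "x * x = 1 \<Longrightarrow> absv x = 1"
  using absv_one absv_minus[of 1] by (auto simp: square_eq_1_iff)

lemma absv_of_nat: "absv (of_nat n) \<le> 1"
proof (induction n)
  case (Suc n)
  then show ?case using absv_ultrametric[of 1 "of_nat n"] by (simp add: absv_one)
qed (simp add: absv_zero)

lemma add_subgroup_ball: "0 \<le> r \<Longrightarrow> add_subgroup {x. absv x \<le> r}"
  unfolding add_subgroup_def
proof (intro conjI ballI)
  fix x y assume "x \<in> {x. absv x \<le> r}" "y \<in> {x. absv x \<le> r}"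
  then show "x - y \<in> {x. absv x \<le> r}" using absv_diff_le[of x y] by simp
qed (simp add: absv_zero)

lemma add_subgroup_open_ball: "0 < r \<Longrightarrow> add_subgroup {x. absv x < r}"
  unfolding add_subgroup_def
proof (intro conjI ballI)
  fix x y assume "x \<in> {x. absv x < r}" "y \<in> {x. absv x < r}"
  then show "x - y \<in> {x. absv x < r}" using absv_diff_le[of x y] by simp
qed (simp add: absv_zero)

lemma openin_field_add_subgroup_coset:
  assumes L: "add_subgroup L" and r: "0 < r" "\<And>x. absv x < r \<Longrightarrow> x \<in> L"
  shows "openin (field_topology absv) {y. y - x \<in> L}"
  unfolding openin_field_topology_iff
proof
  fix z assume z: "z \<in> {y. y - x \<in> L}"
  have "y \<in> {y. y - x \<in> L}" if "absv (y - z) < r" for y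
    using add_subgroupD(3)[OF L r(2)[OF that]] z by fastforce
  then show "\<exists>r>0. \<forall>y. absv (y - z) < r \<longrightarrow> y \<in> {y. y - x \<in> L}" using r(1) by blast
qed

lemma topspace_field: "topspace (field_topology absv) = UNIV"
proof -
  have "openin (field_topology absv) UNIV" by (simp add: openin_field_topology_iff gt_ex)
  then show ?thesis using openin_subset by blast
qed

text \<open>By the ultrametric inequality a point closer to x than |x| has absolute value at least
  |x|, so the complement is open.\<close>

lemma closedin_ball: "closedin (field_topology absv) {x. absv x \<le> r}"
proof -
  have "openin (field_topology absv) {x. r < absv x}"
    unfolding openin_field_topology_iff
  proof
    fix x assume x: "x \<in> {x. r < absv x}"
    show "\<exists>e>0. \<forall>y. absv (y - x) < e \<longrightarrow> y \<in> {x. r < absv x}"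
    proof (cases "r < 0")
      case True
      then have "y \<in> {x. r < absv x}" for y using absv_nonneg[of y] by simp
      then show ?thesis by (meson zero_less_one)
    next
      case False
      have "y \<in> {x. r < absv x}" if "absv (y - x) < absv x" for y
      proof -
        have "absv (y - (y - x)) \<le> max (absv y) (absv (y - x))" by (rule absv_diff_le)
        with that x show ?thesis by simp
      qed
      with False x show ?thesis by (intro exI[of _ "absv x"]) auto
    qed
  qed
  moreover have "UNIV - {x. absv x \<le> r} = {x. r < absv x}" by auto
  ultimately show ?thesis by (simp add: closedin_def topspace_field)
qed

end

context nonarch_local_field
begin

text \<open>Otherwise the open unit ball around each point is that point alone and the topology is
  discrete.\<close>

lemma ex_absv_small: "\<exists>a. a \<noteq> 0 \<and> absv a < 1"
proof (rule ccontr)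
  assume "\<not> (\<exists>a. a \<noteq> 0 \<and> absv a < 1)"
  then have "y = x" if "absv (y - x) < 1" for x y
    using that by (metis right_minus_eq)
  then have "openin (field_topology absv) V" for V
    unfolding openin_field_topology_iff by (metis zero_less_one)
  then have "field_topology absv = discrete_topology UNIV"
    by (simp add: topology_eq)
  with non_discrete show False by simp
qed

lemma ex_absv_less: assumes "0 < r" shows "\<exists>a. a \<noteq> 0 \<and> absv a < r"
proof -
  obtain a where a: "a \<noteq> 0" "absv a < 1" using ex_absv_small by blast
  obtain n where "absv a ^ n < r" using real_arch_pow_inv[OF assms a(2)] by blast
  with a(1) show ?thesis by (intro exI[of _ "a ^ n"]) (simp add: absv_power)
qed

lemma ex_absv_greater: "\<exists>a. a \<noteq> 0 \<and> r < absv a"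
proof -
  define m where "m = max r 1"
  have m: "0 < m" "r \<le> m" by (auto simp: m_def)
  obtain a where a: "a \<noteq> 0" "absv a < 1 / m" using ex_absv_less[of "1 / m"] m(1) by auto
  then have "m < 1 / absv a" using m(1) absv_pos[OF a(1)] by (simp add: field_simps)
  then have "r < absv (1 / a)" using m(2) by (simp add: absv_divide absv_one)
  with a(1) show ?thesis by (intro exI[of _ "1 / a"]) simp
qed

text \<open>Local compactness supplies a single compact neighbourhood of 0. Multiplication by a
  large scalar spreads it over the given ball, which is closed in the compact image.\<close>

lemma compactin_ball: "compactin (field_topology absv) {x. absv x \<le> R}"
proof -
  let ?T = "field_topology absv"
  obtain U K where U: "openin ?T U" "0 \<in> U" and K: "compactin ?T K" "U \<subseteq> K"
    using locally_compact unfolding locally_compact_space_def topspace_field by blast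
  obtain r where r: "r > 0" "\<And>y. absv y < r \<Longrightarrow> y \<in> U"
    using U unfolding openin_field_topology_iff by fastforce
  obtain a where a: "a \<noteq> 0" "R / r < absv a" using ex_absv_greater by blast
  have "continuous_map ?T ?T (\<lambda>x. a * x)"
    unfolding continuous_map_def topspace_field
  proof (intro conjI allI impI)
    fix V assume V: "openin ?T V"
    show "openin ?T {x \<in> UNIV. a * x \<in> V}"
      unfolding openin_field_topology_iff
    proof
      fix x assume "x \<in> {x \<in> UNIV. a * x \<in> V}"
      then obtain e where e: "e > 0" "\<And>y. absv (y - a * x) < e \<Longrightarrow> y \<in> V"
        using V unfolding openin_field_topology_iff by fastforce
      have "a * y \<in> V" if "absv (y - x) < e / absv a" for y
      proof (rule e(2))
        have "absv (a * y - a * x) = absv a * absv (y - x)"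
          by (simp add: right_diff_distrib flip: absv_mult)
        then show "absv (a * y - a * x) < e" using that absv_pos[OF a(1)] by (simp add: field_simps)
      qed
      then show "\<exists>r>0. \<forall>y. absv (y - x) < r \<longrightarrow> y \<in> {x \<in> UNIV. a * x \<in> V}"
        using e(1) absv_pos[OF a(1)] by (intro exI[of _ "e / absv a"]) auto
    qed
  qed auto
  then have "compactin ?T ((\<lambda>x. a * x) ` K)" by (rule image_compactin[OF K(1)])
  moreover have "{x. absv x \<le> R} \<subseteq> (\<lambda>x. a * x) ` K"
  proof
    fix x assume "x \<in> {x. absv x \<le> R}"
    then have "absv (x / a) < r"
      using a absv_pos[OF a(1)] r(1) by (simp add: absv_divide field_simps)
    then have "x / a \<in> K" using r(2) K(2) by blast
    then show "x \<in> (\<lambda>x. a * x) ` K" using a(1) by (intro image_eqI[of _ _ "x / a"]) auto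
  qed
  ultimately show ?thesis by (rule closed_compactin[OF _ _ closedin_ball])
qed

lemma finite_mod_field_ball:
  assumes "add_subgroup L" "0 < r" "\<And>x. absv x < r \<Longrightarrow> x \<in> L"
  shows "finite_mod L {x. absv x \<le> R}"
  using finite_mod_compact[OF assms(1) compactin_ball] openin_field_add_subgroup_coset[OF assms] .

section \<open>The residue characteristic has absolute value less than 1\<close>

lemma add_pow_residue_field:
  "add_pow (residue_field absv) n \<one>\<^bsub>residue_field absv\<^esub> = {y. absv (y - of_nat n) < 1}"
proof -
  have one: "\<one>\<^bsub>residue_field absv\<^esub> = {y. absv (y - 1) < 1}"
  proof -
    have "\<exists>h. absv h < 1 \<and> y = h + 1" if "absv (y - 1) < 1" for y
      using that by (intro exI[of _ "y - 1"]) simp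
    then show ?thesis
      by (auto simp: residue_field_def valuation_ring_def FactRing_def a_r_coset_def r_coset_def)
  qed
  have add: "A \<oplus>\<^bsub>residue_field absv\<^esub> C = {a + c | a c. a \<in> A \<and> c \<in> C}" for A C
    by (auto simp: residue_field_def valuation_ring_def FactRing_def set_add_def set_mult_def)
  show ?thesis
  proof (induction n)
    case 0
    then show ?case
      by (simp add: add_pow_def nat_pow_def residue_field_def FactRing_def)
  next
    case (Suc n)
    have "add_pow (residue_field absv) (Suc n) \<one>\<^bsub>residue_field absv\<^esub>
        = {a + c | a c. absv (a - of_nat n) < 1 \<and> absv (c - 1) < 1}"
      using Suc add one by (simp add: add_pow_def nat_pow_def)
    also have "\<dots> = {y. absv (y - of_nat (Suc n)) < 1}"
    proof (intro subset_antisym subsetI)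
      fix y assume "y \<in> {a + c | a c. absv (a - of_nat n) < 1 \<and> absv (c - 1) < 1}"
      then obtain a c where "y = a + c" "absv (a - of_nat n) < 1" "absv (c - 1) < 1" by blast
      then show "y \<in> {y. absv (y - of_nat (Suc n)) < 1}"
        using absv_ultrametric[of "a - of_nat n" "c - 1"] by (simp add: algebra_simps)
    next
      fix y assume "y \<in> {y. absv (y - of_nat (Suc n)) < 1}"
      then show "y \<in> {a + c | a c. absv (a - of_nat n) < 1 \<and> absv (c - 1) < 1}"
        by (intro CollectI exI[of _ "y - 1"] exI[of _ 1]) (simp add: absv_zero algebra_simps)
    qed
    finally show ?case .
  qed
qed

text \<open>The \<open>LEAST\<close> in \<open>residue_char\<close> needs a witness: the unit ball
  has finitely many classes modulo the maximal ideal, so by pigeonhole two natural numbers share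
  one, and their difference annihilates 1.\<close>

lemma absv_residue_char: "absv (of_nat (residue_char absv)) < 1"
proof -
  let ?P = "\<lambda>n. 0 < n \<and> add_pow (residue_field absv) n \<one>\<^bsub>residue_field absv\<^esub> = \<zero>\<^bsub>residue_field absv\<^esub>"
  have zero: "\<zero>\<^bsub>residue_field absv\<^esub> = {x. absv x < 1}"
    by (simp add: residue_field_def FactRing_def)
  have iff: "{y. absv (y - of_nat n) < 1} = {x. absv x < 1} \<longleftrightarrow> absv (of_nat n) < 1" for n
  proof
    assume "{y. absv (y - of_nat n) < 1} = {x. absv x < 1}"
    moreover have "of_nat n \<in> {y. absv (y - of_nat n) < 1}" by (simp add: absv_zero)
    ultimately show "absv (of_nat n) < 1" by simp
  next
    assume n: "absv (of_nat n) < 1"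
    show "{y. absv (y - of_nat n) < 1} = {x. absv x < 1}"
      using add_subgroupD(3,4)[OF add_subgroup_open_ball[of 1], of _ "of_nat n"] n by fastforce
  qed
  let ?I = "{x. absv x < 1}"
  have I: "add_subgroup ?I" by (rule add_subgroup_open_ball) simp
  have "finite_mod ?I {x. absv x \<le> 1}" by (rule finite_mod_field_ball[OF I, of 1]) auto
  then have "finite (range (\<lambda>n. coset_rep ?I (of_nat n)))"
    unfolding finite_mod_def by (rule finite_subset[rotated]) (use absv_of_nat in auto)
  then have "\<not> inj (\<lambda>n. coset_rep ?I (of_nat n))" using finite_imageD infinite_UNIV_nat by blast
  then obtain m n where "m < n" "coset_rep ?I (of_nat n) = coset_rep ?I (of_nat m)"
    unfolding inj_def by (metis nat_neq_iff)
  then have "absv (of_nat (n - m)) < 1" by (simp add: coset_rep_eq_iff[OF I] of_nat_diff)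
  then have "{y. absv (y - of_nat (n - m)) < 1} = {x. absv x < 1}" by (simp only: iff)
  then have "?P (n - m)" using \<open>m < n\<close> by (simp only: add_pow_residue_field zero zero_less_diff)
  then have "?P (residue_char absv)" unfolding residue_char_def by (rule LeastI)
  then show ?thesis by (simp add: add_pow_residue_field zero iff)
qed

end

section \<open>Coordinates, the maximum norm and compact balls of X\<close>

locale local_vector_space =
  nonarch_local_field absv + finite_dimensional_vector_space smul B
  for absv :: "'f::field \<Rightarrow> real" and smul :: "'f \<Rightarrow> 'x::ab_group_add \<Rightarrow> 'x" and B :: "'x set"
begin

abbreviation "coord \<equiv> representation B"

lemma coord_add: "coord (x + y) b = coord x b + coord y b"
  by (simp add: representation_add independent_Basis span_Basis)

lemma coord_scale: "coord (smul c x) b = c * coord x b"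
  by (simp add: representation_scale independent_Basis span_Basis)

lemma coord_diff: "coord (x - y) b = coord x b - coord y b"
  by (simp add: representation_diff independent_Basis span_Basis)

lemma coord_zero: "coord 0 b = 0"
  by (simp add: representation_zero)

lemma sum_coord: "(\<Sum>b\<in>B. smul (coord x b) b) = x"
  using sum_representation_eq[of B x B] independent_Basis span_Basis finite_Basis by simp

lemma coord_basis: "b \<in> B \<Longrightarrow> coord b c = of_bool (c = b)"
  using representation_basis[OF independent_Basis, of b] by auto

lemma dual_iff:
  "l \<in> dual smul \<longleftrightarrow> (\<forall>x y. l (x + y) = l x + l y) \<and> (\<forall>c x. l (smul c x) = c * l x)"
proof -
  have "vector_space ((*) :: 'f \<Rightarrow> 'f \<Rightarrow> 'f)" by unfold_locales (auto simp: algebra_simps)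
  then show ?thesis
    unfolding dual_def using vector_space_axioms
    by (auto simp: Vector_Spaces.linear_def module_hom_def module_hom_axioms_def module_iff_vector_space)
qed

lemma dualD:
  assumes "l \<in> dual smul"
  shows "l (x + y) = l x + l y" "l (smul c x) = c * l x" "l 0 = 0" "l (- x) = - l x" "l (x - y) = l x - l y"
proof -
  show add: "l (x + y) = l x + l y" for x y using assms by (simp add: dual_iff)
  show scale: "l (smul c x) = c * l x" for c x using assms by (simp add: dual_iff)
  show 0: "l 0 = 0" using add[of 0 0] unfolding add_0 by (metis add_cancel_right_right)
  show minus: "l (- x) = - l x" for x using add[of x "- x"] 0 by (simp add: eq_neg_iff_add_eq_0 add.commute)
  show "l (x - y) = l x - l y" using add[of x "- y"] minus by simp
qed

lemma dual_coord: "(\<lambda>x. coord x b) \<in> dual smul"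
  by (simp add: dual_iff coord_add coord_scale)

lemma dual_sum: "l \<in> dual smul \<Longrightarrow> l x = (\<Sum>b\<in>B. coord x b * l b)"
proof -
  assume l: "l \<in> dual smul"
  have "l (\<Sum>b\<in>A. smul (coord x b) b) = (\<Sum>b\<in>A. coord x b * l b)" if "finite A" for A
    using that by (induction A rule: finite_induct) (simp_all add: dualD[OF l])
  from this[OF finite_Basis] show ?thesis by (simp add: sum_coord)
qed

lemma eq_0_if_coord: "(\<And>b. b \<in> B \<Longrightarrow> coord x b = 0) \<Longrightarrow> x = 0"
  using sum_coord[of x] by simp

lemma ex_dual_eq_1:
  assumes "v \<noteq> 0" shows "\<exists>l\<in>dual smul. l v = 1"
proof -
  obtain b where b: "coord v b \<noteq> 0" using eq_0_if_coord[of v] assms by blast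
  show ?thesis
    by (rule bexI[of _ "\<lambda>x. coord x b / coord v b"])
      (use b in \<open>simp_all add: dual_iff coord_add coord_scale add_divide_distrib\<close>)
qed

text \<open>The inserted 0 keeps \<open>Max\<close> meaningful when B is empty, that is, when X is
  zero.\<close>

definition nrm :: "'x \<Rightarrow> real" where
  "nrm x = Max (insert 0 ((\<lambda>b. absv (coord x b)) ` B))"

lemma nrm_nonneg: "0 \<le> nrm x"
  unfolding nrm_def using finite_Basis by (intro Max_ge) auto

lemma absv_coord_le: "b \<in> B \<Longrightarrow> absv (coord x b) \<le> nrm x"
  unfolding nrm_def using finite_Basis by (intro Max_ge) auto

lemma nrm_le_iff: "0 \<le> r \<Longrightarrow> nrm x \<le> r \<longleftrightarrow> (\<forall>b\<in>B. absv (coord x b) \<le> r)"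
  unfolding nrm_def using finite_Basis by (subst Max_le_iff) auto

lemma nrm_less_iff: "0 < r \<Longrightarrow> nrm x < r \<longleftrightarrow> (\<forall>b\<in>B. absv (coord x b) < r)"
  unfolding nrm_def using finite_Basis by (subst Max_less_iff) auto

lemma nrm_zero: "nrm 0 = 0"
  using nrm_le_iff[of 0 0] nrm_nonneg[of 0] by (simp add: coord_zero absv_zero)

lemma nrm_eq_0: "nrm x = 0 \<Longrightarrow> x = 0"
proof (rule eq_0_if_coord)
  fix b assume "nrm x = 0" "b \<in> B"
  then have "absv (coord x b) = 0" using absv_coord_le[of b x] absv_nonneg[of "coord x b"] by simp
  then show "coord x b = 0" by (simp add: absv_eq_0_iff)
qed

lemma nrm_add: "nrm (x + y) \<le> max (nrm x) (nrm y)"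
proof (subst nrm_le_iff)
  show "0 \<le> max (nrm x) (nrm y)" using nrm_nonneg[of x] by simp
  show "\<forall>b\<in>B. absv (coord (x + y) b) \<le> max (nrm x) (nrm y)"
  proof
    fix b assume "b \<in> B"
    then show "absv (coord (x + y) b) \<le> max (nrm x) (nrm y)"
      using absv_ultrametric[of "coord x b" "coord y b"] absv_coord_le[of b x] absv_coord_le[of b y]
      by (simp add: coord_add)
  qed
qed

lemma nrm_scale: "nrm (smul c x) \<le> absv c * nrm x"
  using absv_nonneg nrm_nonneg absv_coord_le
  by (subst nrm_le_iff) (simp_all add: coord_scale absv_mult mult_left_mono)

lemma nrm_minus: "nrm (- x) = nrm x"
proof -
  have "nrm (- x) \<le> nrm x" for x
    using nrm_scale[of "- 1" x] by (simp add: absv_minus absv_one)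
  from this[of x] this[of "- x"] show ?thesis by simp
qed

lemma nrm_diff: "nrm (x - y) \<le> max (nrm x) (nrm y)"
  using nrm_add[of x "- y"] by (simp add: nrm_minus)

lemma dual_bound:
  assumes "l \<in> dual smul"
  obtains C where "C > 0" "\<And>x. absv (l x) \<le> C * nrm x"
proof
  define C where "C = 1 + (\<Sum>b\<in>B. absv (l b))"
  show C: "C > 0" unfolding C_def by (simp add: absv_nonneg sum_nonneg add_pos_nonneg)
  have Cb: "absv (l b) \<le> C" if "b \<in> B" for b
    using member_le_sum[of b B "\<lambda>b. absv (l b)"] that finite_Basis absv_nonneg by (simp add: C_def add_increasing)
  show "absv (l x) \<le> C * nrm x" for x
  \<comment> \<open>\<open>absv_sum_less\<close> is strict and asks for a positive bound, while
    \<open>nrm x\<close> may be 0; an arbitrary e > 0 settles both.\<close>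
  proof (rule field_le_epsilon)
    fix e :: real assume e: "0 < e"
    have "absv (\<Sum>b\<in>B. coord x b * l b) < C * nrm x + e"
    proof (rule absv_sum_less[OF finite_Basis])
      show "0 < C * nrm x + e" using C e nrm_nonneg[of x] by (simp add: add_nonneg_pos)
      fix b assume b: "b \<in> B"
      have "absv (coord x b * l b) \<le> nrm x * C"
        using mult_mono[OF absv_coord_le[OF b, of x] Cb[OF b] nrm_nonneg absv_nonneg] by (simp add: absv_mult)
      with e show "absv (coord x b * l b) < C * nrm x + e" by (simp add: mult.commute)
    qed
    then show "absv (l x) \<le> C * nrm x + e" by (simp flip: dual_sum[OF assms])
  qed
qed

lemma add_subgroup_nrm_ball: "0 \<le> r \<Longrightarrow> add_subgroup {x. nrm x \<le> r}"
  unfolding add_subgroup_def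
proof (intro conjI ballI)
  fix x y assume "x \<in> {x. nrm x \<le> r}" "y \<in> {x. nrm x \<le> r}"
  then show "x - y \<in> {x. nrm x \<le> r}" using nrm_diff[of x y] by simp
qed (simp add: nrm_zero)

abbreviation "space_top \<equiv> space_topology absv smul"

lemma openin_space_iff: "openin space_top S \<longleftrightarrow> (\<forall>x\<in>S. \<exists>e>0. \<forall>y. nrm (y - x) < e \<longrightarrow> y \<in> S)"
proof -
  have "(\<forall>b\<in>B. absv (coord y b - coord x b) < e) \<longleftrightarrow> nrm (y - x) < e" if "0 < e" for x y e
    using nrm_less_iff[OF that, of "y - x"] by (simp add: coord_diff)
  then show ?thesis
    unfolding openin_space_topology_iff[OF finite_dimensional_vector_space_axioms]
    by (simp cong: conj_cong)
qed

lemma topspace_space: "topspace space_top = UNIV"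
proof -
  have "openin space_top UNIV" by (simp add: openin_space_iff gt_ex)
  then show ?thesis using openin_subset by blast
qed

lemma openin_add_subgroup_coset:
  assumes L: "add_subgroup L" and r: "0 < r" "\<And>x. nrm x \<le> r \<Longrightarrow> x \<in> L"
  shows "openin space_top {y. y - x \<in> L}"
  unfolding openin_space_iff
proof
  fix z assume z: "z \<in> {y. y - x \<in> L}"
  have "y \<in> {y. y - x \<in> L}" if "nrm (y - z) < r" for y
    using add_subgroupD(3)[OF L r(2), of "y - z" "z - x"] z that by simp
  then show "\<exists>r>0. \<forall>y. nrm (y - z) < r \<longrightarrow> y \<in> {y. y - x \<in> L}" using r(1) by blast
qed

lemma closedin_nrm_ball: "closedin space_top {x. nrm x \<le> R}"
proof -
  have "openin space_top {x. R < nrm x}"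
    unfolding openin_space_iff
  proof
    fix x assume x: "x \<in> {x. R < nrm x}"
    show "\<exists>e>0. \<forall>y. nrm (y - x) < e \<longrightarrow> y \<in> {x. R < nrm x}"
    proof (cases "R < 0")
      case True
      then have "y \<in> {x. R < nrm x}" for y using nrm_nonneg[of y] by simp
      then show ?thesis by (meson zero_less_one)
    next
      case False
      have "y \<in> {x. R < nrm x}" if "nrm (y - x) < nrm x" for y
      proof -
        have "nrm (y - (y - x)) \<le> max (nrm y) (nrm (y - x))" by (rule nrm_diff)
        with that x show ?thesis by simp
      qed
      with False x show ?thesis by (intro exI[of _ "nrm x"]) auto
    qed
  qed
  moreover have "UNIV - {x. nrm x \<le> R} = {x. R < nrm x}" by auto
  ultimately show ?thesis by (simp add: closedin_def topspace_space)
qed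

text \<open>The ball is covered by the image of a product of compact balls of F under the coordinate
  isomorphism, which is continuous for the product topology.\<close>

lemma compactin_nrm_ball:
  assumes "0 \<le> R" shows "compactin space_top {x. nrm x \<le> R}"
proof -
  let ?T = "product_topology (\<lambda>b. field_topology absv) B"
  let ?f = "\<lambda>c. \<Sum>b\<in>B. smul (c b) b"
  have coord_f: "coord (?f c) b = c b" if "b \<in> B" for c b
  proof -
    have "coord (\<Sum>d\<in>A. smul (c d) d) b = (\<Sum>d\<in>A. coord (smul (c d) d) b)" for A
      by (induction A rule: infinite_finite_induct) (simp_all add: coord_zero coord_add)
    then have "coord (?f c) b = (\<Sum>d\<in>B. coord (smul (c d) d) b)" .
    also have "\<dots> = (\<Sum>d\<in>B. if d = b then c d else 0)"
      by (intro sum.cong) (auto simp: coord_scale coord_basis)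
    also have "\<dots> = c b" using that finite_Basis by simp
    finally show ?thesis .
  qed
  have "continuous_map ?T space_top ?f"
    unfolding continuous_map_def topspace_space
  proof (intro conjI allI impI)
    fix V assume V: "openin space_top V"
    show "openin ?T {c \<in> topspace ?T. ?f c \<in> V}"
    proof (subst openin_subopen, intro ballI)
      fix c assume c: "c \<in> {c \<in> topspace ?T. ?f c \<in> V}"
      then obtain e where e: "e > 0" "\<And>y. nrm (y - ?f c) < e \<Longrightarrow> y \<in> V"
        using V unfolding openin_space_iff by blast
      let ?N = "PiE B (\<lambda>b. {z. z - c b \<in> {z. absv z < e}})"
      have "openin ?T ?N"
        unfolding openin_PiE[OF finite_Basis]
        using openin_field_add_subgroup_coset[OF add_subgroup_open_ball[OF e(1)] e(1)] by blast
      moreover have "c \<in> ?N" using c e(1) by (auto simp: topspace_field absv_zero)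
      moreover have "?N \<subseteq> {c \<in> topspace ?T. ?f c \<in> V}"
      proof
        fix d assume d: "d \<in> ?N"
        then have "nrm (?f d - ?f c) < e"
          by (auto simp: nrm_less_iff[OF e(1)] coord_diff coord_f)
        with d e(2) show "d \<in> {c \<in> topspace ?T. ?f c \<in> V}" by (auto simp: topspace_field PiE_def)
      qed
      ultimately show "\<exists>T. openin ?T T \<and> c \<in> T \<and> T \<subseteq> {c \<in> topspace ?T. ?f c \<in> V}" by blast
    qed
  qed auto
  moreover have "compactin ?T (PiE B (\<lambda>b. {z. absv z \<le> R}))"
    using compactin_ball by (simp add: compactin_PiE)
  ultimately have "compactin space_top (?f ` PiE B (\<lambda>b. {z. absv z \<le> R}))"
    using image_compactin by blast
  moreover have "{x. nrm x \<le> R} \<subseteq> ?f ` PiE B (\<lambda>b. {z. absv z \<le> R})"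
  proof
    fix x assume "x \<in> {x. nrm x \<le> R}"
    then have "restrict (coord x) B \<in> PiE B (\<lambda>b. {z. absv z \<le> R})"
      using assms by (auto simp: nrm_le_iff)
    moreover have "x = ?f (restrict (coord x) B)" using sum_coord[of x] by simp
    ultimately show "x \<in> ?f ` PiE B (\<lambda>b. {z. absv z \<le> R})" by blast
  qed
  ultimately show ?thesis by (rule closed_compactin[OF _ _ closedin_nrm_ball])
qed

lemma finite_mod_nrm_ball:
  assumes "add_subgroup L" "0 < r" "\<And>x. nrm x \<le> r \<Longrightarrow> x \<in> L"
  shows "finite_mod L {x. nrm x \<le> R}"
proof -
  have "finite_mod L {x. nrm x \<le> max R 0}"
    using finite_mod_compact[OF assms(1) compactin_nrm_ball] openin_add_subgroup_coset[OF assms]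
    by (simp add: max_def)
  then show ?thesis by (rule finite_mod_subset) auto
qed

section \<open>Schwartz functions on X\<close>

abbreviation "SX \<equiv> schwartz_space absv smul"

text \<open>The uniform description on which all later estimates rest. A finite cover of the support
  by balls of constancy has a smallest radius, and by the ultrametric inequality a shift of at most
  that size never leaves a ball of the cover.\<close>

lemma schwartz_iff:
  "\<Phi> \<in> SX \<longleftrightarrow> (\<exists>r>0. periodic {x. nrm x \<le> r} \<Phi>) \<and> (\<exists>R. \<forall>x. \<Phi> x \<noteq> 0 \<longrightarrow> nrm x \<le> R)"
proof (intro iffI conjI)
  assume \<Phi>: "\<Phi> \<in> SX"
  let ?K = "space_top closure_of {x. \<Phi> x \<noteq> 0}"
  have K: "compactin space_top ?K" and "\<And>x. \<exists>N. openin space_top N \<and> x \<in> N \<and> (\<forall>y\<in>N. \<Phi> y = \<Phi> x)"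
    using \<Phi> unfolding schwartz_space_def by blast+
  then have "\<forall>x. \<exists>e>0. \<forall>y. nrm (y - x) < e \<longrightarrow> \<Phi> y = \<Phi> x"
    unfolding openin_space_iff by meson
  then obtain e where e: "\<And>x. e x > 0" "\<And>x y. nrm (y - x) < e x \<Longrightarrow> \<Phi> y = \<Phi> x" by metis
  have in_K: "x \<in> ?K" if "\<Phi> x \<noteq> 0" for x
    using closure_of_subset[of "{x. \<Phi> x \<noteq> 0}" space_top] that by (auto simp: topspace_space)
  \<comment> \<open>Half the radius turns the open ball of constancy into a coset of a closed ball,
    which is a subgroup.\<close>
  let ?U = "\<lambda>x. {y. y - x \<in> {z. nrm z \<le> e x / 2}}"
  have "openin space_top (?U x)" for x
    using openin_add_subgroup_coset[OF add_subgroup_nrm_ball[of "e x / 2"], of "e x / 2" x] e(1)[of x] by simp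
  moreover have "?K \<subseteq> \<Union>(range ?U)"
  proof
    fix y
    have "y \<in> ?U y" using e(1)[of y] by (simp add: nrm_zero)
    then show "y \<in> \<Union>(range ?U)" by blast
  qed
  ultimately obtain \<F> where "finite \<F>" "\<F> \<subseteq> range ?U" "?K \<subseteq> \<Union>\<F>"
    using compactinD[OF K, of "range ?U"] by blast
  then obtain A where "finite A" "\<F> = ?U ` A"
    using finite_subset_image[of \<F> ?U UNIV] by blast
  with \<open>?K \<subseteq> \<Union>\<F>\<close> have A: "finite A" "?K \<subseteq> (\<Union>x\<in>A. ?U x)" by simp_all
  define r where "r = Min (insert 1 ((\<lambda>x. e x / 2) ` A))"
  have r: "r > 0" "\<And>x. x \<in> A \<Longrightarrow> r \<le> e x / 2"
  proof -
    show "r > 0" unfolding r_def using A(1) e(1) by simp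
    show "r \<le> e x / 2" if "x \<in> A" for x unfolding r_def using A(1) that by (intro Min_le) auto
  qed
  have near: "\<Phi> (x + y) = \<Phi> x" if "x \<in> ?K" "nrm y \<le> r" for x y
  proof -
    obtain a where a: "a \<in> A" "nrm (x - a) \<le> e a / 2" using A(2) \<open>x \<in> ?K\<close> by blast
    then have "nrm (x + y - a) \<le> e a / 2"
      using nrm_add[of "x - a" y] r(2)[OF a(1)] that(2) by (simp add: algebra_simps)
    then have "\<Phi> (x + y) = \<Phi> a" "\<Phi> x = \<Phi> a" using e(1)[of a] a(2) by (auto intro!: e(2))
    then show ?thesis by simp
  qed
  \<comment> \<open>Constancy is known only from points of the support. If x + y lies in it, step
    back by -y; otherwise step from x, or else both values are 0.\<close>
  have "\<Phi> (x + y) = \<Phi> x" if y: "nrm y \<le> r" for x y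
  proof (cases "x + y \<in> ?K")
    case True
    then show ?thesis using near[of "x + y" "- y"] y by (simp add: nrm_minus)
  next
    case False
    then show ?thesis using near[of x y] y in_K[of x] in_K[of "x + y"] by metis
  qed
  then show "\<exists>r>0. periodic {x. nrm x \<le> r} \<Phi>" using r(1) unfolding periodic_def by blast
  define R where "R = Max (insert 0 ((\<lambda>x. max (nrm x) (e x / 2)) ` A))"
  have "nrm x \<le> R" if x: "\<Phi> x \<noteq> 0" for x
  proof -
    obtain a where a: "a \<in> A" "nrm (x - a) \<le> e a / 2" using A(2) in_K[OF x] by blast
    then have "nrm x \<le> max (nrm a) (e a / 2)" using nrm_add[of "x - a" a] by simp
    also have "\<dots> \<le> R" unfolding R_def using A(1) a(1) by (intro Max_ge) auto
    finally show ?thesis .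
  qed
  then show "\<exists>R. \<forall>x. \<Phi> x \<noteq> 0 \<longrightarrow> nrm x \<le> R" by blast
next
  assume *: "(\<exists>r>0. periodic {x. nrm x \<le> r} \<Phi>) \<and> (\<exists>R. \<forall>x. \<Phi> x \<noteq> 0 \<longrightarrow> nrm x \<le> R)"
  then obtain r R where r: "r > 0" "\<And>x y. nrm y \<le> r \<Longrightarrow> \<Phi> (x + y) = \<Phi> x"
    and R: "\<And>x. \<Phi> x \<noteq> 0 \<Longrightarrow> nrm x \<le> R" unfolding periodic_def by blast
  let ?L = "{x. nrm x \<le> r}"
  have L: "add_subgroup ?L" using r(1) add_subgroup_nrm_ball by simp
  have loc: "\<exists>N. openin space_top N \<and> x \<in> N \<and> (\<forall>y\<in>N. \<Phi> y = \<Phi> x)" for x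
  proof (intro exI conjI ballI)
    show "openin space_top {y. y - x \<in> ?L}" by (rule openin_add_subgroup_coset[OF L r(1)]) simp
    show "x \<in> {y. y - x \<in> ?L}" using r(1) by (simp add: nrm_zero)
    show "\<Phi> y = \<Phi> x" if "y \<in> {y. y - x \<in> ?L}" for y using r(2)[of "y - x" x] that by simp
  qed
  have "{x. \<Phi> x \<noteq> 0} \<subseteq> {x. nrm x \<le> max R 0}" using R by fastforce
  then have "space_top closure_of {x. \<Phi> x \<noteq> 0} \<subseteq> {x. nrm x \<le> max R 0}"
    by (rule closure_of_minimal[OF _ closedin_nrm_ball])
  then have "compactin space_top (space_top closure_of {x. \<Phi> x \<noteq> 0})"
    using closed_compactin[OF compactin_nrm_ball[of "max R 0"]] by simp
  then show "\<Phi> \<in> SX" unfolding schwartz_space_def using loc by blast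
qed

lemma schwartzE:
  assumes "\<Phi> \<in> SX"
  obtains r R where "r > 0" "periodic {x. nrm x \<le> r} \<Phi>" "R \<ge> 0" "\<forall>x. \<Phi> x \<noteq> 0 \<longrightarrow> nrm x \<le> R"
proof -
  obtain r R where "r > 0" "periodic {x. nrm x \<le> r} \<Phi>" "\<forall>x. \<Phi> x \<noteq> 0 \<longrightarrow> nrm x \<le> R"
    using assms unfolding schwartz_iff by blast
  then show ?thesis by (intro that[of r "max R 0"]) (auto simp: le_max_iff_disj)
qed

lemma schwartzI:
  assumes "r > 0" "\<And>x y. nrm y \<le> r \<Longrightarrow> \<Phi> (x + y) = \<Phi> x" "\<And>x. \<Phi> x \<noteq> 0 \<Longrightarrow> nrm x \<le> R"
  shows "\<Phi> \<in> SX"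
  using assms unfolding schwartz_iff periodic_def by auto

lemma schwartz_add:
  assumes "\<Phi> \<in> SX" "\<Psi> \<in> SX" shows "(\<lambda>x. \<Phi> x + \<Psi> x) \<in> SX"
proof -
  obtain r R where 1: "r > 0" "periodic {x. nrm x \<le> r} \<Phi>" "R \<ge> 0" "\<forall>x. \<Phi> x \<noteq> 0 \<longrightarrow> nrm x \<le> R"
    by (rule schwartzE[OF assms(1)])
  obtain r' R' where 2: "r' > 0" "periodic {x. nrm x \<le> r'} \<Psi>" "R' \<ge> 0" "\<forall>x. \<Psi> x \<noteq> 0 \<longrightarrow> nrm x \<le> R'"
    by (rule schwartzE[OF assms(2)])
  show ?thesis
  proof (rule schwartzI[of "min r r'" _ "max R R'"])
    show "0 < min r r'" using 1 2 by simp
    show "\<Phi> (x + y) + \<Psi> (x + y) = \<Phi> x + \<Psi> x" if "nrm y \<le> min r r'" for x y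
      using 1(2) 2(2) that by (simp add: periodic_def)
    show "nrm x \<le> max R R'" if "\<Phi> x + \<Psi> x \<noteq> 0" for x
      using 1(4)[rule_format, of x] 2(4)[rule_format, of x] that by fastforce
  qed
qed

lemma schwartz_mult: "\<Phi> \<in> SX \<Longrightarrow> (\<lambda>x. c * \<Phi> x) \<in> SX"
  unfolding schwartz_iff periodic_def by auto

lemma schwartz_zero: "(\<lambda>x. 0) \<in> SX"
  unfolding schwartz_iff periodic_def by (auto intro: exI[of _ 1])

lemma schwartz_translate:
  assumes "\<Phi> \<in> SX" shows "(\<lambda>x. \<Phi> (x + v)) \<in> SX"
proof -
  obtain r R where 1: "r > 0" "periodic {x. nrm x \<le> r} \<Phi>" "R \<ge> 0" "\<forall>x. \<Phi> x \<noteq> 0 \<longrightarrow> nrm x \<le> R"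
    by (rule schwartzE[OF assms(1)])
  show ?thesis
  proof (rule schwartzI[OF 1(1)])
    show "\<Phi> (x + y + v) = \<Phi> (x + v)" if "nrm y \<le> r" for x y
      using 1(2) that unfolding periodic_def by (metis add.assoc add.commute mem_Collect_eq)
    show "nrm x \<le> max R (nrm v)" if "\<Phi> (x + v) \<noteq> 0" for x
      using 1(4)[rule_format, OF that] nrm_diff[of "x + v" v] by simp
  qed
qed

lemma schwartz_indicator:
  assumes "add_subgroup L" "0 < r" "\<And>x. nrm x \<le> r \<Longrightarrow> x \<in> L" "\<And>x. x \<in> L \<Longrightarrow> nrm x \<le> R"
  shows "(\<lambda>x. of_bool (x \<in> L)) \<in> SX"
proof (rule schwartzI[OF assms(2), of _ R])
  fix x y assume "nrm y \<le> r"
  then have y: "y \<in> L" by (rule assms(3))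
  have "x + y \<in> L \<longleftrightarrow> x \<in> L"
    using add_subgroupD(3)[OF assms(1) _ y, of x] add_subgroupD(4)[OF assms(1) _ y, of "x + y"] by auto
  then show "of_bool (x + y \<in> L) = of_bool (x \<in> L)" by simp
qed (use assms(4) in auto)

end

section \<open>An invariant integral with values in the coefficient ring\<close>

locale weil_data = local_vector_space absv smul B
  for absv :: "'f::field \<Rightarrow> real" and smul :: "'f \<Rightarrow> 'x::ab_group_add \<Rightarrow> 'x" and B :: "'x set" +
  fixes chi :: "'f \<Rightarrow> 'r::idom"
  assumes two_neq_0: "(2::'f) \<noteq> 0"
    and residue_char_unit: "(of_nat (residue_char absv) :: 'r) dvd 1"
    and chi_add: "chi (x + y) = chi x * chi y"
    and chi_zero: "chi 0 = 1"
    and chi_smooth: "\<exists>\<delta>>0. \<forall>z. absv z < \<delta> \<longrightarrow> chi z = 1"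
    and chi_nontrivial: "\<exists>z. chi z \<noteq> 1"
begin

text \<open>Since |p| < 1, multiplication by a high power of p carries M into the small ball. The
  quotient is thus killed by a power of p, which is a unit of R.\<close>

lemma coset_count_lattice_unit:
  assumes M: "add_subgroup M" and r: "0 < r" "{x. absv x \<le> r} \<subseteq> M" and R: "M \<subseteq> {x. absv x \<le> R}"
  shows "(of_nat (card (coset_rep {x. absv x \<le> r} ` M)) :: 'r) dvd 1"
proof -
  let ?p = "residue_char absv" and ?R = "max R 1"
  obtain k where k: "absv (of_nat ?p) ^ k < r / ?R"
    using real_arch_pow_inv[of "r / ?R", OF _ absv_residue_char] r(1) by auto
  have L: "add_subgroup {x. absv x \<le> r}" using r(1) by (simp add: add_subgroup_ball)
  show ?thesis
  proof (rule coset_count_unit[OF L M r(2)])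
    have "finite_mod {x. absv x \<le> r} {x. absv x \<le> R}"
      by (rule finite_mod_field_ball[OF L r(1)]) simp
    then show "finite_mod {x. absv x \<le> r} M" using R by (rule finite_mod_subset)
    show "(of_nat (?p ^ k) :: 'r) dvd 1"
      using dvd_power_same[OF residue_char_unit, of k] by simp
    fix x assume "x \<in> M"
    then have "absv x \<le> ?R" using R by (auto simp: le_max_iff_disj)
    then have "absv (of_nat ?p) ^ k * absv x \<le> r / ?R * ?R"
      using k r(1) by (intro mult_mono) (auto simp: absv_nonneg)
    then show "of_nat (?p ^ k) * x \<in> {x. absv x \<le> r}"
      by (simp add: absv_mult absv_power)
  qed
qed

lemma coset_count_ball_unit:
  assumes "0 < r" "r \<le> R"
  shows "(of_nat (card (coset_rep {x. absv x \<le> r} ` {x. absv x \<le> R})) :: 'r) dvd 1"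
  by (rule coset_count_lattice_unit[of _ _ R]) (use assms in \<open>auto simp: add_subgroup_ball\<close>)

definition schwartz1 :: "('f \<Rightarrow> 'r) \<Rightarrow> bool" where
  "schwartz1 \<phi> \<longleftrightarrow> (\<exists>r>0. periodic {x. absv x \<le> r} \<phi>) \<and> (\<exists>R. \<forall>x. \<phi> x \<noteq> 0 \<longrightarrow> absv x \<le> R)"

text \<open>For r at most 1 this is the index of the ball of radius r in the unit ball, hence the
  inverse of its volume in the normalisation where the unit ball has volume 1.\<close>

definition ball_count :: "real \<Rightarrow> 'r" where
  "ball_count r = of_nat (card (coset_rep {x. absv x \<le> r} ` {x. absv x \<le> 1}))"

text \<open>The value is the coset sum divided by the number of cosets in the unit ball, stated without
  division since R is only a domain.\<close>
definition is_haar_value :: "('f \<Rightarrow> 'r) \<Rightarrow> 'r \<Rightarrow> bool" where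
  "is_haar_value \<phi> c \<longleftrightarrow> (\<forall>r. 0 < r \<longrightarrow> r \<le> 1 \<longrightarrow> periodic {x. absv x \<le> r} \<phi> \<longrightarrow>
     ball_count r * c = coset_sum {x. absv x \<le> r} \<phi>)"

definition haar :: "('f \<Rightarrow> 'r) \<Rightarrow> 'r" where
  "haar \<phi> = (THE c. is_haar_value \<phi> c)"

lemma ball_finite_mod:
  assumes "0 < r" "\<forall>x. \<phi> x \<noteq> 0 \<longrightarrow> absv x \<le> R"
  shows "finite_mod {x. absv x \<le> r} {x. \<phi> x \<noteq> (0::'r)}"
proof (rule finite_mod_subset)
  show "finite_mod {x. absv x \<le> r} {x. absv x \<le> R}"
    by (rule finite_mod_field_ball[of _ r]) (use assms add_subgroup_ball in auto)
qed (use assms in auto)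

lemma coset_sum_ball:
  assumes "0 < r" "r \<le> R"
  shows "coset_sum {x. absv x \<le> r} (\<lambda>x. of_bool (x \<in> {x. absv x \<le> R}) :: 'r) =
    of_nat (card (coset_rep {x. absv x \<le> r} ` {x. absv x \<le> R}))"
proof (rule coset_sum_indicator)
  show "add_subgroup {x. absv x \<le> r}" using assms add_subgroup_ball by simp
  show "finite_mod {x. absv x \<le> r} {x. absv x \<le> R}"
    by (rule finite_mod_field_ball[of _ r]) (use assms add_subgroup_ball in auto)
  fix x y assume "x \<in> {x. absv x \<le> R}" "y \<in> {x. absv x \<le> r}"
  then show "x + y \<in> {x. absv x \<le> R}" using absv_ultrametric[of x y] assms by simp
qed

lemma periodic_ball_indicator:
  assumes "r \<le> R" shows "periodic {x. absv x \<le> r} (\<lambda>x. of_bool (x \<in> {x. absv x \<le> R}) :: 'r)"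
proof -
  have "absv (x + y) \<le> R \<longleftrightarrow> absv x \<le> R" if "absv y \<le> r" for x y
    using absv_ultrametric[of x y] absv_diff_le[of "x + y" y] that assms by auto
  then show ?thesis by (simp add: periodic_def)
qed

lemma coset_sum_ball_refine:
  assumes r: "0 < r'" "r' \<le> r" and per: "periodic {x. absv x \<le> r} \<phi>" and R: "\<forall>x. \<phi> x \<noteq> 0 \<longrightarrow> absv x \<le> R"
  shows "coset_sum {x. absv x \<le> r'} \<phi> =
    of_nat (card (coset_rep {x. absv x \<le> r'} ` {x. absv x \<le> r})) * coset_sum {x. absv x \<le> r} (\<phi> :: 'f \<Rightarrow> 'r)"
proof -
  have "coset_sum {x. absv x \<le> r'} \<phi> =
      coset_sum {x. absv x \<le> r'} (\<lambda>x. of_bool (x \<in> {x. absv x \<le> r})) * coset_sum {x. absv x \<le> r} \<phi>"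
  proof (rule coset_sum_refine[OF _ _ _ per])
    show "add_subgroup {x. absv x \<le> r}" "add_subgroup {x. absv x \<le> r'}"
      using r by (simp_all add: add_subgroup_ball)
    show "{x. absv x \<le> r'} \<subseteq> {x. absv x \<le> r}" using r by auto
    show "finite_mod {x. absv x \<le> r'} {x. \<phi> x \<noteq> 0}" by (rule ball_finite_mod[OF r(1) R])
  qed
  then show ?thesis using coset_sum_ball[OF r] by simp
qed

text \<open>Multiplicativity of the index, read off from the refinement formula for the indicator of
  the unit ball.\<close>

lemma ball_count_refine:
  assumes "0 < r'" "r' \<le> r" "r \<le> 1"
  shows "ball_count r' = of_nat (card (coset_rep {x. absv x \<le> r'} ` {x. absv x \<le> r})) * ball_count r"
  using coset_sum_ball_refine[OF assms(1,2) periodic_ball_indicator[OF assms(3)], of 1]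
    coset_sum_ball[of r' 1] coset_sum_ball[of r 1] assms by (simp add: ball_count_def)

lemma ball_count_unit: "0 < r \<Longrightarrow> r \<le> 1 \<Longrightarrow> ball_count r dvd 1"
  unfolding ball_count_def by (rule coset_count_ball_unit)

text \<open>Dividing at the radius r, where the count is a unit, gives a candidate. It is correct at
  a smaller radius by refinement; at a larger one, refinement gives the identity up to an index that
  is a unit and can be cancelled.\<close>

lemma haar_eq:
  assumes "0 < r" "r \<le> 1" "periodic {x. absv x \<le> r} \<phi>" "\<forall>x. \<phi> x \<noteq> 0 \<longrightarrow> absv x \<le> R"
  shows "ball_count r * haar \<phi> = coset_sum {x. absv x \<le> r} \<phi>"
proof -
  obtain u where u: "1 = ball_count r * u" using ball_count_unit[OF assms(1,2)] by (auto simp: dvd_def)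
  let ?c = "u * coset_sum {x. absv x \<le> r} \<phi>"
  have c: "ball_count r * ?c = coset_sum {x. absv x \<le> r} \<phi>"
    using u by (simp flip: mult.assoc)
  have val: "is_haar_value \<phi> ?c"
    unfolding is_haar_value_def
  proof (intro allI impI)
    fix s assume s: "0 < s" "s \<le> 1" "periodic {x. absv x \<le> s} \<phi>"
    show "ball_count s * ?c = coset_sum {x. absv x \<le> s} \<phi>"
    proof (cases "s \<le> r")
      case True
      show ?thesis
        unfolding coset_sum_ball_refine[OF s(1) True assms(3,4)] ball_count_refine[OF s(1) True assms(2)]
        using c by (simp add: mult.assoc)
    next
      case False
      define m :: 'r where "m = of_nat (card (coset_rep {x. absv x \<le> r} ` {x. absv x \<le> s}))"
      have "m dvd 1" unfolding m_def by (rule coset_count_ball_unit) (use assms False in auto)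
      then have "m \<noteq> 0" by auto
      have "coset_sum {x. absv x \<le> r} \<phi> = m * coset_sum {x. absv x \<le> s} \<phi>"
        unfolding m_def using False by (intro coset_sum_ball_refine[OF assms(1) _ s(3) assms(4)]) simp
      moreover have "ball_count r = m * ball_count s"
        unfolding m_def using False by (intro ball_count_refine[OF assms(1) _ s(2)]) simp
      ultimately have "m * (ball_count s * ?c) = m * coset_sum {x. absv x \<le> s} \<phi>"
        using c by (simp add: mult.assoc)
      with \<open>m \<noteq> 0\<close> show ?thesis by (rule mult_left_cancel[THEN iffD1])
    qed
  qed
  have "c' = ?c" if "is_haar_value \<phi> c'" for c'
  proof -
    have "ball_count r * c' = ball_count r * ?c"
      using that c assms unfolding is_haar_value_def by simp
    moreover have "ball_count r \<noteq> 0" using u by auto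
    ultimately show ?thesis using mult_left_cancel by blast
  qed
  then have "haar \<phi> = ?c" unfolding haar_def using val by (rule the_equality[rotated])
  with c show ?thesis by simp
qed

lemma schwartz1E:
  assumes "schwartz1 \<phi>"
  obtains r R where "0 < r" "r \<le> 1" "periodic {x. absv x \<le> r} \<phi>" "\<forall>x. \<phi> x \<noteq> 0 \<longrightarrow> absv x \<le> R"
proof -
  obtain r R where r: "0 < r" "periodic {x. absv x \<le> r} \<phi>" and R: "\<forall>x. \<phi> x \<noteq> 0 \<longrightarrow> absv x \<le> R"
    using assms unfolding schwartz1_def by blast
  have "periodic {x. absv x \<le> min r 1} \<phi>" by (rule periodic_mono[OF r(2)]) auto
  with r(1) R show ?thesis by (intro that[of "min r 1" R]) auto
qed

lemma haar_add:
  assumes "schwartz1 \<phi>" "schwartz1 \<psi>"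
  shows "haar (\<lambda>x. \<phi> x + \<psi> x) = haar \<phi> + haar \<psi>"
proof -
  obtain r R where 1: "0 < r" "r \<le> 1" "periodic {x. absv x \<le> r} \<phi>" "\<forall>x. \<phi> x \<noteq> 0 \<longrightarrow> absv x \<le> R"
    by (rule schwartz1E[OF assms(1)])
  obtain r' R' where 2: "0 < r'" "r' \<le> 1" "periodic {x. absv x \<le> r'} \<psi>" "\<forall>x. \<psi> x \<noteq> 0 \<longrightarrow> absv x \<le> R'"
    by (rule schwartz1E[OF assms(2)])
  define s where "s = min r r'"
  have s: "0 < s" "s \<le> 1" using 1 2 by (auto simp: s_def)
  have p: "periodic {x. absv x \<le> s} \<phi>" "periodic {x. absv x \<le> s} \<psi>"
    by (rule periodic_mono[OF 1(3)], force simp: s_def) (rule periodic_mono[OF 2(3)], force simp: s_def)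
  have "ball_count s * haar (\<lambda>x. \<phi> x + \<psi> x) = coset_sum {x. absv x \<le> s} (\<lambda>x. \<phi> x + \<psi> x)"
  proof (rule haar_eq[OF s, of _ "max R R'"])
    show "periodic {x. absv x \<le> s} (\<lambda>x. \<phi> x + \<psi> x)" using p by (simp add: periodic_def)
    show "\<forall>x. \<phi> x + \<psi> x \<noteq> 0 \<longrightarrow> absv x \<le> max R R'"
    proof (intro allI impI)
      fix x assume "\<phi> x + \<psi> x \<noteq> 0"
      then have "\<phi> x \<noteq> 0 \<or> \<psi> x \<noteq> 0" by auto
      with 1(4) 2(4) show "absv x \<le> max R R'" by (auto simp: le_max_iff_disj)
    qed
  qed
  also have "\<dots> = coset_sum {x. absv x \<le> s} \<phi> + coset_sum {x. absv x \<le> s} \<psi>"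
    using s by (intro coset_sum_add add_subgroup_ball ball_finite_mod[OF s(1) 1(4)] ball_finite_mod[OF s(1) 2(4)]) simp
  also have "\<dots> = ball_count s * (haar \<phi> + haar \<psi>)"
    by (simp add: distrib_left haar_eq[OF s p(1) 1(4)] haar_eq[OF s p(2) 2(4)])
  finally show ?thesis using ball_count_unit[OF s] by auto
qed

lemma haar_mult:
  assumes "schwartz1 \<phi>"
  shows "haar (\<lambda>x. c * \<phi> x) = c * haar \<phi>"
proof -
  obtain r R where 1: "0 < r" "r \<le> 1" "periodic {x. absv x \<le> r} \<phi>" "\<forall>x. \<phi> x \<noteq> 0 \<longrightarrow> absv x \<le> R"
    by (rule schwartz1E[OF assms(1)])
  have "ball_count r * haar (\<lambda>x. c * \<phi> x) = coset_sum {x. absv x \<le> r} (\<lambda>x. c * \<phi> x)"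
    by (rule haar_eq[OF 1(1,2), of _ R]) (use 1(3,4) in \<open>auto simp: periodic_def\<close>)
  also have "\<dots> = c * coset_sum {x. absv x \<le> r} \<phi>"
    using 1 by (intro coset_sum_mult add_subgroup_ball ball_finite_mod[OF 1(1,4)]) simp
  also have "\<dots> = ball_count r * (c * haar \<phi>)"
    by (simp add: haar_eq[OF 1, symmetric] mult.left_commute)
  finally show ?thesis using ball_count_unit[OF 1(1,2)] by auto
qed

lemma haar_translate:
  assumes "schwartz1 \<phi>"
  shows "haar (\<lambda>x. \<phi> (x + h)) = haar \<phi>"
proof -
  obtain r R where 1: "0 < r" "r \<le> 1" "periodic {x. absv x \<le> r} \<phi>" "\<forall>x. \<phi> x \<noteq> 0 \<longrightarrow> absv x \<le> R"
    by (rule schwartz1E[OF assms(1)])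
  have "ball_count r * haar (\<lambda>x. \<phi> (x + h)) = coset_sum {x. absv x \<le> r} (\<lambda>x. \<phi> (x + h))"
  proof (rule haar_eq[OF 1(1,2), of _ "max R (absv h)"])
    show "periodic {x. absv x \<le> r} (\<lambda>x. \<phi> (x + h))"
      using 1(3) unfolding periodic_def by (metis add.assoc add.commute)
    show "\<forall>x. \<phi> (x + h) \<noteq> 0 \<longrightarrow> absv x \<le> max R (absv h)"
    proof (intro allI impI)
      fix x assume "\<phi> (x + h) \<noteq> 0"
      then have "absv (x + h) \<le> R" using 1(4) by blast
      then show "absv x \<le> max R (absv h)" using absv_diff_le[of "x + h" h] by auto
    qed
  qed
  also have "\<dots> = coset_sum {x. absv x \<le> r} \<phi>"
    using 1 by (intro coset_sum_translate add_subgroup_ball) simp_all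
  also have "\<dots> = ball_count r * haar \<phi>"
    by (simp add: haar_eq[OF 1])
  finally show ?thesis using ball_count_unit[OF 1(1,2)] by auto
qed

lemma periodic_lattice:
  assumes M: "add_subgroup M" and s: "{x. absv x \<le> s} \<subseteq> M"
  shows "periodic {x. absv x \<le> s} (\<lambda>x. of_bool (x \<in> M) :: 'r)"
proof -
  have stable: "x + y \<in> M" if "x \<in> M" "absv y \<le> s" for x y
    using that s add_subgroupD(3)[OF M, of x y] by blast
  have "x + y \<in> M \<longleftrightarrow> x \<in> M" if y: "absv y \<le> s" for x y
    using stable[of x y] stable[of "x + y" "- y"] y by (auto simp: absv_minus)
  then show ?thesis by (simp add: periodic_def)
qed

lemma schwartz1_lattice:
  assumes "add_subgroup M" "0 < r" "{x. absv x \<le> r} \<subseteq> M" "M \<subseteq> {x. absv x \<le> R}"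
  shows "schwartz1 (\<lambda>x. of_bool (x \<in> M))"
  unfolding schwartz1_def using periodic_lattice[OF assms(1,3)] assms(2,4) by auto

text \<open>At a radius fine enough for M, the integral times a ball count is the number of cosets
  in M. That number is a unit, hence so is each factor.\<close>

lemma haar_lattice_unit:
  assumes M: "add_subgroup M" and r: "0 < r" "{x. absv x \<le> r} \<subseteq> M" and R: "M \<subseteq> {x. absv x \<le> R}"
  shows "haar (\<lambda>x. of_bool (x \<in> M)) dvd 1"
proof -
  define s where "s = min r 1"
  have s: "0 < s" "s \<le> 1" using r(1) by (auto simp: s_def)
  have sM: "{x. absv x \<le> s} \<subseteq> M" using r(2) by (auto simp: s_def)
  have L: "add_subgroup {x. absv x \<le> s}" using s(1) by (simp add: add_subgroup_ball)
  have stable: "x + y \<in> M" if "x \<in> M" "y \<in> {x. absv x \<le> s}" for x y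
    using that sM add_subgroupD(3)[OF M, of x y] by blast
  have "finite_mod {x. absv x \<le> s} {x. absv x \<le> R}"
    by (rule finite_mod_field_ball[OF L s(1)]) simp
  then have fin: "finite_mod {x. absv x \<le> s} M" using R by (rule finite_mod_subset)
  note per = periodic_lattice[OF M sM]
  have "ball_count s * haar (\<lambda>x. of_bool (x \<in> M)) =
      of_nat (card (coset_rep {x. absv x \<le> s} ` M))"
    using haar_eq[OF s per, of R] R coset_sum_indicator[OF L fin stable] by (simp add: subset_iff)
  also have "\<dots> dvd 1" by (rule coset_count_lattice_unit[OF M s(1) sM R])
  finally show ?thesis by (rule dvd_mult_right)
qed

end

section \<open>Weyl operators and Schur's lemma\<close>

context weil_data
begin

lemma chi_neq_0: "chi x \<noteq> 0"
  using chi_add[of x "- x"] chi_zero by auto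

lemma chi_minus_mult: "chi (- x) * chi x = 1"
  using chi_add[of "- x" x] chi_zero by simp

lemma chi_diff_eq_1: "chi x = 1 \<Longrightarrow> chi y = 1 \<Longrightarrow> chi (x - y) = 1"
  using chi_add[of "x - y" y] by simp

lemma chi_diff_eq_1_iff: "chi (x - y) = 1 \<longleftrightarrow> chi x = chi y"
  using chi_add[of "x - y" y] chi_neq_0[of y] by (metis diff_add_cancel mult_cancel_right1)

text \<open>The factor chi(m(u)/2) for w = (u, m) gives the composition law weyl w1 (weyl w2 \<Phi>)
  = chi(omega(w1, w2)/2) weyl (w1 + w2) \<Phi>.\<close>

definition weyl :: "'x \<times> ('x \<Rightarrow> 'f) \<Rightarrow> ('x \<Rightarrow> 'r) \<Rightarrow> 'x \<Rightarrow> 'r" where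
  "weyl w \<Phi> x = chi (snd w x + snd w (fst w) / 2) * \<Phi> (x + fst w)"

text \<open>Nothing is said about T outside \<open>SX\<close>, in contrast to the extensional
  elements of \<open>Aut_S\<close>; operators can therefore be composed as plain functions and
  restricted at the very end.\<close>

definition lin_op :: "(('x \<Rightarrow> 'r) \<Rightarrow> ('x \<Rightarrow> 'r)) \<Rightarrow> bool" where
  "lin_op T \<longleftrightarrow> (\<forall>\<Phi>\<in>SX. T \<Phi> \<in> SX) \<and>
     (\<forall>\<Phi>\<in>SX. \<forall>\<Psi>\<in>SX. T (\<lambda>x. \<Phi> x + \<Psi> x) = (\<lambda>x. T \<Phi> x + T \<Psi> x)) \<and>
     (\<forall>c. \<forall>\<Phi>\<in>SX. T (\<lambda>x. c * \<Phi> x) = (\<lambda>x. c * T \<Phi> x))"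

lemma lin_opD:
  assumes "lin_op T" "\<Phi> \<in> SX"
  shows "T \<Phi> \<in> SX"
    and "\<Psi> \<in> SX \<Longrightarrow> T (\<lambda>x. \<Phi> x + \<Psi> x) = (\<lambda>x. T \<Phi> x + T \<Psi> x)"
    and "T (\<lambda>x. c * \<Phi> x) = (\<lambda>x. c * T \<Phi> x)"
  using assms unfolding lin_op_def by simp_all

lemma lin_op_comp: "lin_op S \<Longrightarrow> lin_op T \<Longrightarrow> lin_op (\<lambda>\<Phi>. S (T \<Phi>))"
  unfolding lin_op_def by simp

lemma lin_op_sum:
  assumes T: "lin_op T" and "finite A" "\<And>a. a \<in> A \<Longrightarrow> f a \<in> SX"
  shows "(\<lambda>x. \<Sum>a\<in>A. f a x) \<in> SX \<and> T (\<lambda>x. \<Sum>a\<in>A. f a x) = (\<lambda>x. \<Sum>a\<in>A. T (f a) x)"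
  using assms(2,3)
proof (induction A rule: finite_induct)
  case empty
  \<comment> \<open>T vanishes at the zero function by homogeneity with c = 0.\<close>
  have "T (\<lambda>x. 0 * 0) = (\<lambda>x. 0 * T (\<lambda>x. 0) x)" by (rule lin_opD(3)[OF T schwartz_zero])
  then show ?case by (simp add: schwartz_zero)
next
  case (insert a A)
  then show ?case
    by (simp add: schwartz_add lin_opD(2)[OF T])
qed

text \<open>The radius r may depend on R. This matters for quadratic characters, which are uniformly
  locally constant on bounded sets but in general not on all of X; the support of
  \<open>\<Phi>\<close> is bounded.\<close>

lemma schwartz_mult_locally_constant:
  assumes \<Phi>: "\<Phi> \<in> SX"
    and g: "\<And>R. \<exists>r>0. \<forall>x y. nrm x \<le> R \<longrightarrow> nrm y \<le> r \<longrightarrow> g (x + y) = g x"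
  shows "(\<lambda>x. g x * \<Phi> x) \<in> (SX :: ('x \<Rightarrow> 'r) set)"
proof -
  obtain r R where 1: "r > 0" "periodic {x. nrm x \<le> r} \<Phi>" "R \<ge> 0" "\<forall>x. \<Phi> x \<noteq> 0 \<longrightarrow> nrm x \<le> R"
    by (rule schwartzE[OF \<Phi>])
  obtain s where s: "s > 0" "\<forall>x y. nrm x \<le> R \<longrightarrow> nrm y \<le> s \<longrightarrow> g (x + y) = g x"
    using g by blast
  show ?thesis
  proof (rule schwartzI[of "min r s" _ R])
    show "0 < min r s" using 1 s by simp
    fix x y assume y: "nrm y \<le> min r s"
    then have "\<Phi> (x + y) = \<Phi> x" using 1(2) by (simp add: periodic_def)
    then show "g (x + y) * \<Phi> (x + y) = g x * \<Phi> x"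
      using s(2) 1(4) y by (cases "\<Phi> x = 0") simp_all
  next
    fix x assume "g x * \<Phi> x \<noteq> 0"
    then show "nrm x \<le> R" using 1(4) by simp
  qed
qed

lemma schwartz_chi_mult:
  assumes \<Phi>: "\<Phi> \<in> SX" and l: "l \<in> dual smul"
  shows "(\<lambda>x. chi (l x) * \<Phi> x) \<in> SX"
proof (rule schwartz_mult_locally_constant[OF \<Phi>])
  fix R :: real
  obtain C where C: "C > 0" "\<And>x. absv (l x) \<le> C * nrm x" by (rule dual_bound[OF l]) blast
  obtain \<delta> where \<delta>: "\<delta> > 0" "\<forall>z. absv z < \<delta> \<longrightarrow> chi z = 1" using chi_smooth by blast
  have "chi (l (x + y)) = chi (l x)" if "nrm y \<le> \<delta> / (2 * C)" for x y
  proof -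
    have "C * nrm y \<le> \<delta> / 2" using that C(1) by (simp add: field_simps)
    then have "absv (l y) < \<delta>" using C(2)[of y] \<delta>(1) by linarith
    then show ?thesis using \<delta>(2) by (simp add: dualD[OF l] chi_add)
  qed
  then show "\<exists>r>0. \<forall>x y. nrm x \<le> R \<longrightarrow> nrm y \<le> r \<longrightarrow> chi (l (x + y)) = chi (l x)"
    using \<delta>(1) C(1) by (intro exI[of _ "\<delta> / (2 * C)"]) simp
qed

text \<open>The exponent changes by k l(y) l(2x + y), which is small for small y as long as x stays
  bounded.\<close>

lemma schwartz_chi_square_mult:
  assumes \<Phi>: "\<Phi> \<in> SX" and l: "l \<in> dual smul"
  shows "(\<lambda>x. chi (k * (l x * l x)) * \<Phi> x) \<in> SX"
proof (rule schwartz_mult_locally_constant[OF \<Phi>])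
  fix R :: real
  obtain C where C: "C > 0" "\<And>x. absv (l x) \<le> C * nrm x" by (rule dual_bound[OF l]) blast
  obtain \<delta> where \<delta>: "\<delta> > 0" "\<forall>z. absv z < \<delta> \<longrightarrow> chi z = 1" using chi_smooth by blast
  define M where "M = max R 1"
  \<comment> \<open>D times \<open>nrm y\<close> bounds the change of the exponent; adding 1 keeps D
    positive when k = 0.\<close>
  define D where "D = (absv k + 1) * (C * (C * M))"
  define r where "r = min M (\<delta> / (2 * D))"
  have M: "M > 0" "R \<le> M" by (auto simp: M_def)
  have D: "D > 0" unfolding D_def using C(1) M(1) absv_nonneg[of k] by (intro mult_pos_pos) simp_all
  have "chi (k * (l (x + y) * l (x + y))) = chi (k * (l x * l x))" if x: "nrm x \<le> R" and y: "nrm y \<le> r" for x y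
  proof -
    have "absv (l (x + (x + y))) \<le> C * M"
    proof -
      have "nrm (x + (x + y)) \<le> M"
        using nrm_add[of x "x + y"] nrm_add[of x y] x y M(2) unfolding r_def by linarith
      then show ?thesis using C order_trans[OF C(2)] by (simp add: mult_left_mono)
    qed
    then have "absv k * (absv (l y) * absv (l (x + (x + y)))) \<le> (absv k + 1) * (C * nrm y * (C * M))"
      using C(1,2) by (intro mult_mono) (simp_all add: absv_nonneg nrm_nonneg)
    also have "\<dots> = D * nrm y" by (simp add: D_def)
    also have "\<dots> \<le> D * (\<delta> / (2 * D))" using y D unfolding r_def by (intro mult_left_mono) auto
    also have "\<dots> < \<delta>" using D \<delta>(1) by simp
    finally have "chi (k * (l y * l (x + (x + y)))) = 1" using \<delta>(2) by (simp add: absv_mult)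
    moreover have "k * (l (x + y) * l (x + y)) = k * (l x * l x) + k * (l y * l (x + (x + y)))"
      by (simp add: dualD[OF l] algebra_simps)
    ultimately show ?thesis by (simp add: chi_add)
  qed
  moreover have "r > 0" using M D \<delta>(1) by (simp add: r_def)
  ultimately show "\<exists>r>0. \<forall>x y. nrm x \<le> R \<longrightarrow> nrm y \<le> r \<longrightarrow>
      chi (k * (l (x + y) * l (x + y))) = chi (k * (l x * l x))" by blast
qed

lemma weyl_schwartz:
  assumes "w \<in> W smul" "\<Phi> \<in> SX" shows "weyl w \<Phi> \<in> SX"
proof -
  have l: "snd w \<in> dual smul" using assms(1) by (auto simp: W_def)
  have "weyl w \<Phi> = (\<lambda>x. chi (snd w (fst w) / 2) * (chi (snd w x) * \<Phi> (x + fst w)))"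
    by (simp add: weyl_def fun_eq_iff chi_add mult_ac)
  then show ?thesis
    using schwartz_mult[OF schwartz_chi_mult[OF schwartz_translate[OF assms(2)] l]] by simp
qed

section \<open>Polar lattices of X\<close>

text \<open>Lattices given by duality rather than balls, so that points outside are separated from the
  lattice by characters without knowing the conductor of \<open>chi\<close>.\<close>
definition polar_lattice :: "'f \<Rightarrow> 'x set" where
  "polar_lattice k = {x. \<forall>b\<in>B. \<forall>c. absv c \<le> 1 \<longrightarrow> chi (k * c * coord x b) = 1}"

lemma add_subgroup_polar_lattice: "add_subgroup (polar_lattice k)"
  unfolding add_subgroup_def polar_lattice_def
  by (auto simp: coord_zero chi_zero coord_diff right_diff_distrib chi_diff_eq_1)

lemma polar_lattice_absorbing:
  assumes "k \<noteq> 0" shows "\<exists>r>0. \<forall>x. nrm x \<le> r \<longrightarrow> x \<in> polar_lattice k"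
proof -
  obtain \<delta> where \<delta>: "\<delta> > 0" "\<forall>z. absv z < \<delta> \<longrightarrow> chi z = 1" using chi_smooth by blast
  let ?r = "\<delta> / (2 * absv k)"
  have k: "absv k > 0" using assms by (rule absv_pos)
  have "x \<in> polar_lattice k" if x: "nrm x \<le> ?r" for x
    unfolding polar_lattice_def
  proof (intro CollectI ballI allI impI)
    fix b c assume b: "b \<in> B" and c: "absv c \<le> 1"
    have "absv c * absv (coord x b) \<le> 1 * ?r"
      using c order_trans[OF absv_coord_le[OF b, of x] x] absv_nonneg by (intro mult_mono) simp_all
    then have "absv k * (absv c * absv (coord x b)) \<le> absv k * ?r"
      using k by (intro mult_left_mono) simp_all
    also have "\<dots> < \<delta>" using k \<delta>(1) by simp
    finally show "chi (k * c * coord x b) = 1" using \<delta>(2) by (simp add: absv_mult mult.assoc)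
  qed
  then show ?thesis using \<delta>(1) k by (intro exI[of _ ?r]) simp
qed

text \<open>If the b-coordinate of x were too large, c = z / (k x_b) would lie in the unit ball, and
  membership in the lattice would force chi(z) = 1.\<close>

lemma polar_lattice_bound:
  assumes "chi z \<noteq> 1" "k \<noteq> 0" "x \<in> polar_lattice k"
  shows "nrm x \<le> absv z / absv k"
proof (subst nrm_le_iff)
  show "0 \<le> absv z / absv k" by (simp add: absv_nonneg)
  show "\<forall>b\<in>B. absv (coord x b) \<le> absv z / absv k"
  proof (intro ballI leI notI)
    fix b assume b: "b \<in> B" and less: "absv z / absv k < absv (coord x b)"
    have k: "absv k > 0" using assms(2) by (rule absv_pos)
    have x: "coord x b \<noteq> 0"
      using less divide_nonneg_pos[OF absv_nonneg[of z] k] by (auto simp: absv_zero)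
    have "absv (z / (k * coord x b)) \<le> 1"
      using less k absv_pos[OF x] by (simp add: absv_divide absv_mult field_simps)
    then have "chi (k * (z / (k * coord x b)) * coord x b) = 1"
      using assms(3) b unfolding polar_lattice_def by blast
    then show False using assms(1,2) x by simp
  qed
qed

lemma polar_lattice_small:
  assumes "r > 0" shows "\<exists>k. k \<noteq> 0 \<and> polar_lattice k \<subseteq> {x. nrm x \<le> r}"
proof -
  obtain z where z: "chi z \<noteq> 1" using chi_nontrivial by blast
  obtain k where k: "k \<noteq> 0" "absv z / r < absv k" using ex_absv_greater by blast
  have "absv z / absv k \<le> r" using k(2) assms absv_pos[OF k(1)] by (simp add: field_simps)
  then have "polar_lattice k \<subseteq> {x. nrm x \<le> r}"
    using polar_lattice_bound[OF z k(1)] order_trans by blast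
  with k(1) show ?thesis by blast
qed

text \<open>Rescaling c to k c / k' keeps it in the unit ball, so the conditions for k are among
  those for k'.\<close>

lemma polar_lattice_antimono:
  assumes "k' \<noteq> 0" "absv k \<le> absv k'" shows "polar_lattice k' \<subseteq> polar_lattice k"
proof
  fix x assume x: "x \<in> polar_lattice k'"
  show "x \<in> polar_lattice k"
    unfolding polar_lattice_def
  proof (intro CollectI ballI allI impI)
    fix b c assume b: "b \<in> B" and c: "absv c \<le> 1"
    have "absv (k * c / k') \<le> 1"
      using mult_mono[OF assms(2) c] absv_pos[OF assms(1)] by (simp add: absv_divide absv_mult absv_nonneg)
    then have "chi (k' * (k * c / k') * coord x b) = 1"
      using x b unfolding polar_lattice_def by blast
    then show "chi (k * c * coord x b) = 1" using assms(1) by simp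
  qed
qed

lemma polar_lattice_separation:
  assumes "x \<notin> polar_lattice k"
  shows "\<exists>l\<in>dual smul. (\<forall>y\<in>polar_lattice k. chi (l y) = 1) \<and> chi (l x) \<noteq> 1"
proof -
  obtain b c where b: "b \<in> B" "absv c \<le> 1" "chi (k * c * coord x b) \<noteq> 1"
    using assms unfolding polar_lattice_def by blast
  show ?thesis
  proof (rule bexI[of _ "\<lambda>y. k * c * coord y b"])
    show "(\<lambda>y. k * c * coord y b) \<in> dual smul"
      by (simp add: dual_iff coord_add coord_scale algebra_simps)
    show "(\<forall>y\<in>polar_lattice k. chi (k * c * coord y b) = 1) \<and> chi (k * c * coord x b) \<noteq> 1"
      using b unfolding polar_lattice_def by blast
  qed
qed

abbreviation lattice_ind :: "'f \<Rightarrow> 'x \<Rightarrow> 'r" where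
  "lattice_ind k \<equiv> \<lambda>x. of_bool (x \<in> polar_lattice k)"

lemma lattice_ind_schwartz: assumes "k \<noteq> 0" shows "lattice_ind k \<in> SX"
proof -
  obtain z where z: "chi z \<noteq> 1" using chi_nontrivial by blast
  obtain r where "r > 0" "\<forall>x. nrm x \<le> r \<longrightarrow> x \<in> polar_lattice k"
    using polar_lattice_absorbing[OF assms] by blast
  then show ?thesis
    by (intro schwartz_indicator[OF add_subgroup_polar_lattice, of r _ "absv z / absv k"]
      polar_lattice_bound[OF z assms]) simp_all
qed

lemma lattice_ind_translate:
  assumes "y \<in> polar_lattice k" shows "(\<lambda>x. lattice_ind k (x + y)) = lattice_ind k"
proof -
  have "x + y \<in> polar_lattice k \<longleftrightarrow> x \<in> polar_lattice k" for x
    using add_subgroupD(3)[OF add_subgroup_polar_lattice _ assms, of x]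
      add_subgroupD(4)[OF add_subgroup_polar_lattice _ assms, of "x + y"] by auto
  then show ?thesis by simp
qed

text \<open>An operator commuting with the characters of X maps the indicator of a polar lattice to a
  function supported on that lattice, since it preserves eigenfunctions; translations then make
  it constant there.\<close>

lemma schur:
  assumes T: "lin_op T"
    and comm: "\<And>w \<Phi>. w \<in> W smul \<Longrightarrow> \<Phi> \<in> SX \<Longrightarrow> T (weyl w \<Phi>) = weyl w (T \<Phi>)"
  shows "\<exists>c. \<forall>\<Phi>\<in>SX. T \<Phi> = (\<lambda>x. c * \<Phi> x)"
proof -
  have zero_dual: "(\<lambda>x. 0) \<in> dual smul" by (simp add: dual_iff)
  have trans: "T (\<lambda>x. \<Phi> (x + v)) = (\<lambda>x. T \<Phi> (x + v))" if "\<Phi> \<in> SX" for \<Phi> v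
    using comm[of "(v, \<lambda>x. 0)" \<Phi>] that zero_dual by (simp add: W_def weyl_def[abs_def] chi_zero)
  have char: "T (\<lambda>x. chi (l x) * \<Phi> x) = (\<lambda>x. chi (l x) * T \<Phi> x)" if "\<Phi> \<in> SX" "l \<in> dual smul" for \<Phi> l
    using comm[of "(0, l)" \<Phi>] that by (simp add: W_def weyl_def[abs_def] dualD)
  define \<tau> where "\<tau> k = T (lattice_ind k) 0" for k
  have T_ind: "T (lattice_ind k) x = \<tau> k * of_bool (x \<in> polar_lattice k)" if k: "k \<noteq> 0" for k x
  proof (cases "x \<in> polar_lattice k")
    case True
    have "T (lattice_ind k) = (\<lambda>y. T (lattice_ind k) (y + x))"
      using trans[OF lattice_ind_schwartz[OF k], of x] lattice_ind_translate[OF True] by simp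
    then have "T (lattice_ind k) 0 = T (lattice_ind k) (0 + x)" by (rule fun_cong)
    then show ?thesis using True by (simp add: \<tau>_def)
  next
    case False
    obtain l where l: "l \<in> dual smul" "\<forall>y\<in>polar_lattice k. chi (l y) = 1" "chi (l x) \<noteq> 1"
      using polar_lattice_separation[OF False] by blast
    have "(\<lambda>y. chi (l y) * lattice_ind k y) = lattice_ind k" using l(2) by auto
    then have "T (lattice_ind k) = (\<lambda>y. chi (l y) * T (lattice_ind k) y)"
      using char[OF lattice_ind_schwartz[OF k] l(1)] by simp
    then have "T (lattice_ind k) x = chi (l x) * T (lattice_ind k) x" by (rule fun_cong)
    then have "T (lattice_ind k) x = 0" using l(3) by simp
    then show ?thesis using False by simp
  qed
  \<comment> \<open>A function periodic under one lattice is a finite combination of translates of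
    its indicator, and T commutes with translations.\<close>
  have key: "T \<Phi> x = \<tau> k * \<Phi> x"
    if k: "k \<noteq> 0" and \<Phi>: "\<Phi> \<in> SX" and per: "periodic (polar_lattice k) \<Phi>" for k \<Phi> x
  proof -
    let ?L = "polar_lattice k"
    let ?A = "coset_rep ?L ` {x. \<Phi> x \<noteq> 0}"
    obtain r R where R: "r > 0" "periodic {x. nrm x \<le> r} \<Phi>" "R \<ge> 0" "\<forall>x. \<Phi> x \<noteq> 0 \<longrightarrow> nrm x \<le> R"
      by (rule schwartzE[OF \<Phi>])
    obtain s where s: "s > 0" "\<forall>x. nrm x \<le> s \<longrightarrow> x \<in> ?L" using polar_lattice_absorbing[OF k] by blast
    have "finite_mod ?L {x. nrm x \<le> R}"
      using finite_mod_nrm_ball[OF add_subgroup_polar_lattice s(1)] s(2) by simp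
    then have fin: "finite_mod ?L {x. \<Phi> x \<noteq> 0}" by (rule finite_mod_subset) (use R(4) in auto)
    note dec = coset_decomposition[OF add_subgroup_polar_lattice per fin]
    let ?f = "\<lambda>c x. \<Phi> c * lattice_ind k (x + - c)"
    have f: "?f c \<in> SX" for c
      by (rule schwartz_mult[OF schwartz_translate[OF lattice_ind_schwartz[OF k]]])
    have Tf: "T (?f c) = (\<lambda>x. \<Phi> c * T (lattice_ind k) (x + - c))" for c
      using lin_opD(3)[OF T schwartz_translate[OF lattice_ind_schwartz[OF k]], of "\<Phi> c" "- c"]
        trans[OF lattice_ind_schwartz[OF k], of "- c"] by (simp only:)
    have "\<Phi> = (\<lambda>x. \<Sum>c\<in>?A. ?f c x)" unfolding add_uminus_conv_diff by (rule ext, rule dec)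
    then have "T \<Phi> = T (\<lambda>x. \<Sum>c\<in>?A. ?f c x)" by (rule arg_cong)
    also have "\<dots> = (\<lambda>x. \<Sum>c\<in>?A. T (?f c) x)"
      using lin_op_sum[OF T, of ?A ?f] f fin unfolding finite_mod_def by blast
    finally have "T \<Phi> x = (\<Sum>c\<in>?A. T (?f c) x)" by (rule fun_cong)
    also have "\<dots> = (\<Sum>c\<in>?A. \<tau> k * (\<Phi> c * of_bool (x - c \<in> ?L)))"
      unfolding Tf T_ind[OF k] by (simp add: mult_ac)
    also have "\<dots> = \<tau> k * \<Phi> x" using dec[of x] by (simp flip: sum_distrib_left)
    finally show ?thesis .
  qed
  \<comment> \<open>The scalar is the same for all lattices: the indicator of the larger one is
    periodic under the smaller, so T acts on it by both scalars, and the value at 0 compares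
    them.\<close>
  have nested: "\<tau> k = \<tau> k'" if "k \<noteq> 0" "k' \<noteq> 0" "absv k \<le> absv k'" for k k'
  proof -
    have "periodic (polar_lattice k') (lattice_ind k)"
      unfolding periodic_def
    proof (intro allI ballI)
      fix x y assume "y \<in> polar_lattice k'"
      then have "y \<in> polar_lattice k" using polar_lattice_antimono[OF that(2,3)] by blast
      then show "lattice_ind k (x + y) = lattice_ind k x" by (rule lattice_ind_translate[THEN fun_cong])
    qed
    from key[OF that(2) lattice_ind_schwartz[OF that(1)] this, of 0] show ?thesis
      using add_subgroupD(1)[OF add_subgroup_polar_lattice] by (simp add: \<tau>_def)
  qed
  have const: "\<tau> k = \<tau> 1" if "k \<noteq> 0" for k
    using nested[of k 1] nested[of 1 k] that by (cases "absv k \<le> absv 1") simp_all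
  have "T \<Phi> = (\<lambda>x. \<tau> 1 * \<Phi> x)" if \<Phi>: "\<Phi> \<in> SX" for \<Phi>
  proof -
    obtain r R where R: "r > 0" "periodic {x. nrm x \<le> r} \<Phi>" "R \<ge> 0" "\<forall>x. \<Phi> x \<noteq> 0 \<longrightarrow> nrm x \<le> R"
      by (rule schwartzE[OF \<Phi>])
    obtain k where k: "k \<noteq> 0" "polar_lattice k \<subseteq> {x. nrm x \<le> r}" using polar_lattice_small[OF R(1)] by blast
    show ?thesis using key[OF k(1) \<Phi> periodic_mono[OF R(2) k(2)]] const[OF k(1)] by auto
  qed
  then show ?thesis by blast
qed

end

section \<open>Partial Fourier transforms\<close>

context weil_data
begin

text \<open>The inverse operator is carried along explicitly, so that products, inverses and
  conjugates are handled without choosing inverse functions. The values of \<open>\<sigma>\<close>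
  outside W are irrelevant.\<close>

definition implemented :: "('x \<times> ('x \<Rightarrow> 'f) \<Rightarrow> 'x \<times> ('x \<Rightarrow> 'f)) \<Rightarrow> bool" where
  "implemented \<sigma> \<longleftrightarrow> (\<exists>s s'. lin_op s \<and> lin_op s' \<and> (\<forall>\<Phi>\<in>SX. s' (s \<Phi>) = \<Phi> \<and> s (s' \<Phi>) = \<Phi>) \<and>
     (\<forall>w\<in>W smul. \<forall>\<Phi>\<in>SX. s (weyl w \<Phi>) = weyl (\<sigma> w) (s \<Phi>)))"

lemma implemented_shear:
  assumes e: "e \<in> dual smul"
  shows "implemented (\<lambda>(u, m). (u, \<lambda>x. m x + k * e u * e x))"
proof -
  let ?s = "\<lambda>k \<Phi> x. chi (k * (e x * e x)) * \<Phi> x"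
  have lin: "lin_op (?s k)" for k
    unfolding lin_op_def
    using schwartz_chi_square_mult[OF _ e, of _ k] by (auto simp: algebra_simps)
  have inv: "?s (- k) (?s k \<Phi>) = \<Phi>" for k \<Phi>
    using chi_minus_mult by (simp flip: mult.assoc)
  have "?s (- k / 2) (weyl (u, m) \<Phi>) = weyl (u, \<lambda>x. m x + k * e u * e x) (?s (- k / 2) \<Phi>)" for u m \<Phi>
  proof
    fix x
    \<comment> \<open>Expanding e(x + u)^2: the cross term cancels the shear k e(u) e(x), and the
      term in e(u)^2 cancels the change in the symmetrising factor.\<close>
    have "- k / 2 * (e x * e x) + (m x + m u / 2) =
        (m x + k * e u * e x + (m u + k * e u * e u) / 2) + - k / 2 * (e (x + u) * e (x + u))"
      using two_neq_0 by (simp add: dualD[OF e] field_simps)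
    from arg_cong[OF this, of chi] have "chi (- k / 2 * (e x * e x)) * chi (m x + m u / 2) =
        chi (m x + k * e u * e x + (m u + k * e u * e u) / 2) * chi (- k / 2 * (e (x + u) * e (x + u)))"
      by (simp only: chi_add)
    then show "?s (- k / 2) (weyl (u, m) \<Phi>) x = weyl (u, \<lambda>x. m x + k * e u * e x) (?s (- k / 2) \<Phi>) x"
      unfolding weyl_def fst_conv snd_conv mult.assoc[symmetric] by simp
  qed
  then show ?thesis
    unfolding implemented_def
    using lin[of "- k / 2"] lin[of "k / 2"] inv[of "- k / 2"] inv[of "k / 2"]
    by (intro exI[of _ "?s (- k / 2)"] exI[of _ "?s (k / 2)"]) auto
qed

text \<open>With l v = 1, X splits into F v and the kernel of l, and x + (y - l x) v is x with its
  v-coordinate replaced by y. Only that coordinate is transformed; \<epsilon>, a square root of 1,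
  is the sign in the kernel.\<close>

definition pfourier :: "'x \<Rightarrow> ('x \<Rightarrow> 'f) \<Rightarrow> 'f \<Rightarrow> ('x \<Rightarrow> 'r) \<Rightarrow> 'x \<Rightarrow> 'r" where
  "pfourier v l \<epsilon> \<Phi> x = haar (\<lambda>y. \<Phi> (x + smul (y - l x) v) * chi (\<epsilon> * l x * y))"

text \<open>It acts on the plane spanned by (v, 0) and (0, l) and is trivial on its symplectic
  complement. In the coordinates a = l(u), b = m(v) of (u, m) it sends (a, b) to (\<epsilon> b,
  -\<epsilon> a), so the opposite sign gives the inverse.\<close>

definition rotation :: "'x \<Rightarrow> ('x \<Rightarrow> 'f) \<Rightarrow> 'f \<Rightarrow> 'x \<times> ('x \<Rightarrow> 'f) \<Rightarrow> 'x \<times> ('x \<Rightarrow> 'f)" where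
  "rotation v l \<epsilon> w = (fst w + smul (\<epsilon> * snd w v - l (fst w)) v,
     \<lambda>x. snd w x - (snd w v + \<epsilon> * l (fst w)) * l x)"

context
  fixes v :: 'x and l :: "'x \<Rightarrow> 'f"
  assumes l: "l \<in> dual smul" and lv: "l v = 1"
begin

text \<open>The integration variable y is the value of l at the point where \<open>\<Phi>\<close> is
  evaluated, and that point lies in a bounded set.\<close>

lemma pfourier_integrand_bound:
  assumes "\<forall>x. \<Phi> x \<noteq> (0::'r) \<longrightarrow> nrm x \<le> R" "\<And>x. absv (l x) \<le> C * nrm x" "C > 0"
    and "\<Phi> (x + smul (y - l x) v) \<noteq> 0"
  shows "absv y \<le> C * R"
proof -
  have "y = l (x + smul (y - l x) v)" by (simp add: dualD[OF l] lv)
  then have "absv y \<le> C * nrm (x + smul (y - l x) v)" using assms(2) by metis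
  also have "\<dots> \<le> C * R" using assms by (intro mult_left_mono) auto
  finally show ?thesis .
qed

lemma ex_radius_smul: assumes "0 < r" shows "\<exists>t>0. \<forall>h. absv h \<le> t \<longrightarrow> nrm (smul h v) \<le> r"
proof (intro exI conjI allI impI)
  show t: "0 < r / (nrm v + 1)" using assms nrm_nonneg[of v] by simp
  fix h assume h: "absv h \<le> r / (nrm v + 1)"
  have "nrm (smul h v) \<le> absv h * nrm v" by (rule nrm_scale)
  also have "\<dots> \<le> r / (nrm v + 1) * (nrm v + 1)"
    using h t nrm_nonneg[of v] by (intro mult_mono) simp_all
  also have "\<dots> = r" using nrm_nonneg[of v] by simp
  finally show "nrm (smul h v) \<le> r" .
qed

lemma pfourier_integrand_schwartz1:
  assumes \<Phi>: "\<Phi> \<in> SX"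
  shows "schwartz1 (\<lambda>y. \<Phi> (x + smul (y - l x) v) * chi (b * y))"
proof -
  obtain r R where 1: "r > 0" "periodic {x. nrm x \<le> r} \<Phi>" "R \<ge> 0" "\<forall>x. \<Phi> x \<noteq> 0 \<longrightarrow> nrm x \<le> R"
    by (rule schwartzE[OF \<Phi>])
  obtain C where C: "C > 0" "\<And>x. absv (l x) \<le> C * nrm x" by (rule dual_bound[OF l]) blast
  obtain \<delta> where \<delta>: "\<delta> > 0" "\<forall>z. absv z < \<delta> \<longrightarrow> chi z = 1" using chi_smooth by blast
  obtain t where t: "t > 0" "\<forall>h. absv h \<le> t \<longrightarrow> nrm (smul h v) \<le> r" using ex_radius_smul[OF 1(1)] by blast
  obtain M where M: "M > 0" "absv b \<le> M"
    using absv_nonneg[of b] by (intro that[of "absv b + 1"]) simp_all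
  define s where "s = min t (\<delta> / (2 * M))"
  have s: "s > 0" using t(1) \<delta>(1) M(1) by (simp add: s_def)
  have "\<Phi> (x + smul (y + h - l x) v) * chi (b * (y + h)) = \<Phi> (x + smul (y - l x) v) * chi (b * y)"
    if h: "absv h \<le> s" for y h
  proof -
    have eq: "x + smul (y + h - l x) v = (x + smul (y - l x) v) + smul h v"
      by (simp add: algebra_simps scale_left_distrib scale_left_diff_distrib)
    have "\<Phi> (x + smul (y + h - l x) v) = \<Phi> (x + smul (y - l x) v)"
      unfolding eq by (rule periodicD[OF 1(2)]) (use t(2) h in \<open>simp add: s_def\<close>)
    moreover have "chi (b * h) = 1"
    proof -
      have "absv b * absv h \<le> M * (\<delta> / (2 * M))"
        using h M absv_nonneg[of h] unfolding s_def by (intro mult_mono) auto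
      also have "\<dots> < \<delta>" using \<delta>(1) M(1) by simp
      finally show ?thesis using \<delta>(2) by (simp add: absv_mult)
    qed
    ultimately show ?thesis by (simp add: distrib_left chi_add)
  qed
  then have "periodic {y. absv y \<le> s} (\<lambda>y. \<Phi> (x + smul (y - l x) v) * chi (b * y))"
    by (simp add: periodic_def)
  moreover have "\<forall>y. \<Phi> (x + smul (y - l x) v) * chi (b * y) \<noteq> 0 \<longrightarrow> absv y \<le> C * R"
    by (intro allI impI, rule pfourier_integrand_bound[OF 1(4) C(2,1), where x = x]) simp
  ultimately show ?thesis unfolding schwartz1_def using s by blast
qed

text \<open>Smoothness and decay exchange roles. The transform is locally constant because y is
  bounded on the support of the integrand. It vanishes for large l(x) because a small shift of y,
  invisible to \<open>\<Phi>\<close>, multiplies the integral by a value of chi other than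
  1.\<close>

lemma pfourier_schwartz:
  assumes \<Phi>: "\<Phi> \<in> SX" and \<epsilon>: "\<epsilon> * \<epsilon> = 1"
  shows "pfourier v l \<epsilon> \<Phi> \<in> SX"
proof -
  note abs_\<epsilon> = absv_sqrt_1[OF \<epsilon>]
  obtain r R where 1: "r > 0" "periodic {x. nrm x \<le> r} \<Phi>" "R \<ge> 0" "\<forall>x. \<Phi> x \<noteq> 0 \<longrightarrow> nrm x \<le> R"
    by (rule schwartzE[OF \<Phi>])
  obtain C where C: "C > 0" "\<And>x. absv (l x) \<le> C * nrm x" by (rule dual_bound[OF l]) blast
  obtain \<delta> where \<delta>: "\<delta> > 0" "\<forall>z. absv z < \<delta> \<longrightarrow> chi z = 1" using chi_smooth by blast
  obtain z1 where z1: "chi z1 \<noteq> 1" using chi_nontrivial by blast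
  obtain t where t: "t > 0" "\<forall>h. absv h \<le> t \<longrightarrow> nrm (smul h v) \<le> r" using ex_radius_smul[OF 1(1)] by blast
  \<comment> \<open>The bounds r and t / C keep the moved argument within the period of
    \<open>\<Phi>\<close>; the last one makes the phase trivial for |y| at most C R, with 1 added so
    that the denominator is positive when R = 0.\<close>
  define s where "s = min (min r (t / C)) (\<delta> / (2 * (C * (C * R + 1))))"
  have CR: "C * R \<ge> 0" using C(1) 1(3) by simp
  have s: "s > 0" using 1(1) t(1) C(1) \<delta>(1) CR by (simp add: s_def)
  show ?thesis
  proof (rule schwartzI[OF s])
    fix x z assume z: "nrm z \<le> s"
    have "absv (l z) \<le> C * (t / C)"
      using order_trans[OF C(2)[of z] mult_left_mono[of "nrm z" "t / C" C]] z C(1) by (simp add: s_def)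
    then have "absv (- l z) \<le> t" using C(1) by (simp add: absv_minus)
    then have "nrm (smul (- l z) v) \<le> r" using t(2) by blast
    then have z': "nrm (z + smul (- l z) v) \<le> r"
      using nrm_add[of z "smul (- l z) v"] z by (auto simp: s_def)
    have "\<Phi> (x + z + smul (y - l (x + z)) v) * chi (\<epsilon> * l (x + z) * y) =
        \<Phi> (x + smul (y - l x) v) * chi (\<epsilon> * l x * y)" for y
    proof -
      have eq: "x + z + smul (y - l (x + z)) v = (x + smul (y - l x) v) + (z + smul (- l z) v)"
        by (simp add: dualD[OF l] algebra_simps scale_left_distrib scale_left_diff_distrib)
      have \<Phi>_eq: "\<Phi> (x + z + smul (y - l (x + z)) v) = \<Phi> (x + smul (y - l x) v)"
        unfolding eq by (rule periodicD[OF 1(2)]) (use z' in simp)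
      show ?thesis
      proof (cases "\<Phi> (x + smul (y - l x) v) = 0")
        case True
        with \<Phi>_eq show ?thesis by simp
      next
        case False
        have "chi (\<epsilon> * l z * y) = 1"
        proof -
          have y: "absv y \<le> C * R" using pfourier_integrand_bound[OF 1(4) C(2,1) False] .
          have "absv (\<epsilon> * l z * y) = absv (l z) * absv y" by (simp add: absv_mult abs_\<epsilon>)
          also have "\<dots> \<le> (C * nrm z) * (C * R + 1)"
            using C y nrm_nonneg[of z] absv_nonneg[of y] by (intro mult_mono) simp_all
          also have "\<dots> = C * (C * R + 1) * nrm z" by simp
          also have "\<dots> \<le> C * (C * R + 1) * (\<delta> / (2 * (C * (C * R + 1))))"
            using z C(1) CR by (intro mult_left_mono) (auto simp: s_def)
          also have "\<dots> < \<delta>" using \<delta>(1) C(1) CR by simp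
          finally show ?thesis using \<delta>(2) by blast
        qed
        then have "chi (\<epsilon> * l (x + z) * y) = chi (\<epsilon> * l x * y)"
          by (simp add: dualD(1)[OF l] distrib_left distrib_right chi_add)
        with \<Phi>_eq show ?thesis by simp
      qed
    qed
    then show "pfourier v l \<epsilon> \<Phi> (x + z) = pfourier v l \<epsilon> \<Phi> x" by (simp add: pfourier_def)
  next
    fix x assume nz: "pfourier v l \<epsilon> \<Phi> x \<noteq> 0"
    let ?F = "\<lambda>y. \<Phi> (x + smul (y - l x) v) * chi (\<epsilon> * l x * y)"
    have F: "schwartz1 ?F" by (rule pfourier_integrand_schwartz1[OF \<Phi>])
    have "\<exists>y. \<Phi> (x + smul (y - l x) v) \<noteq> 0"
    proof (rule ccontr)
      assume "\<nexists>y. \<Phi> (x + smul (y - l x) v) \<noteq> 0"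
      then have "?F = (\<lambda>y. 0 * ?F y)" by simp
      then have "haar ?F = 0 * haar ?F" using haar_mult[OF F, of 0] by simp
      then show False using nz by (simp add: pfourier_def)
    qed
    then obtain y where y: "\<Phi> (x + smul (y - l x) v) \<noteq> 0" by blast
    then have y1: "nrm (x + smul (y - l x) v) \<le> R" and y2: "absv y \<le> C * R"
      using 1(4) pfourier_integrand_bound[OF 1(4) C(2,1)] by auto
    have lx: "absv (l x) \<le> absv z1 / t"
    proof (rule ccontr)
      assume "\<not> absv (l x) \<le> absv z1 / t"
      then have less: "absv z1 / t < absv (l x)" by simp
      have "l x \<noteq> 0" using less divide_nonneg_pos[OF absv_nonneg[of z1] t(1)] by (auto simp: absv_zero)
      have "\<epsilon> \<noteq> 0" using \<epsilon> by auto
      \<comment> \<open>Chosen so that shifting y by h adds exactly z1 to the exponent.\<close>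
      define h where "h = z1 / (\<epsilon> * l x)"
      have "absv h \<le> t"
        using less t(1) absv_pos[OF \<open>l x \<noteq> 0\<close>] by (simp add: h_def absv_divide absv_mult abs_\<epsilon> field_simps)
      then have hv: "nrm (smul h v) \<le> r" using t(2) by blast
      have "?F (y + h) = chi z1 * ?F y" for y
      proof -
        have eq: "x + smul (y + h - l x) v = (x + smul (y - l x) v) + smul h v"
          by (simp add: algebra_simps scale_left_distrib scale_left_diff_distrib)
        have "\<Phi> (x + smul (y + h - l x) v) = \<Phi> (x + smul (y - l x) v)"
          unfolding eq by (rule periodicD[OF 1(2)]) (simp add: hv)
        moreover have "\<epsilon> * l x * (y + h) = z1 + \<epsilon> * l x * y"
          using \<open>l x \<noteq> 0\<close> \<open>\<epsilon> \<noteq> 0\<close> by (simp add: h_def distrib_left)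
        ultimately show ?thesis by (simp add: chi_add)
      qed
      then have "haar ?F = chi z1 * haar ?F"
        using haar_translate[OF F, of h] haar_mult[OF F, of "chi z1"] by simp
      then show False using nz z1 by (simp add: pfourier_def)
    qed
    \<comment> \<open>x differs from a point of the support of \<open>\<Phi>\<close> by a multiple
      of v with coefficient l x - y, both terms of which are already bounded.\<close>
    have "nrm x = nrm ((x + smul (y - l x) v) + (smul (l x) v - smul y v))"
      by (simp add: scale_left_diff_distrib)
    then have "nrm x \<le> max R (max (nrm (smul (l x) v)) (nrm (smul y v)))"
      using nrm_add[of "x + smul (y - l x) v" "smul (l x) v - smul y v"]
        nrm_diff[of "smul (l x) v" "smul y v"] y1 by linarith
    moreover have "nrm (smul (l x) v) \<le> absv z1 / t * nrm v" "nrm (smul y v) \<le> C * R * nrm v"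
      using order_trans[OF nrm_scale mult_right_mono[OF lx nrm_nonneg[of v]]]
        order_trans[OF nrm_scale mult_right_mono[OF y2 nrm_nonneg[of v]]] by simp_all
    ultimately show "nrm x \<le> max R (max (absv z1 / t * nrm v) (C * R * nrm v))" by linarith
  qed
qed

lemma lin_op_pfourier:
  assumes \<epsilon>: "\<epsilon> * \<epsilon> = 1" shows "lin_op (pfourier v l \<epsilon>)"
  unfolding lin_op_def
proof (intro conjI ballI allI ext)
  show "pfourier v l \<epsilon> \<Phi> \<in> SX" if "\<Phi> \<in> SX" for \<Phi> by (rule pfourier_schwartz[OF that \<epsilon>])
  show "pfourier v l \<epsilon> (\<lambda>x. \<Phi> x + \<Psi> x) x = pfourier v l \<epsilon> \<Phi> x + pfourier v l \<epsilon> \<Psi> x"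
    if "\<Phi> \<in> SX" "\<Psi> \<in> SX" for \<Phi> \<Psi> x
    unfolding pfourier_def distrib_right
    by (rule haar_add[OF pfourier_integrand_schwartz1[OF that(1)] pfourier_integrand_schwartz1[OF that(2)]])
  show "pfourier v l \<epsilon> (\<lambda>x. c * \<Phi> x) x = c * pfourier v l \<epsilon> \<Phi> x" if "\<Phi> \<in> SX" for c \<Phi> x
    using haar_mult[OF pfourier_integrand_schwartz1[OF that, of x "\<epsilon> * l x"], of c]
    by (simp add: pfourier_def mult.assoc)
qed

text \<open>Substituting y - l(u) for y turns the shifted argument into the one for x + u'. The
  exponents then agree by bilinearity and \<epsilon> * \<epsilon> = 1, and invariance of the
  integral finishes.\<close>

lemma pfourier_weyl:
  assumes \<epsilon>: "\<epsilon> * \<epsilon> = 1" and w: "w \<in> W smul" and \<Phi>: "\<Phi> \<in> SX"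
  shows "pfourier v l \<epsilon> (weyl w \<Phi>) = weyl (rotation v l \<epsilon> w) (pfourier v l \<epsilon> \<Phi>)"
proof
  fix x
  obtain u m where um: "w = (u, m)" and m: "m \<in> dual smul" using w by (auto simp: W_def)
  have \<epsilon>2: "\<epsilon> * (\<epsilon> * c) = c" for c using \<epsilon> by (simp flip: mult.assoc)
  define u' where "u' = u + smul (\<epsilon> * m v - l u) v"
  define m' where "m' x = m x - (m v + \<epsilon> * l u) * l x" for x
  have rot: "rotation v l \<epsilon> w = (u', m')" by (simp add: rotation_def um u'_def m'_def fun_eq_iff)
  have lu': "l u' = \<epsilon> * m v" by (simp add: u'_def dualD[OF l] lv)
  have m'u': "m' u' / 2 = m u / 2 - l u * m v"
  proof -
    have "m' u' = m u' - (m v + \<epsilon> * l u) * (\<epsilon> * m v)" by (simp add: m'_def lu')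
    also have "\<dots> = m u - 2 * (l u * m v)" by (simp add: u'_def dualD[OF m] algebra_simps \<epsilon>2)
    finally show ?thesis using two_neq_0 by (simp add: field_simps)
  qed
  let ?F = "\<lambda>y. weyl w \<Phi> (x + smul (y - l x) v) * chi (\<epsilon> * l x * y)"
  let ?G = "\<lambda>y. \<Phi> (x + u' + smul (y - l (x + u')) v) * chi (\<epsilon> * l (x + u') * y)"
  have "?F (y + - l u) = chi (m' x + m' u' / 2) * ?G y" for y
  proof -
    have arg: "x + smul (y + - l u - l x) v + u = x + u' + smul (y - l (x + u')) v"
      unfolding dualD(1)[OF l] lu'
      by (simp add: u'_def algebra_simps scale_left_distrib scale_left_diff_distrib)
    have exponent: "m (x + smul (y + - l u - l x) v) + m u / 2 + \<epsilon> * l x * (y + - l u)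
        = m' x + m' u' / 2 + \<epsilon> * l (x + u') * y"
      unfolding m'u' by (simp add: dualD[OF m] dualD(1)[OF l] lu' m'_def algebra_simps \<epsilon>2)
    show ?thesis
      unfolding weyl_def um fst_conv snd_conv arg
      using arg_cong[OF exponent, of chi] by (simp add: chi_add mult_ac)
  qed
  then have "haar (\<lambda>y. ?F (y + - l u)) = haar (\<lambda>y. chi (m' x + m' u' / 2) * ?G y)" by simp
  also have "\<dots> = chi (m' x + m' u' / 2) * haar ?G"
    by (rule haar_mult[OF pfourier_integrand_schwartz1[OF \<Phi>]])
  finally have "haar ?F = chi (m' x + m' u' / 2) * haar ?G"
    by (simp only: haar_translate[OF pfourier_integrand_schwartz1[OF weyl_schwartz[OF w \<Phi>]]])
  then show "pfourier v l \<epsilon> (weyl w \<Phi>) x = weyl (rotation v l \<epsilon> w) (pfourier v l \<epsilon> \<Phi>) x"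
    by (simp add: pfourier_def weyl_def rot)
qed

lemma rotation_W: "w \<in> W smul \<Longrightarrow> rotation v l \<epsilon> w \<in> W smul"
  using l by (auto simp: W_def rotation_def dual_iff algebra_simps)

lemma rotation_inverse:
  assumes \<epsilon>: "\<epsilon> * \<epsilon> = 1" and w: "w \<in> W smul"
  shows "rotation v l (- \<epsilon>) (rotation v l \<epsilon> w) = w"
proof -
  obtain u m where um: "w = (u, m)" and m: "m \<in> dual smul" using w by (auto simp: W_def)
  have \<epsilon>2: "\<epsilon> * (\<epsilon> * c) = c" for c using \<epsilon> by (simp flip: mult.assoc)
  show ?thesis
    by (simp add: rotation_def um dualD[OF l] dualD[OF m] lv algebra_simps scale_left_diff_distrib
      scale_left_distrib \<epsilon>2)
qed

text \<open>Opposite signs make the two rotations cancel, so Schur's lemma applies. The value at 0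
  of the double transform involves the test function only on the line F v, and there c becomes a
  product of two volumes: that of the unit ball and that of its dual lattice.\<close>

lemma pfourier_inversion:
  assumes \<epsilon>: "\<epsilon> * \<epsilon> = 1"
  shows "\<exists>c. c dvd 1 \<and> (\<forall>\<Phi>\<in>SX. pfourier v l (- \<epsilon>) (pfourier v l \<epsilon> \<Phi>) = (\<lambda>x. c * \<Phi> x))"
proof -
  have \<epsilon>': "- \<epsilon> * - \<epsilon> = 1" using \<epsilon> by simp
  note abs_\<epsilon> = absv_sqrt_1[OF \<epsilon>]
  note lin = lin_op_pfourier[OF \<epsilon>]
  have "\<exists>c. \<forall>\<Phi>\<in>SX. pfourier v l (- \<epsilon>) (pfourier v l \<epsilon> \<Phi>) = (\<lambda>x. c * \<Phi> x)"
  proof (rule schur)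
    show "lin_op (\<lambda>\<Phi>. pfourier v l (- \<epsilon>) (pfourier v l \<epsilon> \<Phi>))"
      by (rule lin_op_comp[OF lin_op_pfourier[OF \<epsilon>'] lin])
    fix w and \<Phi> :: "'x \<Rightarrow> 'r" assume w: "w \<in> W smul" and \<Phi>: "\<Phi> \<in> SX"
    show "pfourier v l (- \<epsilon>) (pfourier v l \<epsilon> (weyl w \<Phi>)) = weyl w (pfourier v l (- \<epsilon>) (pfourier v l \<epsilon> \<Phi>))"
      using pfourier_weyl[OF \<epsilon> w \<Phi>] pfourier_weyl[OF \<epsilon>' rotation_W[OF w] lin_opD(1)[OF lin \<Phi>], of \<epsilon>]
        rotation_inverse[OF \<epsilon> w] by simp
  qed
  then obtain c where c: "\<And>\<Phi>. \<Phi> \<in> SX \<Longrightarrow> pfourier v l (- \<epsilon>) (pfourier v l \<epsilon> \<Phi>) = (\<lambda>x. c * \<Phi> x)" by blast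
  obtain C where C: "C > 0" "\<And>x. absv (l x) \<le> C * nrm x" by (rule dual_bound[OF l]) blast
  obtain t where t: "t > 0" "\<forall>h. absv h \<le> t \<longrightarrow> nrm (smul h v) \<le> 1" using ex_radius_smul[of 1] by auto
  \<comment> \<open>A lattice adapted to the splitting of X into F v and the kernel of l; it meets F
    v exactly in the unit ball.\<close>
  define L where "L = {x. absv (l x) \<le> 1 \<and> nrm (x - smul (l x) v) \<le> 1}"
  have L: "add_subgroup L"
    unfolding add_subgroup_def
  proof (intro conjI ballI)
    show "0 \<in> L" by (simp add: L_def dualD[OF l] absv_zero nrm_zero)
    fix x y assume xy: "x \<in> L" "y \<in> L"
    have eq: "x - y - smul (l (x - y)) v = (x - smul (l x) v) - (y - smul (l y) v)"
      by (simp add: dualD[OF l] scale_left_diff_distrib)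
    show "x - y \<in> L"
      unfolding L_def mem_Collect_eq eq unfolding dualD(5)[OF l]
      using absv_diff_le[of "l x" "l y"] nrm_diff[of "x - smul (l x) v" "y - smul (l y) v"]
        xy[unfolded L_def mem_Collect_eq] by linarith
  qed
  define \<Phi>0 :: "'x \<Rightarrow> 'r" where "\<Phi>0 x = of_bool (x \<in> L)" for x
  have \<Phi>0: "\<Phi>0 \<in> SX"
    unfolding \<Phi>0_def[abs_def]
  proof (rule schwartz_indicator[OF L, of "min 1 (min (1 / C) (t / C))" "max 1 (nrm v)"])
    show "0 < min 1 (min (1 / C) (t / C))" using C(1) t(1) by simp
    show "x \<in> L" if x: "nrm x \<le> min 1 (min (1 / C) (t / C))" for x
    proof -
      have "C * nrm x \<le> 1" "C * nrm x \<le> t" using x C(1) by (simp_all add: field_simps)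
      then have "absv (l x) \<le> 1" "nrm (smul (l x) v) \<le> 1" using C(2)[of x] t(2) by auto
      then show ?thesis
        unfolding L_def mem_Collect_eq using nrm_diff[of x "smul (l x) v"] x by (auto simp: min_le_iff_disj)
    qed
    show "nrm x \<le> max 1 (nrm v)" if x: "x \<in> L" for x
    proof -
      have "nrm (smul (l x) v) \<le> 1 * nrm v"
        using x by (intro order_trans[OF nrm_scale] mult_right_mono) (simp_all add: L_def nrm_nonneg)
      then show ?thesis using nrm_add[of "x - smul (l x) v" "smul (l x) v"] x by (auto simp: L_def)
    qed
  qed
  have \<Phi>0v: "\<Phi>0 (smul y v) = of_bool (absv y \<le> 1)" for y
    by (simp add: \<Phi>0_def L_def dualD[OF l] lv nrm_zero)
  \<comment> \<open>The dual of the unit ball under the pairing chi(\<epsilon> b y). As the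
    conductor of chi is not given, D is merely enclosed between two balls.\<close>
  define D where "D = {b. \<forall>y. absv y \<le> 1 \<longrightarrow> chi (\<epsilon> * b * y) = 1}"
  have D: "add_subgroup D"
    unfolding add_subgroup_def D_def
    by (auto simp: chi_zero left_diff_distrib right_diff_distrib chi_diff_eq_1)
  obtain \<delta> where \<delta>: "\<delta> > 0" "\<forall>z. absv z < \<delta> \<longrightarrow> chi z = 1" using chi_smooth by blast
  obtain z1 where z1: "chi z1 \<noteq> 1" using chi_nontrivial by blast
  have "{b. absv b \<le> \<delta> / 2} \<subseteq> D"
  proof
    fix b assume b: "b \<in> {b. absv b \<le> \<delta> / 2}"
    have "chi (\<epsilon> * b * y) = 1" if "absv y \<le> 1" for y
    proof -
      have "absv b * absv y \<le> \<delta> / 2 * 1"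
        using b that \<delta>(1) absv_nonneg by (intro mult_mono) simp_all
      then show ?thesis using \<delta> by (simp add: absv_mult abs_\<epsilon>)
    qed
    then show "b \<in> D" by (simp add: D_def)
  qed
  moreover have "D \<subseteq> {b. absv b \<le> absv z1}"
  proof
    fix b assume b: "b \<in> D"
    show "b \<in> {b. absv b \<le> absv z1}"
    proof (rule ccontr)
      assume "b \<notin> {b. absv b \<le> absv z1}"
      then have less: "absv z1 < absv b" by simp
      then have b0: "b \<noteq> 0" using absv_nonneg[of z1] by (auto simp: absv_zero)
      have "absv (z1 / (\<epsilon> * b)) \<le> 1"
        using less absv_pos[OF b0] by (simp add: absv_divide absv_mult abs_\<epsilon>)
      then have "chi (\<epsilon> * b * (z1 / (\<epsilon> * b))) = 1" using b unfolding D_def by blast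
      moreover have "\<epsilon> \<noteq> 0" using \<epsilon> by auto
      ultimately show False using z1 b0 by simp
    qed
  qed
  moreover have "0 < \<delta> / 2" using \<delta>(1) by simp
  ultimately have D_bounds: "0 < \<delta> / 2" "{b. absv b \<le> \<delta> / 2} \<subseteq> D" "D \<subseteq> {b. absv b \<le> absv z1}"
    by simp_all
  define h1 where "h1 = haar (\<lambda>y. of_bool (absv y \<le> 1))"
  have F1: "pfourier v l \<epsilon> \<Phi>0 (smul b v) = h1 * of_bool (b \<in> D)" for b
  proof -
    have "smul b v + smul (y - l (smul b v)) v = smul y v" for y
      by (simp add: dualD[OF l] lv flip: scale_left_distrib)
    then have eq: "pfourier v l \<epsilon> \<Phi>0 (smul b v) = haar (\<lambda>y. of_bool (absv y \<le> 1) * chi (\<epsilon> * b * y))"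
      by (simp add: pfourier_def \<Phi>0v dualD(2)[OF l] lv)
    show ?thesis
    proof (cases "b \<in> D")
      case True
      then have "(\<lambda>y. of_bool (absv y \<le> 1) * chi (\<epsilon> * b * y)) = (\<lambda>y. of_bool (absv y \<le> 1))"
        by (auto simp: D_def)
      then show ?thesis using True eq by (simp add: h1_def)
    next
      case False
      \<comment> \<open>Orthogonality of characters: translation by h preserves the unit ball and
        multiplies the integral by a value of chi other than 1, so the integral is 0.\<close>
      then obtain h where h: "absv h \<le> 1" "chi (\<epsilon> * b * h) \<noteq> 1" by (auto simp: D_def)
      let ?F = "\<lambda>y. of_bool (absv y \<le> 1) * chi (\<epsilon> * b * y)"
      have F: "schwartz1 ?F"
        using pfourier_integrand_schwartz1[OF \<Phi>0, of 0 "\<epsilon> * b"] by (simp add: dualD[OF l] \<Phi>0v)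
      have "absv (y + h) \<le> 1 \<longleftrightarrow> absv y \<le> 1" for y
        using absv_ultrametric[of y h] absv_diff_le[of "y + h" h] h(1) by auto
      then have "?F (y + h) = chi (\<epsilon> * b * h) * ?F y" for y by (simp add: distrib_left chi_add)
      then have "haar ?F = chi (\<epsilon> * b * h) * haar ?F"
        using haar_translate[OF F, of h] haar_mult[OF F, of "chi (\<epsilon> * b * h)"] by simp
      then show ?thesis using False eq h(2) by simp
    qed
  qed
  have "c = pfourier v l (- \<epsilon>) (pfourier v l \<epsilon> \<Phi>0) 0"
    using c[OF \<Phi>0] \<Phi>0v[of 0] by (simp add: absv_zero)
  also have "\<dots> = haar (\<lambda>b. h1 * of_bool (b \<in> D))"
    by (simp add: pfourier_def[of v l "- \<epsilon>"] dualD(3)[OF l] F1 chi_zero)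
  also have "\<dots> = h1 * haar (\<lambda>b. of_bool (b \<in> D))"
    by (rule haar_mult[OF schwartz1_lattice[OF D D_bounds]])
  finally have ch: "c = h1 * haar (\<lambda>b. of_bool (b \<in> D))" .
  have ball: "add_subgroup {y. absv y \<le> 1}" by (simp add: add_subgroup_ball)
  have "h1 dvd 1"
    unfolding h1_def using haar_lattice_unit[OF ball zero_less_one order_refl order_refl] by simp
  then have "c dvd 1"
    unfolding ch using mult_dvd_mono[OF _ haar_lattice_unit[OF D D_bounds], of h1 1] by simp
  with c show ?thesis by blast
qed

lemma implemented_rotation:
  assumes \<epsilon>: "\<epsilon> * \<epsilon> = 1" shows "implemented (rotation v l \<epsilon>)"
proof -
  have \<epsilon>': "- \<epsilon> * - \<epsilon> = 1" using \<epsilon> by simp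
  obtain c where c: "c dvd 1" "\<And>\<Phi>. \<Phi> \<in> SX \<Longrightarrow> pfourier v l (- \<epsilon>) (pfourier v l \<epsilon> \<Phi>) = (\<lambda>x. c * \<Phi> x)"
    using pfourier_inversion[OF \<epsilon>] by blast
  obtain c' where c': "c' dvd 1" "\<And>\<Phi>. \<Phi> \<in> SX \<Longrightarrow> pfourier v l \<epsilon> (pfourier v l (- \<epsilon>) \<Phi>) = (\<lambda>x. c' * \<Phi> x)"
    using pfourier_inversion[OF \<epsilon>'] by auto
  obtain d where d: "1 = c * d" using c(1) by (auto simp: dvd_def)
  obtain d' where d': "1 = c' * d'" using c'(1) by (auto simp: dvd_def)
  let ?s = "pfourier v l \<epsilon>" and ?s' = "\<lambda>\<Phi> x. d * pfourier v l (- \<epsilon>) \<Phi> x"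
  note lin = lin_op_pfourier[OF \<epsilon>] and lin' = lin_op_pfourier[OF \<epsilon>']
  have lin_s': "lin_op ?s'"
    using lin' unfolding lin_op_def by (simp add: schwartz_mult algebra_simps)
  have left: "?s' (?s \<Phi>) = \<Phi>" if "\<Phi> \<in> SX" for \<Phi>
    using c(2)[OF that] d by (simp add: mult_ac flip: mult.assoc)
  have right: "?s (?s' \<Phi>) = \<Phi>" if \<Phi>: "\<Phi> \<in> SX" for \<Phi>
  proof -
    \<comment> \<open>A preimage of \<open>\<Phi>\<close> under \<open>?s\<close>, built from the
      inversion in the other order. The left inverse sends \<open>\<Phi>\<close> to this preimage,
      so the scalars c and c' never have to be compared.\<close>
    let ?\<Psi> = "\<lambda>x. d' * pfourier v l (- \<epsilon>) \<Phi> x"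
    have \<Psi>: "?\<Psi> \<in> SX" by (rule schwartz_mult[OF lin_opD(1)[OF lin' \<Phi>]])
    have "?s ?\<Psi> = (\<lambda>x. d' * (c' * \<Phi> x))"
      using lin_opD(3)[OF lin lin_opD(1)[OF lin' \<Phi>]] c'(2)[OF \<Phi>] by simp
    also have "\<dots> = \<Phi>" using d' by (simp add: mult_ac flip: mult.assoc)
    finally show ?thesis using left[OF \<Psi>] by simp
  qed
  show ?thesis
    unfolding implemented_def using lin lin_s' left right pfourier_weyl[OF \<epsilon>] by blast
qed

end

end

section \<open>Generation of the symplectic group by transvections\<close>

context weil_data
begin

definition omega :: "'x \<times> ('x \<Rightarrow> 'f) \<Rightarrow> 'x \<times> ('x \<Rightarrow> 'f) \<Rightarrow> 'f" where
  "omega w1 w2 = form_B w1 w2 - form_B w2 w1"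

definition transvection :: "'x \<times> ('x \<Rightarrow> 'f) \<Rightarrow> 'f \<Rightarrow> 'x \<times> ('x \<Rightarrow> 'f) \<Rightarrow> 'x \<times> ('x \<Rightarrow> 'f)" where
  "transvection d k w = W_add w (W_scale smul (k * omega w d) d)"

text \<open>Bijectivity and extensionality are left to the carrier of \<open>Sp\<close>, so that
  transvections, rotations and their composites qualify as plain functions.\<close>

definition symplectic :: "('x \<times> ('x \<Rightarrow> 'f) \<Rightarrow> 'x \<times> ('x \<Rightarrow> 'f)) \<Rightarrow> bool" where
  "symplectic \<sigma> \<longleftrightarrow> (\<forall>w\<in>W smul. \<sigma> w \<in> W smul) \<and>
     (\<forall>w1\<in>W smul. \<forall>w2\<in>W smul. \<sigma> (W_add w1 w2) = W_add (\<sigma> w1) (\<sigma> w2)) \<and>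
     (\<forall>c. \<forall>w\<in>W smul. \<sigma> (W_scale smul c w) = W_scale smul c (\<sigma> w)) \<and>
     (\<forall>w1\<in>W smul. \<forall>w2\<in>W smul. omega (\<sigma> w1) (\<sigma> w2) = omega w1 w2)"

lemma symplecticD:
  assumes "symplectic \<sigma>" "w1 \<in> W smul"
  shows "\<sigma> w1 \<in> W smul" "w2 \<in> W smul \<Longrightarrow> \<sigma> (W_add w1 w2) = W_add (\<sigma> w1) (\<sigma> w2)"
    "\<sigma> (W_scale smul c w1) = W_scale smul c (\<sigma> w1)" "w2 \<in> W smul \<Longrightarrow> omega (\<sigma> w1) (\<sigma> w2) = omega w1 w2"
  using assms unfolding symplectic_def by blast+

lemma symplectic_comp: "symplectic \<sigma> \<Longrightarrow> symplectic \<tau> \<Longrightarrow> symplectic (\<lambda>w. \<sigma> (\<tau> w))"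
  unfolding symplectic_def by simp

lemma W_iff: "w \<in> W smul \<longleftrightarrow> snd w \<in> dual smul"
  by (cases w) (simp add: W_def)

lemma W_add_closed: "w1 \<in> W smul \<Longrightarrow> w2 \<in> W smul \<Longrightarrow> W_add w1 w2 \<in> W smul"
  by (simp add: W_iff W_add_def dual_iff algebra_simps)

lemma W_scale_closed: "w \<in> W smul \<Longrightarrow> W_scale smul c w \<in> W smul"
  by (simp add: W_iff W_scale_def dual_iff algebra_simps)

lemma omega_add_left: "w3 \<in> W smul \<Longrightarrow> omega (W_add w1 w2) w3 = omega w1 w3 + omega w2 w3"
  by (simp add: W_iff omega_def form_B_def W_add_def dualD)

lemma omega_scale_left: "w2 \<in> W smul \<Longrightarrow> omega (W_scale smul c w1) w2 = c * omega w1 w2"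
  by (simp add: W_iff omega_def form_B_def W_scale_def dualD right_diff_distrib)

lemma omega_skew: "omega w2 w1 = - omega w1 w2"
  by (simp add: omega_def)

lemma omega_add_right: "w3 \<in> W smul \<Longrightarrow> omega w3 (W_add w1 w2) = omega w3 w1 + omega w3 w2"
  by (simp add: W_iff omega_def form_B_def W_add_def dualD)

lemma omega_scale_right: "w2 \<in> W smul \<Longrightarrow> omega w2 (W_scale smul c w1) = c * omega w2 w1"
  by (simp add: W_iff omega_def form_B_def W_scale_def dualD right_diff_distrib)

lemma omega_self: "omega w w = 0"
  by (simp add: omega_def)

lemmas omega_simps = omega_add_left omega_scale_left omega_add_right omega_scale_right omega_self

lemma transvection_closed: "d \<in> W smul \<Longrightarrow> w \<in> W smul \<Longrightarrow> transvection d k w \<in> W smul"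
  by (simp add: transvection_def W_add_closed W_scale_closed)

lemma symplectic_transvection:
  assumes d: "d \<in> W smul" shows "symplectic (transvection d k)"
  unfolding symplectic_def
proof (intro conjI ballI allI)
  show "transvection d k w \<in> W smul" if "w \<in> W smul" for w using transvection_closed[OF d that] .
  show "transvection d k (W_add w1 w2) = W_add (transvection d k w1) (transvection d k w2)"
    if "w1 \<in> W smul" "w2 \<in> W smul" for w1 w2
    unfolding transvection_def omega_add_left[OF d]
    by (simp add: W_add_def W_scale_def algebra_simps scale_left_distrib)
  show "transvection d k (W_scale smul c w) = W_scale smul c (transvection d k w)"
    if "w \<in> W smul" for c w
    unfolding transvection_def omega_scale_left[OF d]
    by (simp add: W_add_def W_scale_def algebra_simps scale_right_distrib)
  show "omega (transvection d k w1) (transvection d k w2) = omega w1 w2"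
    if w: "w1 \<in> W smul" "w2 \<in> W smul" for w1 w2
    using w d W_scale_closed[OF d] W_add_closed[OF w(1) W_scale_closed[OF d]] omega_skew[of w2 d]
    by (simp add: transvection_def omega_simps algebra_simps)
qed

lemma symplectic_rotation:
  assumes l: "l \<in> dual smul" "l v = 1" and \<epsilon>: "\<epsilon> * \<epsilon> = 1"
  shows "symplectic (rotation v l \<epsilon>)"
  unfolding symplectic_def
proof (intro conjI ballI allI)
  show "rotation v l \<epsilon> w \<in> W smul" if "w \<in> W smul" for w using rotation_W[OF l that] .
  have \<epsilon>2: "\<epsilon> * (\<epsilon> * c) = c" for c using \<epsilon> by (simp flip: mult.assoc)
  show "rotation v l \<epsilon> (W_add w1 w2) = W_add (rotation v l \<epsilon> w1) (rotation v l \<epsilon> w2)"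
    if "w1 \<in> W smul" "w2 \<in> W smul" for w1 w2
    by (simp add: rotation_def W_add_def dualD[OF l(1)] algebra_simps scale_left_distrib)
  show "rotation v l \<epsilon> (W_scale smul c w) = W_scale smul c (rotation v l \<epsilon> w)"
    if "w \<in> W smul" for c w
    by (simp add: rotation_def W_scale_def dualD[OF l(1)] algebra_simps scale_right_distrib scale_right_diff_distrib)
  show "omega (rotation v l \<epsilon> w1) (rotation v l \<epsilon> w2) = omega w1 w2"
    if w: "w1 \<in> W smul" "w2 \<in> W smul" for w1 w2
    using w unfolding W_iff
    by (simp add: rotation_def omega_def form_B_def dualD[OF l(1)] dualD[of "snd w1"] dualD[of "snd w2"] l(2)
      algebra_simps \<epsilon>2)
qed

section \<open>Implementable maps and transvections\<close>

lemma implementedE: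
  assumes "implemented \<sigma>"
  obtains s s' where "lin_op s" "lin_op s'" "\<forall>\<Phi>\<in>SX. s' (s \<Phi>) = \<Phi>" "\<forall>\<Phi>\<in>SX. s (s' \<Phi>) = \<Phi>"
    "\<forall>w\<in>W smul. \<forall>\<Phi>\<in>SX. s (weyl w \<Phi>) = weyl (\<sigma> w) (s \<Phi>)"
  using assms unfolding implemented_def by auto

lemma implementedI:
  assumes "lin_op s" "lin_op s'" "\<And>\<Phi>. \<Phi> \<in> SX \<Longrightarrow> s' (s \<Phi>) = \<Phi>" "\<And>\<Phi>. \<Phi> \<in> SX \<Longrightarrow> s (s' \<Phi>) = \<Phi>"
    "\<And>w \<Phi>. w \<in> W smul \<Longrightarrow> \<Phi> \<in> SX \<Longrightarrow> s (weyl w \<Phi>) = weyl (\<sigma> w) (s \<Phi>)"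
  shows "implemented \<sigma>"
  unfolding implemented_def using assms by (intro exI[of _ s] exI[of _ s']) simp

lemma implemented_comp:
  assumes "implemented \<sigma>" "implemented \<tau>" "\<And>w. w \<in> W smul \<Longrightarrow> \<tau> w \<in> W smul"
  shows "implemented (\<lambda>w. \<sigma> (\<tau> w))"
proof -
  obtain s s' where s: "lin_op s" "lin_op s'" "\<forall>\<Phi>\<in>SX. s' (s \<Phi>) = \<Phi>" "\<forall>\<Phi>\<in>SX. s (s' \<Phi>) = \<Phi>"
    "\<forall>w\<in>W smul. \<forall>\<Phi>\<in>SX. s (weyl w \<Phi>) = weyl (\<sigma> w) (s \<Phi>)" by (rule implementedE[OF assms(1)])
  obtain t t' where t: "lin_op t" "lin_op t'" "\<forall>\<Phi>\<in>SX. t' (t \<Phi>) = \<Phi>" "\<forall>\<Phi>\<in>SX. t (t' \<Phi>) = \<Phi>"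
    "\<forall>w\<in>W smul. \<forall>\<Phi>\<in>SX. t (weyl w \<Phi>) = weyl (\<tau> w) (t \<Phi>)" by (rule implementedE[OF assms(2)])
  show ?thesis
    by (rule implementedI[of "\<lambda>\<Phi>. s (t \<Phi>)" "\<lambda>\<Phi>. t' (s' \<Phi>)"])
      (use s t assms(3) lin_opD(1)[OF s(2)] lin_opD(1)[OF t(1)] lin_op_comp in simp_all)
qed

lemma implemented_inverse:
  assumes "implemented \<tau>" "\<And>w. w \<in> W smul \<Longrightarrow> \<sigma> w \<in> W smul" "\<And>w. w \<in> W smul \<Longrightarrow> \<tau> (\<sigma> w) = w"
  shows "implemented \<sigma>"
proof -
  obtain t t' where t: "lin_op t" "lin_op t'" "\<forall>\<Phi>\<in>SX. t' (t \<Phi>) = \<Phi>" "\<forall>\<Phi>\<in>SX. t (t' \<Phi>) = \<Phi>"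
    "\<forall>w\<in>W smul. \<forall>\<Phi>\<in>SX. t (weyl w \<Phi>) = weyl (\<tau> w) (t \<Phi>)" by (rule implementedE[OF assms(1)])
  show ?thesis
  proof (rule implementedI[OF t(2,1)])
    fix w and \<Phi> :: "'x \<Rightarrow> 'r" assume w: "w \<in> W smul" and \<Phi>: "\<Phi> \<in> SX"
    have t'\<Phi>: "t' \<Phi> \<in> SX" by (rule lin_opD(1)[OF t(2) \<Phi>])
    have "weyl w \<Phi> = t (weyl (\<sigma> w) (t' \<Phi>))"
      using t(4,5) assms(2,3)[OF w] \<Phi> t'\<Phi> by simp
    then show "t' (weyl w \<Phi>) = weyl (\<sigma> w) (t' \<Phi>)"
      using t(3) weyl_schwartz[OF assms(2)[OF w] t'\<Phi>] by simp
  qed (use t in simp_all)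
qed

text \<open>Rests on g T = T' g, where T and T' are the transvections along d and g d. Only the
  operators are conjugated, so no inverse of g appears.\<close>

lemma implemented_conjugate:
  assumes g: "symplectic g" "implemented g" and d: "d \<in> W smul" and "implemented (transvection (g d) k)"
  shows "implemented (transvection d k)"
proof -
  obtain s s' where s: "lin_op s" "lin_op s'" "\<forall>\<Phi>\<in>SX. s' (s \<Phi>) = \<Phi>" "\<forall>\<Phi>\<in>SX. s (s' \<Phi>) = \<Phi>"
    "\<forall>w\<in>W smul. \<forall>\<Phi>\<in>SX. s (weyl w \<Phi>) = weyl (g w) (s \<Phi>)" by (rule implementedE[OF g(2)])
  obtain t t' where t: "lin_op t" "lin_op t'" "\<forall>\<Phi>\<in>SX. t' (t \<Phi>) = \<Phi>" "\<forall>\<Phi>\<in>SX. t (t' \<Phi>) = \<Phi>"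
    "\<forall>w\<in>W smul. \<forall>\<Phi>\<in>SX. t (weyl w \<Phi>) = weyl (transvection (g d) k w) (t \<Phi>)" by (rule implementedE[OF assms(4)])
  note clos = lin_opD(1)[OF s(1)] lin_opD(1)[OF s(2)] lin_opD(1)[OF t(1)] lin_opD(1)[OF t(2)]
  show ?thesis
  proof (rule implementedI[of "\<lambda>\<Phi>. s' (t (s \<Phi>))" "\<lambda>\<Phi>. s' (t' (s \<Phi>))"])
    show "lin_op (\<lambda>\<Phi>. s' (t (s \<Phi>)))" "lin_op (\<lambda>\<Phi>. s' (t' (s \<Phi>)))"
      by (rule lin_op_comp[OF s(2) lin_op_comp[OF t(1) s(1)]], rule lin_op_comp[OF s(2) lin_op_comp[OF t(2) s(1)]])
    fix \<Phi> :: "'x \<Rightarrow> 'r" assume \<Phi>: "\<Phi> \<in> SX"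
    show "s' (t' (s (s' (t (s \<Phi>))))) = \<Phi>" "s' (t (s (s' (t' (s \<Phi>))))) = \<Phi>"
      using s(3,4) t(3,4) clos \<Phi> by simp_all
    fix w assume w: "w \<in> W smul"
    let ?w' = "transvection d k w"
    have gw': "transvection (g d) k (g w) = g ?w'"
      using symplecticD[OF g(1) w] symplecticD[OF g(1) d] symplecticD(4)[OF g(1) w d] W_scale_closed[OF d]
      by (simp add: transvection_def)
    have "t (s (weyl w \<Phi>)) = weyl (g ?w') (s (s' (t (s \<Phi>))))"
      using s(4,5) t(5) clos \<Phi> w gw' symplecticD(1)[OF g(1) w] by simp
    also have "\<dots> = s (weyl ?w' (s' (t (s \<Phi>))))"
      using s(5) clos \<Phi> transvection_closed[OF d w] by simp
    finally show "s' (t (s (weyl w \<Phi>))) = weyl ?w' (s' (t (s \<Phi>)))"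
      using s(3) clos \<Phi> weyl_schwartz[OF transvection_closed[OF d w]] by simp
  qed
qed

text \<open>The term \<open>m 0\<close> vanishes for linear m; it is present because the equation is
  one of functions on all pairs.\<close>

lemma transvection_dual:
  "transvection (0, e) k = (\<lambda>(u, m). (u, \<lambda>x. m x + k * (e u - m 0) * e x))"
  by (auto simp: transvection_def omega_def form_B_def W_add_def W_scale_def fun_eq_iff)

lemma implemented_transvection_dual:
  assumes e: "e \<in> dual smul" shows "implemented (transvection (0, e) k)"
proof -
  obtain s s' where s: "lin_op s" "lin_op s'" "\<forall>\<Phi>\<in>SX. s' (s \<Phi>) = \<Phi>" "\<forall>\<Phi>\<in>SX. s (s' \<Phi>) = \<Phi>"
    "\<forall>w\<in>W smul. \<forall>\<Phi>\<in>SX. s (weyl w \<Phi>) = weyl ((\<lambda>(u, m). (u, \<lambda>x. m x + k * e u * e x)) w) (s \<Phi>)"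
    by (rule implementedE[OF implemented_shear[OF e]])
  have "transvection (0, e) k w = (\<lambda>(u, m). (u, \<lambda>x. m x + k * e u * e x)) w" if "w \<in> W smul" for w
    using that by (cases w) (simp add: transvection_dual W_iff dualD)
  then show ?thesis by (intro implementedI[OF s(1,2)]) (use s in simp_all)
qed

text \<open>Implementable symplectic maps move d = (v, m) to a dual vector: if v is not 0, a shear
  removes m provided m(v) is not 0, and a rotation takes (v, 0) to (0, -l). A preliminary shear by l
  handles m(v) = 0.\<close>

lemma implemented_transvection:
  assumes d: "d \<in> W smul" shows "implemented (transvection d k)"
proof -
  obtain v m where vm: "d = (v, m)" and m: "m \<in> dual smul" using d by (cases d) (simp add: W_iff)
  show ?thesis
  proof (cases "v = 0")
    case True
    then show ?thesis using implemented_transvection_dual[OF m] vm by simp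
  next
    case False
    obtain l where l: "l \<in> dual smul" "l v = 1" using ex_dual_eq_1[OF False] by blast
    have zero: "(\<lambda>x. 0) \<in> dual smul" by (simp add: dual_iff)
    have shear: "symplectic (transvection (0, e) c)" "implemented (transvection (0, e) c)" if "e \<in> dual smul" for e c
      using symplectic_transvection implemented_transvection_dual that by (simp_all add: W_iff)
    have impl_v: "implemented (transvection (v, \<lambda>x. 0) k)"
    proof (rule implemented_conjugate[of "rotation v l 1"])
      have "rotation v l 1 (v, \<lambda>x. 0) = (0, \<lambda>x. - l x)" by (simp add: rotation_def l)
      moreover have "(\<lambda>x. - l x) \<in> dual smul" using l(1) by (simp add: dual_iff)
      ultimately show "implemented (transvection (rotation v l 1 (v, \<lambda>x. 0)) k)"
        by (simp add: implemented_transvection_dual)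
    qed (use symplectic_rotation[OF l] implemented_rotation[OF l] zero in \<open>simp_all add: W_iff\<close>)
    have impl_nz: "implemented (transvection (v, m) k)" if m: "m \<in> dual smul" and "m v \<noteq> 0" for m
    proof (rule implemented_conjugate[OF shear[OF m]])
      \<comment> \<open>The shear along (0, m) with parameter c sends m to (1 + c m(v)) m, which
        determines the constant.\<close>
      have "transvection (0, m) (- 1 / m v) (v, m) = (v, \<lambda>x. 0)"
        using that by (simp add: transvection_dual dualD)
      then show "implemented (transvection (transvection (0, m) (- 1 / m v) (v, m)) k)"
        using impl_v by simp
    qed (use m in \<open>simp add: W_iff\<close>)
    show ?thesis
    proof (cases "m v = 0")
      case False
      then show ?thesis using impl_nz[OF m] vm by simp
    next
      case True
      show ?thesis
        unfolding vm
      proof (rule implemented_conjugate[OF shear[OF l(1)]])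
        \<comment> \<open>Adding l makes the value at v equal to 1, which reduces to the case just
          treated.\<close>
        have "transvection (0, l) 1 (v, m) = (v, \<lambda>x. m x + l x)"
          using l by (simp add: transvection_dual dualD[OF m])
        moreover have "(\<lambda>x. m x + l x) \<in> dual smul"
          using m l(1) by (simp add: dual_iff algebra_simps)
        ultimately show "implemented (transvection (transvection (0, l) 1 (v, m)) k)"
          using impl_nz[of "\<lambda>x. m x + l x"] True l(2) by simp
      qed (use m in \<open>simp add: W_iff\<close>)
    qed
  qed
qed

section \<open>Reduction of a symplectic map to the identity\<close>

definition sp_impl :: "('x \<times> ('x \<Rightarrow> 'f) \<Rightarrow> 'x \<times> ('x \<Rightarrow> 'f)) \<Rightarrow> bool" where
  "sp_impl \<tau> \<longleftrightarrow> symplectic \<tau> \<and> implemented \<tau>"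

lemma sp_impl_comp: "sp_impl \<sigma> \<Longrightarrow> sp_impl \<tau> \<Longrightarrow> sp_impl (\<lambda>w. \<sigma> (\<tau> w))"
  unfolding sp_impl_def by (simp add: symplectic_comp implemented_comp symplecticD(1))

text \<open>Take the transvection along v - u with k = 1 / omega u v: since omega u (v - u) = omega
  u v, it adds exactly v - u to u, and it fixes whatever is orthogonal to v - u.\<close>

lemma transvection_move:
  assumes u: "u \<in> W smul" and v: "v \<in> W smul" and uv: "omega u v \<noteq> 0"
  shows "\<exists>\<tau>. sp_impl \<tau> \<and> \<tau> u = v \<and> (\<forall>x\<in>W smul. omega x u = omega x v \<longrightarrow> \<tau> x = x)"
proof -
  define d where "d = W_add v (W_scale smul (- 1) u)"
  have d: "d \<in> W smul" unfolding d_def by (intro W_add_closed W_scale_closed u v)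
  have od: "omega x d = omega x v - omega x u" if "x \<in> W smul" for x
    by (simp add: d_def omega_add_right[OF that] omega_scale_right[OF that])
  have "transvection d (1 / omega u v) u = W_add u (W_scale smul 1 d)"
    using uv by (simp add: transvection_def od[OF u] omega_self)
  also have "\<dots> = v" by (simp add: d_def W_add_def W_scale_def)
  finally have "transvection d (1 / omega u v) u = v" .
  moreover have "transvection d (1 / omega u v) x = x" if "x \<in> W smul" "omega x u = omega x v" for x
    using that by (simp add: transvection_def od W_add_def W_scale_def)
  ultimately show ?thesis
    using symplectic_transvection[OF d] implemented_transvection[OF d] unfolding sp_impl_def by blast
qed

text \<open>A detour through z covers the case where u and v are orthogonal. The last clause lists
  vectors that survive both steps.\<close>

lemma transvection_move2:
  assumes u: "u \<in> W smul" and z: "z \<in> W smul" and v: "v \<in> W smul" and "omega u z \<noteq> 0" "omega z v \<noteq> 0"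
  shows "\<exists>\<tau>. sp_impl \<tau> \<and> \<tau> u = v \<and>
    (\<forall>x\<in>W smul. omega x u = omega x v \<and> omega x z = omega x v \<longrightarrow> \<tau> x = x)"
proof -
  obtain \<tau>1 where 1: "sp_impl \<tau>1" "\<tau>1 u = z" "\<forall>x\<in>W smul. omega x u = omega x z \<longrightarrow> \<tau>1 x = x"
    using transvection_move[OF u z assms(4)] by blast
  obtain \<tau>2 where 2: "sp_impl \<tau>2" "\<tau>2 z = v" "\<forall>x\<in>W smul. omega x z = omega x v \<longrightarrow> \<tau>2 x = x"
    using transvection_move[OF z v assms(5)] by blast
  show ?thesis
    using sp_impl_comp[OF 2(1) 1(1)] 1 2 by (intro exI[of _ "\<lambda>w. \<tau>2 (\<tau>1 w)"]) simp
qed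

abbreviation basis_e :: "'x \<Rightarrow> 'x \<times> ('x \<Rightarrow> 'f)" where "basis_e b \<equiv> (b, \<lambda>x. 0)"
abbreviation basis_f :: "'x \<Rightarrow> 'x \<times> ('x \<Rightarrow> 'f)" where "basis_f b \<equiv> (0, \<lambda>x. coord x b)"

lemma basis_W: "basis_e b \<in> W smul" "basis_f b \<in> W smul"
  by (simp_all add: W_iff dual_coord) (simp add: dual_iff)

lemma omega_basis:
  assumes "b \<in> B" "c \<in> B"
  shows "omega (basis_e b) (basis_e c) = 0" "omega (basis_f b) (basis_f c) = 0"
    "omega (basis_e b) (basis_f c) = of_bool (b = c)" "omega (basis_f b) (basis_e c) = - of_bool (b = c)"
  using assms by (auto simp: omega_def form_B_def coord_zero coord_basis)

text \<open>One hyperbolic pair is restored at a time, each of its vectors by at most two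
  transvections. The difficulty is to leave the pairs of S in place: they are fixed because they
  pair equally with the start, the detour and the target of each move.\<close>

lemma symplectic_reduce:
  assumes \<sigma>: "symplectic \<sigma>" and "finite S" "S \<subseteq> B"
  shows "\<exists>\<tau>. sp_impl \<tau> \<and> (\<forall>b\<in>S. \<tau> (\<sigma> (basis_e b)) = basis_e b \<and> \<tau> (\<sigma> (basis_f b)) = basis_f b)"
  using assms(2,3)
proof (induction S rule: finite_induct)
  case empty
  \<comment> \<open>For empty S any implementable symplectic map will do; this one is
    trivial.\<close>
  have "sp_impl (transvection (basis_e 0) 0)"
    using symplectic_transvection implemented_transvection basis_W by (simp add: sp_impl_def)
  then show ?case by blast
next
  case (insert b S)
  then have b: "b \<in> B" and S: "S \<subseteq> B" by auto
  obtain \<tau>0 where \<tau>0: "sp_impl \<tau>0" "\<forall>b\<in>S. \<tau>0 (\<sigma> (basis_e b)) = basis_e b \<and> \<tau>0 (\<sigma> (basis_f b)) = basis_f b"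
    using insert by blast
  let ?e = "basis_e b" and ?f = "basis_f b"
  let ?E = "basis_e ` S \<union> basis_f ` S"
  note eW = basis_W(1)[of b] and fW = basis_W(2)[of b]
  have EW: "x \<in> W smul" if "x \<in> ?E" for x using that basis_W by blast
  have E0: "omega x ?e = 0" "omega x ?f = 0" if "x \<in> ?E" for x
  proof -
    have "c \<in> B \<and> c \<noteq> b" if "c \<in> S" for c using that S insert.hyps by auto
    with \<open>x \<in> ?E\<close> show "omega x ?e = 0" "omega x ?f = 0" by (auto simp: omega_basis b)
  qed
  have ef: "omega ?e ?f = 1" "omega ?f ?e = - 1" using omega_basis[OF b b] by simp_all
  have fixed: "omega x (\<rho> y) = omega x y" if "symplectic \<rho>" "\<rho> x = x" "x \<in> W smul" "y \<in> W smul" for \<rho> x y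
    using symplecticD(4)[OF that(1,3,4)] that(2) by simp
  define \<sigma>1 where "\<sigma>1 w = \<tau>0 (\<sigma> w)" for w
  have \<sigma>1: "symplectic \<sigma>1"
    unfolding \<sigma>1_def[abs_def] using symplectic_comp \<sigma> \<tau>0(1) by (simp add: sp_impl_def)
  have fix1: "\<sigma>1 x = x" if "x \<in> ?E" for x using that \<tau>0(2) by (auto simp: \<sigma>1_def)
  note u = symplecticD(1)[OF \<sigma>1 eW] and y = symplecticD(1)[OF \<sigma>1 fW]
  have uy: "omega (\<sigma>1 ?e) (\<sigma>1 ?f) = 1" using symplecticD(4)[OF \<sigma>1 eW fW] ef by simp
  have E1: "omega x (\<sigma>1 ?e) = 0" "omega x (\<sigma>1 ?f) = 0" if "x \<in> ?E" for x
    using fixed[OF \<sigma>1 fix1[OF that] EW[OF that]] E0[OF that] eW fW by simp_all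
  \<comment> \<open>The detour must be orthogonal to the earlier pairs and to neither endpoint. Both
    f and its image are orthogonal to the earlier pairs; if each fails at one endpoint, their sum
    succeeds at both.\<close>
  have "\<exists>z\<in>W smul. omega (\<sigma>1 ?e) z \<noteq> 0 \<and> omega z ?e \<noteq> 0 \<and> (\<forall>x\<in>?E. omega x z = 0)"
  proof (cases "omega (\<sigma>1 ?e) ?f = 0")
    case False
    then show ?thesis using fW ef E0 by (intro bexI[of _ ?f]) simp_all
  next
    case f0: True
    show ?thesis
    proof (cases "omega (\<sigma>1 ?f) ?e = 0")
      case False
      then show ?thesis using y uy E1 by (intro bexI[of _ "\<sigma>1 ?f"]) simp_all
    next
      case True
      then show ?thesis
        using f0 u y eW fW uy ef E0 E1 EW
        by (intro bexI[of _ "W_add ?f (\<sigma>1 ?f)"])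
          (simp_all add: omega_add_left omega_add_right W_add_closed)
    qed
  qed
  then obtain z where z: "z \<in> W smul" "omega (\<sigma>1 ?e) z \<noteq> 0" "omega z ?e \<noteq> 0" "\<forall>x\<in>?E. omega x z = 0" by blast
  obtain \<tau>1 where \<tau>1: "sp_impl \<tau>1" "\<tau>1 (\<sigma>1 ?e) = ?e"
    "\<forall>x\<in>W smul. omega x (\<sigma>1 ?e) = omega x ?e \<and> omega x z = omega x ?e \<longrightarrow> \<tau>1 x = x"
    using transvection_move2[OF u z(1) eW z(2,3)] by blast
  define \<sigma>2 where "\<sigma>2 w = \<tau>1 (\<sigma>1 w)" for w
  have \<sigma>2: "symplectic \<sigma>2"
    unfolding \<sigma>2_def[abs_def] using symplectic_comp \<sigma>1 \<tau>1(1) by (simp add: sp_impl_def)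
  have fix2: "\<sigma>2 x = x" if "x \<in> insert ?e ?E" for x
  proof (cases "x = ?e")
    case True
    then show ?thesis using \<tau>1(2) by (simp add: \<sigma>2_def)
  next
    case False
    then have x: "x \<in> ?E" using that by simp
    then show ?thesis using \<tau>1(3) EW[OF x] E0[OF x] E1[OF x] z(4) fix1[OF x] by (simp add: \<sigma>2_def)
  qed
  have E2W: "x \<in> W smul" if "x \<in> insert ?e ?E" for x using that EW eW by auto
  note v = symplecticD(1)[OF \<sigma>2 fW]
  have E2: "omega x (\<sigma>2 ?f) = omega x ?f" if "x \<in> insert ?e ?E" for x
    using fixed[OF \<sigma>2 fix2[OF that] E2W[OF that] fW] .
  have "\<exists>\<tau>. sp_impl \<tau> \<and> \<tau> (\<sigma>2 ?f) = ?f \<and> (\<forall>x\<in>insert ?e ?E. \<tau> x = x)"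
  proof (cases "omega (\<sigma>2 ?f) ?f = 0")
    case False
    then obtain \<tau> where "sp_impl \<tau>" "\<tau> (\<sigma>2 ?f) = ?f" "\<forall>x\<in>W smul. omega x (\<sigma>2 ?f) = omega x ?f \<longrightarrow> \<tau> x = x"
      using transvection_move[OF v fW] by blast
    then show ?thesis using E2 E2W by (intro exI[of _ \<tau>]) simp
  next
    case True
    \<comment> \<open>Now e must stay fixed as well. Adding e to f does not change the pairing with
      e or with the earlier pairs, and it makes the pairing with the image of f equal to -1.\<close>
    let ?z = "W_add ?e ?f"
    have zW: "?z \<in> W smul" by (rule W_add_closed[OF eW fW])
    have "omega (\<sigma>2 ?f) ?e = - 1" using E2[of ?e] ef omega_skew[of "\<sigma>2 ?f" ?e] by simp
    then have "omega (\<sigma>2 ?f) ?z \<noteq> 0" using True by (simp add: omega_add_right[OF v])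
    moreover have "omega ?z ?f \<noteq> 0" using ef by (simp add: omega_add_left[OF fW] omega_self)
    ultimately obtain \<tau> where \<tau>: "sp_impl \<tau>" "\<tau> (\<sigma>2 ?f) = ?f"
      "\<forall>x\<in>W smul. omega x (\<sigma>2 ?f) = omega x ?f \<and> omega x ?z = omega x ?f \<longrightarrow> \<tau> x = x"
      using transvection_move2[OF v zW fW] by blast
    have "omega x ?z = omega x ?f" if x: "x \<in> insert ?e ?E" for x
      using x E0 by (auto simp: omega_add_right[OF E2W[OF x]] omega_self)
    then show ?thesis using \<tau> E2 E2W by (intro exI[of _ \<tau>]) simp
  qed
  then obtain \<tau>2 where \<tau>2: "sp_impl \<tau>2" "\<tau>2 (\<sigma>2 ?f) = ?f" "\<forall>x\<in>insert ?e ?E. \<tau>2 x = x" by blast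
  have "sp_impl (\<lambda>w. \<tau>2 (\<tau>1 (\<tau>0 w)))"
    using sp_impl_comp[OF \<tau>2(1) sp_impl_comp[OF \<tau>1(1) \<tau>0(1)]] .
  moreover have "\<tau>2 (\<tau>1 (\<tau>0 (\<sigma> x))) = \<tau>2 (\<sigma>2 x)" for x by (simp add: \<sigma>2_def \<sigma>1_def)
  moreover have "\<tau>2 (\<sigma>2 x) = x" if x: "x \<in> insert ?e ?E" for x
    using fix2[OF x] bspec[OF \<tau>2(3) x] by (simp only:)
  ultimately show ?case using \<tau>2(2) by (intro exI[of _ "\<lambda>w. \<tau>2 (\<tau>1 (\<tau>0 w))"]) simp
qed

text \<open>The coordinates of w are its pairings with the fixed vectors, and these pairings are
  preserved; no expansion of w in the basis is involved.\<close>

lemma symplectic_fixing_basis: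
  assumes \<rho>: "symplectic \<rho>" and fix_e: "\<And>b. b \<in> B \<Longrightarrow> \<rho> (basis_e b) = basis_e b"
    and fix_f: "\<And>b. b \<in> B \<Longrightarrow> \<rho> (basis_f b) = basis_f b" and w: "w \<in> W smul"
  shows "\<rho> w = w"
proof -
  obtain u m where um: "w = (u, m)" by (cases w)
  obtain u' m' where um': "\<rho> (u, m) = (u', m')" by (cases "\<rho> (u, m)")
  have m: "m \<in> dual smul" and m': "m' \<in> dual smul"
    using w symplecticD(1)[OF \<rho> w] unfolding um um' W_iff by simp_all
  have "coord u' b = coord u b" if "b \<in> B" for b
    using symplecticD(4)[OF \<rho> w basis_W(2)[of b]] fix_f[OF that]
    by (simp add: um um' omega_def form_B_def dualD[OF m] dualD[OF m'])
  then have "u' - u = 0" by (intro eq_0_if_coord) (simp add: coord_diff)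
  moreover have "m' b = m b" if "b \<in> B" for b
    using symplecticD(4)[OF \<rho> w basis_W(1)[of b]] fix_e[OF that]
    by (simp add: um um' omega_def form_B_def)
  then have "(\<Sum>b\<in>B. coord x b * m' b) = (\<Sum>b\<in>B. coord x b * m b)" for x by simp
  then have "m' x = m x" for x
    by (rule trans[OF dual_sum[OF m'] trans[OF _ dual_sum[OF m, symmetric]]])
  then have "m' = m" by (rule ext)
  ultimately show ?thesis by (simp add: um um')
qed

text \<open>The reduction yields an implementable \<open>\<tau>\<close> with \<open>\<tau>\<close>
  \<circ> \<open>\<sigma>\<close> the identity on W, so the inverse of an operator for
  \<open>\<tau>\<close> implements \<open>\<sigma>\<close>.\<close>

theorem symplectic_implemented:
  assumes \<sigma>: "symplectic \<sigma>" shows "implemented \<sigma>"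
proof -
  obtain \<tau> where \<tau>: "sp_impl \<tau>" "\<forall>b\<in>B. \<tau> (\<sigma> (basis_e b)) = basis_e b \<and> \<tau> (\<sigma> (basis_f b)) = basis_f b"
    using symplectic_reduce[OF \<sigma> finite_Basis order_refl] by blast
  have "symplectic (\<lambda>w. \<tau> (\<sigma> w))" using \<tau>(1) \<sigma> symplectic_comp by (simp add: sp_impl_def)
  from symplectic_fixing_basis[OF this] have "\<tau> (\<sigma> w) = w" if "w \<in> W smul" for w
    using \<tau>(2) that by simp
  then show ?thesis
    using implemented_inverse[of \<tau> \<sigma>] \<tau>(1) symplecticD(1)[OF \<sigma>] by (simp add: sp_impl_def)
qed

end

section \<open>The metaplectic group\<close>

lemma BijGroup_simps:
  "carrier (BijGroup S) = Bij S"
  "\<one>\<^bsub>BijGroup S\<^esub> = (\<lambda>x\<in>S. x)"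
  "f \<in> Bij S \<Longrightarrow> g \<in> Bij S \<Longrightarrow> f \<otimes>\<^bsub>BijGroup S\<^esub> g = compose S f g"
  by (simp_all add: BijGroup_def)

lemma Bij_apply: "f \<in> Bij S \<Longrightarrow> x \<in> S \<Longrightarrow> f x \<in> S"
  using Bij_imp_funcset by blast

lemma Bij_f_inv: "f \<in> Bij S \<Longrightarrow> x \<in> S \<Longrightarrow> f (inv_into S f x) = x"
  by (auto simp: Bij_def bij_betw_def f_inv_into_f)

lemma Bij_eqI: "f \<in> Bij S \<Longrightarrow> g \<in> Bij S \<Longrightarrow> (\<And>x. x \<in> S \<Longrightarrow> f x = g x) \<Longrightarrow> f = g"
  using Bij_imp_extensional extensionalityI by blast

lemma restrict_BijI:
  assumes "\<And>x. x \<in> S \<Longrightarrow> f x \<in> S \<and> g x \<in> S \<and> g (f x) = x \<and> f (g x) = x"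
  shows "restrict f S \<in> Bij S"
proof -
  have "bij_betw f S S" by (rule bij_betwI[of _ _ _ g]) (use assms in auto)
  then show ?thesis by (simp add: Bij_def bij_betw_restrict_eq)
qed

context weil_data
begin

section \<open>Automorphisms of the Schwartz space and the symplectic group as groups of
  bijections\<close>

abbreviation AutS :: "(('x \<Rightarrow> 'r) \<Rightarrow> 'x \<Rightarrow> 'r) monoid" where
  "AutS \<equiv> Aut_S absv smul"

lemma carrier_AutS: "carrier AutS = {s \<in> Bij SX. lin_op s}"
  unfolding Aut_S_def lin_op_def using Bij_apply[of _ SX] by auto

lemma AutS_eq: "AutS = BijGroup SX\<lparr>carrier := carrier AutS\<rparr>"
  by (simp add: Aut_S_def)

lemma subgroup_AutS: "subgroup (carrier AutS) (BijGroup SX)"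
proof (rule group.subgroupI[OF group_BijGroup])
  show "carrier AutS \<subseteq> carrier (BijGroup SX)" by (auto simp: carrier_AutS BijGroup_simps)
  have "(\<lambda>\<Phi>\<in>SX. \<Phi>) \<in> carrier AutS"
    by (simp add: carrier_AutS id_Bij lin_op_def schwartz_add schwartz_mult)
  then show "carrier AutS \<noteq> {}" by blast
next
  fix s assume "s \<in> carrier AutS"
  then have s: "s \<in> Bij SX" "lin_op s" by (simp_all add: carrier_AutS)
  have "inv_into SX s (\<lambda>x. \<Phi> x + \<Psi> x) = (\<lambda>x. inv_into SX s \<Phi> x + inv_into SX s \<Psi> x)"
    if "\<Phi> \<in> SX" "\<Psi> \<in> SX" for \<Phi> \<Psi>
    using that schwartz_add
    by (intro Bij_inv_into_lemma[of SX s "\<lambda>\<Phi> \<Psi> x. \<Phi> x + \<Psi> x", OF lin_opD(2)[OF s(2)] s(1)]) auto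
  moreover have "inv_into SX s (\<lambda>x. c * \<Phi> x) = (\<lambda>x. c * inv_into SX s \<Phi> x)" if "\<Phi> \<in> SX" for c \<Phi>
    using that schwartz_mult
    by (intro Bij_inv_into_lemma[of SX s "\<lambda>\<Phi> \<Psi> x. c * \<Phi> x", OF lin_opD(3)[OF s(2)] s(1)]) auto
  ultimately show "inv\<^bsub>BijGroup SX\<^esub> s \<in> carrier AutS"
    using restrict_inv_into_Bij[OF s(1)] Bij_inv_into_mem[OF s(1)]
    by (simp add: carrier_AutS inv_BijGroup[OF s(1)] lin_op_def schwartz_add schwartz_mult)
next
  fix s t assume "s \<in> carrier AutS" "t \<in> carrier AutS"
  then have st: "s \<in> Bij SX" "lin_op s" "t \<in> Bij SX" "lin_op t" by (simp_all add: carrier_AutS)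
  have "lin_op (compose SX s t)"
    using lin_op_comp[OF st(2,4)] unfolding lin_op_def by (simp add: compose_eq schwartz_add schwartz_mult)
  then show "s \<otimes>\<^bsub>BijGroup SX\<^esub> t \<in> carrier AutS"
    using st by (simp add: BijGroup_simps carrier_AutS compose_Bij)
qed

lemma group_AutS: "group AutS"
  using subgroup.subgroup_is_group[OF subgroup_AutS group_BijGroup] AutS_eq by simp

lemma AutS_D:
  assumes "s \<in> carrier AutS"
  shows "s \<in> Bij SX" "lin_op s" "\<Phi> \<in> SX \<Longrightarrow> s \<Phi> \<in> SX"
  using assms Bij_apply by (auto simp: carrier_AutS)

lemma AutS_mult:
  assumes "s \<in> carrier AutS" "t \<in> carrier AutS"
  shows "s \<otimes>\<^bsub>AutS\<^esub> t = compose SX s t"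
proof -
  have "s \<otimes>\<^bsub>AutS\<^esub> t = s \<otimes>\<^bsub>BijGroup SX\<^esub> t" by (simp add: Aut_S_def)
  then show ?thesis using AutS_D(1)[OF assms(1)] AutS_D(1)[OF assms(2)] by (simp add: BijGroup_simps)
qed

lemma AutS_inv:
  assumes "s \<in> carrier AutS"
  shows "inv\<^bsub>AutS\<^esub> s = restrict (inv_into SX s) SX"
proof -
  have "inv\<^bsub>AutS\<^esub> s = inv\<^bsub>BijGroup SX\<^esub> s"
    using group.m_inv_consistent[OF group_BijGroup subgroup_AutS assms] AutS_eq by simp
  then show ?thesis using inv_BijGroup[OF AutS_D(1)[OF assms]] by simp
qed

lemma AutS_eqI:
  "s \<in> carrier AutS \<Longrightarrow> t \<in> carrier AutS \<Longrightarrow> (\<And>\<Phi>. \<Phi> \<in> SX \<Longrightarrow> s \<Phi> = t \<Phi>) \<Longrightarrow> s = t"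
  using Bij_eqI AutS_D(1) by blast

lemma restrict_AutS:
  assumes "lin_op s" "lin_op s'" "\<And>\<Phi>. \<Phi> \<in> SX \<Longrightarrow> s' (s \<Phi>) = \<Phi>" "\<And>\<Phi>. \<Phi> \<in> SX \<Longrightarrow> s (s' \<Phi>) = \<Phi>"
  shows "restrict s SX \<in> carrier AutS"
proof -
  have "restrict s SX \<in> Bij SX"
    by (rule restrict_BijI[of _ _ s']) (use assms lin_opD(1) in blast)
  moreover have "lin_op (restrict s SX)"
    using assms(1) unfolding lin_op_def by (simp add: schwartz_add schwartz_mult)
  ultimately show ?thesis by (simp add: carrier_AutS)
qed

lemma carrier_Sp: "carrier (Sp smul) = {\<sigma> \<in> Bij (W smul). symplectic \<sigma>}"
  unfolding Sp_def symplectic_def omega_def using Bij_apply[of _ "W smul"] by auto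

lemma Sp_D:
  assumes "\<sigma> \<in> carrier (Sp smul)"
  shows "\<sigma> \<in> Bij (W smul)" "symplectic \<sigma>" "w \<in> W smul \<Longrightarrow> \<sigma> w \<in> W smul"
  using assms Bij_apply by (auto simp: carrier_Sp)

lemma Sp_eq: "Sp smul = BijGroup (W smul)\<lparr>carrier := carrier (Sp smul)\<rparr>"
  by (simp add: Sp_def)

lemma subgroup_Sp: "subgroup (carrier (Sp smul)) (BijGroup (W smul))"
proof (rule group.subgroupI[OF group_BijGroup])
  show "carrier (Sp smul) \<subseteq> carrier (BijGroup (W smul))" by (auto simp: carrier_Sp BijGroup_simps)
  have "(\<lambda>w\<in>W smul. w) \<in> carrier (Sp smul)"
    by (simp add: carrier_Sp id_Bij symplectic_def W_add_closed W_scale_closed)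
  then show "carrier (Sp smul) \<noteq> {}" by blast
next
  fix s assume "s \<in> carrier (Sp smul)"
  then have s: "s \<in> Bij (W smul)" "symplectic s" by (simp_all add: carrier_Sp)
  have "inv_into (W smul) s (W_add w1 w2) = W_add (inv_into (W smul) s w1) (inv_into (W smul) s w2)"
    if "w1 \<in> W smul" "w2 \<in> W smul" for w1 w2
    using that W_add_closed
    by (intro Bij_inv_into_lemma[of "W smul" s W_add, OF symplecticD(2)[OF s(2)] s(1)]) auto
  moreover have "inv_into (W smul) s (W_scale smul c w) = W_scale smul c (inv_into (W smul) s w)"
    if "w \<in> W smul" for c w
    using that W_scale_closed
    by (intro Bij_inv_into_lemma[of "W smul" s "\<lambda>w w'. W_scale smul c w", OF symplecticD(3)[OF s(2)] s(1)]) auto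
  moreover have "omega (inv_into (W smul) s w1) (inv_into (W smul) s w2) = omega w1 w2"
    if w: "w1 \<in> W smul" "w2 \<in> W smul" for w1 w2
    using symplecticD(4)[OF s(2) Bij_inv_into_mem[OF s(1) w(1)] Bij_inv_into_mem[OF s(1) w(2)]]
      Bij_f_inv[OF s(1)] w by simp
  ultimately show "inv\<^bsub>BijGroup (W smul)\<^esub> s \<in> carrier (Sp smul)"
    using restrict_inv_into_Bij[OF s(1)] Bij_inv_into_mem[OF s(1)]
    by (simp add: carrier_Sp inv_BijGroup[OF s(1)] symplectic_def W_add_closed W_scale_closed)
next
  fix s t assume "s \<in> carrier (Sp smul)" "t \<in> carrier (Sp smul)"
  then have st: "s \<in> Bij (W smul)" "symplectic s" "t \<in> Bij (W smul)" "symplectic t"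
    by (simp_all add: carrier_Sp)
  have "symplectic (compose (W smul) s t)"
    using symplectic_comp[OF st(2,4)] unfolding symplectic_def
    by (simp add: compose_eq W_add_closed W_scale_closed)
  then show "s \<otimes>\<^bsub>BijGroup (W smul)\<^esub> t \<in> carrier (Sp smul)"
    using st by (simp add: BijGroup_simps carrier_Sp compose_Bij)
qed

lemma group_Sp: "group (Sp smul)"
  using subgroup.subgroup_is_group[OF subgroup_Sp group_BijGroup] Sp_eq by simp

lemma Sp_mult:
  assumes "\<sigma> \<in> carrier (Sp smul)" "\<tau> \<in> carrier (Sp smul)"
  shows "\<sigma> \<otimes>\<^bsub>Sp smul\<^esub> \<tau> = compose (W smul) \<sigma> \<tau>"
proof -
  have "\<sigma> \<otimes>\<^bsub>Sp smul\<^esub> \<tau> = \<sigma> \<otimes>\<^bsub>BijGroup (W smul)\<^esub> \<tau>" by (simp add: Sp_def)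
  then show ?thesis using Sp_D(1)[OF assms(1)] Sp_D(1)[OF assms(2)] by (simp add: BijGroup_simps)
qed

lemma Sp_one: "\<one>\<^bsub>Sp smul\<^esub> = (\<lambda>w\<in>W smul. w)"
  by (simp add: Sp_def BijGroup_def)

lemma Sp_inv:
  assumes "\<sigma> \<in> carrier (Sp smul)"
  shows "inv\<^bsub>Sp smul\<^esub> \<sigma> = restrict (inv_into (W smul) \<sigma>) (W smul)"
proof -
  have "inv\<^bsub>Sp smul\<^esub> \<sigma> = inv\<^bsub>BijGroup (W smul)\<^esub> \<sigma>"
    using group.m_inv_consistent[OF group_BijGroup subgroup_Sp assms] Sp_eq by simp
  then show ?thesis using inv_BijGroup[OF Sp_D(1)[OF assms]] by simp
qed

section \<open>From the Heisenberg group to the intertwining relation\<close>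

abbreviation Heis :: "(('x \<times> ('x \<Rightarrow> 'f)) \<times> 'r) set" where
  "Heis \<equiv> carrier (A_grp smul chi)"

abbreviation U where "U \<equiv> U_op absv smul chi"

lemma Heis_iff: "(w, t) \<in> Heis \<longleftrightarrow> w \<in> W smul \<and> t dvd 1"
  by (simp add: A_grp_def unit_group_def)

lemma chi_unit: "chi x dvd 1"
  using chi_add[of x "- x"] chi_zero by (auto simp: dvd_def)

lemma U_weyl: "\<Phi> \<in> SX \<Longrightarrow> U (w, t) \<Phi> = (\<lambda>x. t * chi (- (form_B w w / 2)) * weyl w \<Phi> x)"
proof
  fix x assume \<Phi>: "\<Phi> \<in> SX"
  obtain v m where w: "w = (v, m)" by (cases w)
  have "chi (- (m v / 2)) * chi (m x + m v / 2) = chi (m x)" by (simp flip: chi_add)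
  then show "U (w, t) \<Phi> x = t * chi (- (form_B w w / 2)) * weyl w \<Phi> x"
    using \<Phi> by (simp add: U_op_def w weyl_def form_B_def mult_ac)
qed

lemma U_AutS:
  assumes "a \<in> Heis" shows "U a \<in> carrier AutS"
proof -
  obtain v m t where a: "a = ((v, m), t)" by (metis surj_pair)
  have m: "m \<in> dual smul" and "t dvd 1" using assms by (simp_all add: a Heis_iff W_iff)
  then obtain t' where t': "1 = t * t'" by (auto simp: dvd_def)
  have lin: "lin_op (\<lambda>\<Phi> x. t * \<Phi> (x + v) * chi (m x))" if "m \<in> dual smul" for t m v
  proof -
    have "(\<lambda>x. t * \<Phi> (x + v) * chi (m x)) \<in> SX" if "\<Phi> \<in> SX" for \<Phi>
      using schwartz_mult[OF schwartz_chi_mult[OF schwartz_translate[OF that] \<open>m \<in> dual smul\<close>]]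
      by (simp add: mult_ac)
    then show ?thesis by (simp add: lin_op_def algebra_simps)
  qed
  have "restrict (\<lambda>\<Phi> x. t * \<Phi> (x + v) * chi (m x)) SX \<in> carrier AutS"
  proof (rule restrict_AutS[OF lin[OF m]])
    let ?s' = "\<lambda>\<Phi> x. (t' * chi (m v)) * \<Phi> (x + - v) * chi (- m x)"
    have "(\<lambda>x. - m x) \<in> dual smul" using m by (simp add: dual_iff)
    then show "lin_op ?s'" by (rule lin)
    fix \<Phi> :: "'x \<Rightarrow> 'r"
    show "?s' (\<lambda>x. t * \<Phi> (x + v) * chi (m x)) = \<Phi>"
    proof
      fix x
      have "chi (m v) * (chi (m (x - v)) * chi (- m x)) = 1"
        using chi_zero by (simp add: dualD[OF m] flip: chi_add)
      moreover have "?s' (\<lambda>x. t * \<Phi> (x + v) * chi (m x)) x =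
          (t * t') * (chi (m v) * (chi (m (x - v)) * chi (- m x))) * \<Phi> x"
        by (simp add: mult_ac)
      ultimately show "?s' (\<lambda>x. t * \<Phi> (x + v) * chi (m x)) x = \<Phi> x" by (simp flip: t')
    qed
    show "(\<lambda>x. t * ?s' \<Phi> (x + v) * chi (m x)) = \<Phi>"
    proof
      fix x
      have "chi (m v) * (chi (- m (x + v)) * chi (m x)) = 1"
        using chi_zero by (simp add: dualD[OF m] flip: chi_add)
      moreover have "t * ?s' \<Phi> (x + v) * chi (m x) =
          (t * t') * (chi (m v) * (chi (- m (x + v)) * chi (m x))) * \<Phi> x"
        by (simp add: mult_ac)
      ultimately show "t * ?s' \<Phi> (x + v) * chi (m x) = \<Phi> x" by (simp flip: t')
    qed
  qed
  then show ?thesis by (simp add: U_op_def a)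
qed

text \<open>Indicators of small sets detect v, the point x = 0 gives t, and then chi \<circ> (m -
  m') = 1 forces m = m' because chi is non-trivial.\<close>

lemma inj_on_U: "inj_on U Heis"
proof (rule inj_onI)
  fix a a' assume aa': "a \<in> Heis" "a' \<in> Heis" "U a = U a'"
  obtain v m t where a: "a = ((v, m), t)" by (metis surj_pair)
  obtain v' m' t' where a': "a' = ((v', m'), t')" by (metis surj_pair)
  have m: "m \<in> dual smul" and m': "m' \<in> dual smul" and "t \<noteq> 0"
    using aa'(1,2) by (auto simp: a a' Heis_iff W_iff)
  have eq: "t * \<Phi> (x + v) * chi (m x) = t' * \<Phi> (x + v') * chi (m' x)" if "\<Phi> \<in> SX" for \<Phi> x
    using fun_cong[OF fun_cong[OF aa'(3), of \<Phi>], of x] that by (simp add: U_op_def a a')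
  have v: "v = v'"
  proof (rule ccontr)
    assume "v \<noteq> v'"
    then have pos: "0 < nrm (v' - v)" using nrm_nonneg[of "v' - v"] nrm_eq_0[of "v' - v"] by fastforce
    \<comment> \<open>A lattice missing v' - v: its indicator moved to v is 1 at v and 0 at v', so
      the two operators differ at x = 0.\<close>
    obtain k where k: "k \<noteq> 0" "polar_lattice k \<subseteq> {x. nrm x \<le> nrm (v' - v) / 2}"
      using polar_lattice_small[of "nrm (v' - v) / 2"] pos by auto
    have "v' - v \<notin> polar_lattice k" using k(2) pos by auto
    moreover have "0 \<in> polar_lattice k" by (rule add_subgroupD(1)[OF add_subgroup_polar_lattice])
    ultimately show False
      using eq[OF schwartz_translate[OF lattice_ind_schwartz[OF k(1)], of "- v"], of 0] \<open>t \<noteq> 0\<close> chi_neq_0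
      by simp
  qed
  have eq': "t * chi (m x) = t' * chi (m' x)" for x
    using eq[OF schwartz_translate[OF lattice_ind_schwartz[of 1], of "- x - v"], of x] v
      add_subgroupD(1)[OF add_subgroup_polar_lattice] by simp
  have "t = t'" using eq'[of 0] by (simp add: dualD(3)[OF m] dualD(3)[OF m'] chi_zero)
  then have chi_eq: "chi (m x - m' x) = 1" for x using eq'[of x] \<open>t \<noteq> 0\<close> by (simp add: chi_diff_eq_1_iff)
  have "m x = m' x" for x
  proof (rule ccontr)
    assume "m x \<noteq> m' x"
    obtain z where "chi z \<noteq> 1" using chi_nontrivial by blast
    \<comment> \<open>A nonzero linear form is onto F, so a multiple of x takes m - m' to a point z
      where chi is not 1.\<close>
    moreover have "m (smul (z / (m x - m' x)) x) - m' (smul (z / (m x - m' x)) x) = z"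
      unfolding dualD(2)[OF m] dualD(2)[OF m'] right_diff_distrib[symmetric] using \<open>m x \<noteq> m' x\<close> by simp
    ultimately show False using chi_eq[of "smul (z / (m x - m' x)) x"] by simp
  qed
  then have "m = m'" by (rule ext)
  then show "a = a'" by (simp add: a a' v \<open>t = t'\<close>)
qed

definition intertwines where
  "intertwines \<sigma> s \<longleftrightarrow> (\<forall>w\<in>W smul. \<forall>\<Phi>\<in>SX. s (weyl w \<Phi>) = weyl (\<sigma> w) (s \<Phi>))"

text \<open>Surjectivity ensures that an intertwiner normalises A(W) instead of merely conjugating
  it into itself.\<close>

lemma mu_Heis:
  assumes "\<sigma> \<in> carrier (Sp smul)"
  shows "mu smul chi \<sigma> ` Heis = Heis"
proof (intro subset_antisym subsetI)
  fix b assume "b \<in> mu smul chi \<sigma> ` Heis"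
  then obtain w t where wt: "w \<in> W smul" "t dvd 1" "b = mu smul chi \<sigma> (w, t)" using Heis_iff by auto
  then show "b \<in> Heis"
    using Sp_D(3)[OF assms] mult_dvd_mono[OF chi_unit[of "f_quad \<sigma> w"] wt(2)] by (simp add: mu_def Heis_iff)
next
  fix b assume b: "b \<in> Heis"
  obtain w t where wt: "b = (w, t)" by (cases b)
  then have w: "w \<in> W smul" "t dvd 1" using b by (simp_all add: Heis_iff)
  let ?w = "inv_into (W smul) \<sigma> w"
  have iw: "?w \<in> W smul" "\<sigma> ?w = w"
    using Bij_inv_into_mem[OF Sp_D(1)[OF assms] w(1)] Bij_f_inv[OF Sp_D(1)[OF assms] w(1)] by simp_all
  have "chi (f_quad \<sigma> ?w) * (chi (- f_quad \<sigma> ?w) * t) = t"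
    using chi_minus_mult[of "f_quad \<sigma> ?w"] by (simp add: mult_ac flip: mult.assoc)
  moreover have "(?w, chi (- f_quad \<sigma> ?w) * t) \<in> Heis"
    using iw(1) mult_dvd_mono[OF chi_unit[of "- f_quad \<sigma> ?w"] w(2)] by (simp add: Heis_iff)
  ultimately show "b \<in> mu smul chi \<sigma> ` Heis"
    by (intro image_eqI[of _ _ "(?w, chi (- f_quad \<sigma> ?w) * t)"]) (simp_all add: mu_def wt iw(2))
qed

text \<open>\<open>U\<close> and \<open>weyl\<close> differ by the scalar chi(-B(w, w)/2). The
  factor chi(f(w)) in \<open>mu\<close>, with f standing for \<open>f_quad \<sigma>\<close>, turns
  the scalar at \<open>\<sigma> w\<close> into the one at w, so both sides carry the same
  unit.\<close>

lemma intertwines_iff: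
  assumes \<sigma>: "\<sigma> \<in> carrier (Sp smul)" and s: "s \<in> carrier AutS"
  shows "intertwines \<sigma> s \<longleftrightarrow> (\<forall>a\<in>Heis. s \<otimes>\<^bsub>AutS\<^esub> U a = U (mu smul chi \<sigma> a) \<otimes>\<^bsub>AutS\<^esub> s)"
proof -
  have left: "(s \<otimes>\<^bsub>AutS\<^esub> U (w, t)) \<Phi> = (\<lambda>x. t * chi (- (form_B w w / 2)) * s (weyl w \<Phi>) x)"
    if "(w, t) \<in> Heis" "\<Phi> \<in> SX" for w t \<Phi>
    using that AutS_mult[OF s U_AutS[OF that(1)]] lin_opD(3)[OF AutS_D(2)[OF s] weyl_schwartz[OF _ that(2)]]
    by (simp add: compose_eq U_weyl Heis_iff)
  have right: "(U (mu smul chi \<sigma> (w, t)) \<otimes>\<^bsub>AutS\<^esub> s) \<Phi> =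
      (\<lambda>x. t * chi (- (form_B w w / 2)) * weyl (\<sigma> w) (s \<Phi>) x)"
    if a: "(w, t) \<in> Heis" and \<Phi>: "\<Phi> \<in> SX" for w t \<Phi>
  proof -
    have mu_in: "mu smul chi \<sigma> (w, t) \<in> Heis" using mu_Heis[OF \<sigma>] a by blast
    have "f_quad \<sigma> w + - (form_B (\<sigma> w) (\<sigma> w) / 2) = - (form_B w w / 2)"
      by (simp add: f_quad_def diff_divide_distrib)
    then have c: "chi (f_quad \<sigma> w) * t * chi (- (form_B (\<sigma> w) (\<sigma> w) / 2)) = t * chi (- (form_B w w / 2))"
      using chi_add[of "f_quad \<sigma> w" "- (form_B (\<sigma> w) (\<sigma> w) / 2)"] by (simp add: mult_ac)
    have "(U (mu smul chi \<sigma> (w, t)) \<otimes>\<^bsub>AutS\<^esub> s) \<Phi> = U (mu smul chi \<sigma> (w, t)) (s \<Phi>)"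
      using AutS_mult[OF U_AutS[OF mu_in] s] \<Phi> by (simp add: compose_eq)
    also have "\<dots> = U (\<sigma> w, chi (f_quad \<sigma> w) * t) (s \<Phi>)" using a by (simp add: mu_def)
    finally show ?thesis using U_weyl[OF AutS_D(3)[OF s \<Phi>]] by (simp only: c)
  qed
  interpret A: group AutS by (rule group_AutS)
  show ?thesis
  proof (intro iffI ballI)
    fix a assume int: "intertwines \<sigma> s" and "a \<in> Heis"
    moreover obtain w t where "a = (w, t)" by (cases a)
    ultimately have a: "(w, t) \<in> Heis" and at: "a = (w, t)" by simp_all
    have mu_in: "mu smul chi \<sigma> (w, t) \<in> Heis" using mu_Heis[OF \<sigma>] a by blast
    show "s \<otimes>\<^bsub>AutS\<^esub> U a = U (mu smul chi \<sigma> a) \<otimes>\<^bsub>AutS\<^esub> s"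
      unfolding at
    proof (rule AutS_eqI)
      show "s \<otimes>\<^bsub>AutS\<^esub> U (w, t) \<in> carrier AutS" "U (mu smul chi \<sigma> (w, t)) \<otimes>\<^bsub>AutS\<^esub> s \<in> carrier AutS"
        using A.m_closed U_AutS a mu_in s by simp_all
      show "(s \<otimes>\<^bsub>AutS\<^esub> U (w, t)) \<Phi> = (U (mu smul chi \<sigma> (w, t)) \<otimes>\<^bsub>AutS\<^esub> s) \<Phi>" if "\<Phi> \<in> SX" for \<Phi>
        using int a that unfolding left[OF a that] right[OF a that] intertwines_def by (simp add: Heis_iff)
    qed
  next
    assume *: "\<forall>a\<in>Heis. s \<otimes>\<^bsub>AutS\<^esub> U a = U (mu smul chi \<sigma> a) \<otimes>\<^bsub>AutS\<^esub> s"
    show "intertwines \<sigma> s"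
      unfolding intertwines_def
    proof (intro ballI ext)
      fix w and \<Phi> :: "'x \<Rightarrow> 'r" and x assume w: "w \<in> W smul" and \<Phi>: "\<Phi> \<in> SX"
      have a: "(w, 1) \<in> Heis" using w by (simp add: Heis_iff)
      have "(s \<otimes>\<^bsub>AutS\<^esub> U (w, 1)) \<Phi> x = (U (mu smul chi \<sigma> (w, 1)) \<otimes>\<^bsub>AutS\<^esub> s) \<Phi> x" using * a by simp
      then show "s (weyl w \<Phi>) x = weyl (\<sigma> w) (s \<Phi>) x"
        unfolding left[OF a \<Phi>] right[OF a \<Phi>] using chi_neq_0 by simp
    qed
  qed
qed

lemma AA_subset: "AA absv smul chi \<subseteq> carrier AutS"
  unfolding AA_def using U_AutS by blast

text \<open>The library defines the normalizer as a stabilizer for conjugation restricted to subsets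
  of the carrier, which is why \<open>AA_subset\<close> enters.\<close>

lemma normalizer_iff:
  "s \<in> normalizer AutS (AA absv smul chi) \<longleftrightarrow> s \<in> carrier AutS \<and>
     (\<lambda>a. s \<otimes>\<^bsub>AutS\<^esub> U a \<otimes>\<^bsub>AutS\<^esub> inv\<^bsub>AutS\<^esub> s) ` Heis = U ` Heis"
proof -
  have "s <#\<^bsub>AutS\<^esub> AA absv smul chi #>\<^bsub>AutS\<^esub> inv\<^bsub>AutS\<^esub> s =
      (\<lambda>a. s \<otimes>\<^bsub>AutS\<^esub> U a \<otimes>\<^bsub>AutS\<^esub> inv\<^bsub>AutS\<^esub> s) ` Heis"
    by (auto simp: l_coset_def r_coset_def AA_def)
  then show ?thesis
    using AA_subset by (auto simp: normalizer_def stabilizer_def AA_def)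
qed

text \<open>\<open>pi0\<close> goes through \<open>inv_into\<close>, which inverts U only on its
  range; the normaliser condition places the conjugates there. Conversely, intertwining makes
  conjugation agree with \<open>mu\<close>, and \<open>mu_Heis\<close> gives the normaliser
  condition back.\<close>

lemma mem_Mp_iff:
  "(\<sigma>, s) \<in> carrier (Mp absv smul chi) \<longleftrightarrow>
     \<sigma> \<in> carrier (Sp smul) \<and> s \<in> carrier AutS \<and> intertwines \<sigma> s"
proof (cases "\<sigma> \<in> carrier (Sp smul) \<and> s \<in> carrier AutS")
  case False
  then show ?thesis by (auto simp: Mp_def BB0_def normalizer_iff)
next
  case True
  then have \<sigma>: "\<sigma> \<in> carrier (Sp smul)" and s: "s \<in> carrier AutS" by simp_all
  interpret A: group AutS by (rule group_AutS)
  let ?conj = "\<lambda>a. s \<otimes>\<^bsub>AutS\<^esub> U a \<otimes>\<^bsub>AutS\<^esub> inv\<^bsub>AutS\<^esub> s"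
  have mu_in: "mu smul chi \<sigma> a \<in> Heis" if "a \<in> Heis" for a using mu_Heis[OF \<sigma>] that by blast
  have conj_eq: "?conj a = U (mu smul chi \<sigma> a) \<longleftrightarrow> s \<otimes>\<^bsub>AutS\<^esub> U a = U (mu smul chi \<sigma> a) \<otimes>\<^bsub>AutS\<^esub> s"
    if "a \<in> Heis" for a
    by (rule A.inv_solve_right'[OF U_AutS[OF mu_in[OF that]] A.m_closed[OF s U_AutS[OF that]] s])
  have "(\<sigma>, s) \<in> carrier (Mp absv smul chi) \<longleftrightarrow> ?conj ` Heis = U ` Heis \<and> mu smul chi \<sigma> = pi0 absv smul chi s"
    using \<sigma> s by (simp add: Mp_def BB0_def normalizer_iff)
  also have "\<dots> \<longleftrightarrow> (\<forall>a\<in>Heis. ?conj a = U (mu smul chi \<sigma> a))"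
  proof (intro iffI ballI conjI)
    fix a assume *: "?conj ` Heis = U ` Heis \<and> mu smul chi \<sigma> = pi0 absv smul chi s" and a: "a \<in> Heis"
    have "mu smul chi \<sigma> a = inv_into Heis U (?conj a)" using * a by (simp add: pi0_def)
    moreover have "?conj a \<in> U ` Heis" using * a by blast
    ultimately show "?conj a = U (mu smul chi \<sigma> a)" by (simp add: f_inv_into_f)
  next
    assume *: "\<forall>a\<in>Heis. ?conj a = U (mu smul chi \<sigma> a)"
    then have "?conj ` Heis = U ` mu smul chi \<sigma> ` Heis" by (simp add: image_image)
    then show "?conj ` Heis = U ` Heis" using mu_Heis[OF \<sigma>] by simp
    show "mu smul chi \<sigma> = pi0 absv smul chi s"
    proof
      fix a
      show "mu smul chi \<sigma> a = pi0 absv smul chi s a"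
      proof (cases "a \<in> Heis")
        case True
        then show ?thesis using * mu_in inv_into_f_f[OF inj_on_U] by (simp add: pi0_def)
      next
        case False
        \<comment> \<open>Off the Heisenberg group both maps are \<open>undefined\<close>, being
          restrictions.\<close>
        then show ?thesis by (simp add: mu_def pi0_def)
      qed
    qed
  qed
  also have "\<dots> \<longleftrightarrow> intertwines \<sigma> s" using conj_eq intertwines_iff[OF \<sigma> s] by simp
  finally show ?thesis using \<sigma> s by simp
qed

section \<open>The metaplectic group as a subgroup of the product of \<open>Sp\<close> and
  \<open>AutS\<close>\<close>

lemma Mp_eq: "Mp absv smul chi = (Sp smul \<times>\<times> AutS)\<lparr>carrier := carrier (Mp absv smul chi)\<rparr>"
  by (simp add: Mp_def DirProd_def BB0_def)

lemma subgroup_Mp: "subgroup (carrier (Mp absv smul chi)) (Sp smul \<times>\<times> AutS)"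
proof (rule group.subgroupI[OF DirProd_group[OF group_Sp group_AutS]])
  show "carrier (Mp absv smul chi) \<subseteq> carrier (Sp smul \<times>\<times> AutS)"
    by (auto simp: mem_Mp_iff)
  interpret S: group "Sp smul" by (rule group_Sp)
  interpret A: group AutS by (rule group_AutS)
  have "\<one>\<^bsub>AutS\<^esub> = (\<lambda>\<Phi>\<in>SX. \<Phi>)" by (simp add: Aut_S_def BijGroup_def)
  then have "(\<one>\<^bsub>Sp smul\<^esub>, \<one>\<^bsub>AutS\<^esub>) \<in> carrier (Mp absv smul chi)"
    unfolding mem_Mp_iff intertwines_def using S.one_closed A.one_closed weyl_schwartz by (simp add: Sp_one)
  then show "carrier (Mp absv smul chi) \<noteq> {}" by blast
next
  fix x assume "x \<in> carrier (Mp absv smul chi)"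
  moreover obtain \<sigma> s where x: "x = (\<sigma>, s)" by (cases x)
  ultimately have \<sigma>: "\<sigma> \<in> carrier (Sp smul)" and s: "s \<in> carrier AutS" and int: "intertwines \<sigma> s"
    by (simp_all add: mem_Mp_iff)
  have inv_in: "inv\<^bsub>Sp smul\<^esub> \<sigma> \<in> carrier (Sp smul)" "inv\<^bsub>AutS\<^esub> s \<in> carrier AutS"
    using group.inv_closed[OF group_Sp \<sigma>] group.inv_closed[OF group_AutS s] .
  have "intertwines (inv\<^bsub>Sp smul\<^esub> \<sigma>) (inv\<^bsub>AutS\<^esub> s)"
    unfolding intertwines_def Sp_inv[OF \<sigma>] AutS_inv[OF s]
  proof (intro ballI)
    fix w and \<Phi> :: "'x \<Rightarrow> 'r" assume w: "w \<in> W smul" and \<Phi>: "\<Phi> \<in> SX"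
    let ?w = "inv_into (W smul) \<sigma> w" and ?\<Phi> = "inv_into SX s \<Phi>"
    have iw: "?w \<in> W smul" "\<sigma> ?w = w"
      using Bij_inv_into_mem[OF Sp_D(1)[OF \<sigma>] w] Bij_f_inv[OF Sp_D(1)[OF \<sigma>] w] by simp_all
    have i\<Phi>: "?\<Phi> \<in> SX" "s ?\<Phi> = \<Phi>"
      using Bij_inv_into_mem[OF AutS_D(1)[OF s] \<Phi>] Bij_f_inv[OF AutS_D(1)[OF s] \<Phi>] by simp_all
    have "s (weyl ?w ?\<Phi>) = weyl w \<Phi>" using int iw i\<Phi> unfolding intertwines_def by simp
    moreover have "inj_on s SX" using AutS_D(1)[OF s] by (simp add: Bij_def bij_betw_def)
    ultimately have "inv_into SX s (weyl w \<Phi>) = weyl ?w ?\<Phi>"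
      using inv_into_f_f[OF _ weyl_schwartz[OF iw(1) i\<Phi>(1)], of s] by simp
    then show "restrict (inv_into SX s) SX (weyl w \<Phi>) =
        weyl (restrict (inv_into (W smul) \<sigma>) (W smul) w) (restrict (inv_into SX s) SX \<Phi>)"
      using w \<Phi> weyl_schwartz[OF w \<Phi>] by simp
  qed
  then show "inv\<^bsub>Sp smul \<times>\<times> AutS\<^esub> x \<in> carrier (Mp absv smul chi)"
    using inv_in by (simp add: x inv_DirProd[OF group_Sp group_AutS \<sigma> s] mem_Mp_iff)
next
  fix x y assume "x \<in> carrier (Mp absv smul chi)" "y \<in> carrier (Mp absv smul chi)"
  moreover obtain \<sigma> s where x: "x = (\<sigma>, s)" by (cases x)
  moreover obtain \<tau> t where y: "y = (\<tau>, t)" by (cases y)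
  ultimately have 1: "\<sigma> \<in> carrier (Sp smul)" "s \<in> carrier AutS" "intertwines \<sigma> s"
    and 2: "\<tau> \<in> carrier (Sp smul)" "t \<in> carrier AutS" "intertwines \<tau> t"
    by (simp_all add: mem_Mp_iff)
  have "intertwines (\<sigma> \<otimes>\<^bsub>Sp smul\<^esub> \<tau>) (s \<otimes>\<^bsub>AutS\<^esub> t)"
    using 1(3) 2(3) Sp_D(3)[OF 2(1)] AutS_D(3)[OF 2(2)] weyl_schwartz
    unfolding intertwines_def Sp_mult[OF 1(1) 2(1)] AutS_mult[OF 1(2) 2(2)]
    by (simp add: compose_eq)
  then show "x \<otimes>\<^bsub>Sp smul \<times>\<times> AutS\<^esub> y \<in> carrier (Mp absv smul chi)"
    using monoid.m_closed[OF group.is_monoid[OF group_Sp] 1(1) 2(1)]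
      monoid.m_closed[OF group.is_monoid[OF group_AutS] 1(2) 2(2)]
    by (simp add: x y mem_Mp_iff)
qed

lemma group_Mp: "group (Mp absv smul chi)"
  using subgroup.subgroup_is_group[OF subgroup_Mp DirProd_group[OF group_Sp group_AutS]] Mp_eq by simp

lemma Mp_mult: "(\<sigma>, s) \<otimes>\<^bsub>Mp absv smul chi\<^esub> (\<tau>, t) = (\<sigma> \<otimes>\<^bsub>Sp smul\<^esub> \<tau>, s \<otimes>\<^bsub>AutS\<^esub> t)"
  by (subst Mp_eq) simp

section \<open>Exactness of the sequence\<close>

abbreviation scalar_op :: "'r \<Rightarrow> ('x \<Rightarrow> 'r) \<Rightarrow> 'x \<Rightarrow> 'r" where
  "scalar_op c \<equiv> (\<lambda>\<Phi>\<in>SX. (\<lambda>x. c * \<Phi> x))"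

lemma scalar_op_AutS:
  assumes "c dvd 1" shows "scalar_op c \<in> carrier AutS"
proof -
  obtain d where d: "1 = c * d" using assms by (auto simp: dvd_def)
  have "c * (d * y) = y" for y using d by (simp flip: mult.assoc)
  then have cancel: "c * (d * y) = y" "d * (c * y) = y" for y by (simp_all add: mult.left_commute)
  have lin: "lin_op (\<lambda>\<Phi> x. c * \<Phi> x)" for c
    by (simp add: lin_op_def schwartz_mult algebra_simps)
  show ?thesis
    by (rule restrict_AutS[OF lin[of c] lin[of d]]) (simp_all add: cancel)
qed

lemma Sp_one_Mp_iff:
  "(\<lambda>w\<in>W smul. w, s) \<in> carrier (Mp absv smul chi) \<longleftrightarrow> (\<exists>c. c dvd 1 \<and> s = scalar_op c)"
proof
  assume "(\<lambda>w\<in>W smul. w, s) \<in> carrier (Mp absv smul chi)"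
  then have s: "s \<in> carrier AutS" and int: "intertwines (\<lambda>w\<in>W smul. w) s" by (simp_all add: mem_Mp_iff)
  have "\<exists>c. \<forall>\<Phi>\<in>SX. s \<Phi> = (\<lambda>x. c * \<Phi> x)"
    by (rule schur[OF AutS_D(2)[OF s]]) (use int in \<open>simp add: intertwines_def\<close>)
  then obtain c where c: "\<And>\<Phi>. \<Phi> \<in> SX \<Longrightarrow> s \<Phi> = (\<lambda>x. c * \<Phi> x)" by blast
  have ind: "lattice_ind 1 \<in> SX" by (rule lattice_ind_schwartz) simp
  \<comment> \<open>The scalar c is a unit because s is onto: a preimage of a function with value 1
    at 0 provides the inverse of c.\<close>
  let ?\<Phi> = "inv_into SX s (lattice_ind 1)"
  have "?\<Phi> \<in> SX" "s ?\<Phi> = lattice_ind 1"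
    using Bij_inv_into_mem[OF AutS_D(1)[OF s] ind] Bij_f_inv[OF AutS_D(1)[OF s] ind] .
  then have "c * ?\<Phi> 0 = lattice_ind 1 0" using c[of ?\<Phi>] by metis
  then have "c * ?\<Phi> 0 = 1" using add_subgroupD(1)[OF add_subgroup_polar_lattice] by simp
  then have "c dvd 1" by (metis dvd_triv_left)
  moreover from this have "s = scalar_op c"
    by (intro AutS_eqI[OF s scalar_op_AutS]) (simp_all add: c)
  ultimately show "\<exists>c. c dvd 1 \<and> s = scalar_op c" by blast
next
  assume "\<exists>c. c dvd 1 \<and> s = scalar_op c"
  then obtain c where c: "c dvd 1" "s = scalar_op c" by blast
  have "\<one>\<^bsub>Sp smul\<^esub> \<in> carrier (Sp smul)" using monoid.one_closed[OF group.is_monoid[OF group_Sp]] .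
  moreover have "intertwines (\<lambda>w\<in>W smul. w) (scalar_op c)"
    unfolding intertwines_def using weyl_schwartz by (auto simp: weyl_def fun_eq_iff mult_ac)
  ultimately show "(\<lambda>w\<in>W smul. w, s) \<in> carrier (Mp absv smul chi)"
    using scalar_op_AutS[OF c(1)] by (simp add: mem_Mp_iff c(2) Sp_one)
qed

lemma Mp_scalar_mem: "c dvd 1 \<Longrightarrow> Mp_scalar absv smul c \<in> carrier (Mp absv smul chi)"
  using Sp_one_Mp_iff unfolding Mp_scalar_def by blast

lemma Mp_scalar_mon: "Mp_scalar absv smul \<in> mon unit_group (Mp absv smul chi)"
  unfolding mon_def
proof (intro CollectI conjI)
  show "Mp_scalar absv smul \<in> hom unit_group (Mp absv smul chi)"
  proof (rule homI)
    show "Mp_scalar absv smul c \<in> carrier (Mp absv smul chi)" if "c \<in> carrier unit_group" for c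
      using that Mp_scalar_mem by (simp add: unit_group_def)
    fix c d :: 'r assume "c \<in> carrier unit_group" "d \<in> carrier unit_group"
    then have cd: "c dvd 1" "d dvd 1" by (simp_all add: unit_group_def)
    have "scalar_op (c * d) = compose SX (scalar_op c) (scalar_op d)"
      by (auto simp: compose_def restrict_def fun_eq_iff schwartz_mult mult.assoc)
    then have "scalar_op (c * d) = scalar_op c \<otimes>\<^bsub>AutS\<^esub> scalar_op d"
      using AutS_mult[OF scalar_op_AutS[OF cd(1)] scalar_op_AutS[OF cd(2)]] by simp
    moreover have "\<one>\<^bsub>Sp smul\<^esub> = \<one>\<^bsub>Sp smul\<^esub> \<otimes>\<^bsub>Sp smul\<^esub> \<one>\<^bsub>Sp smul\<^esub>"
      using monoid.l_one[OF group.is_monoid[OF group_Sp] monoid.one_closed[OF group.is_monoid[OF group_Sp]]] by simp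
    ultimately show "Mp_scalar absv smul (c \<otimes>\<^bsub>unit_group\<^esub> d) =
        Mp_scalar absv smul c \<otimes>\<^bsub>Mp absv smul chi\<^esub> Mp_scalar absv smul d"
      by (simp add: Mp_scalar_def Mp_mult Sp_one unit_group_def)
  qed
  show "inj_on (Mp_scalar absv smul) (carrier (unit_group :: 'r monoid))"
  proof (rule inj_onI)
    fix c d :: 'r assume "Mp_scalar absv smul c = Mp_scalar absv smul d"
    then have "scalar_op c (lattice_ind 1) 0 = scalar_op d (lattice_ind 1) 0" by (simp add: Mp_scalar_def)
    then show "c = d"
      using lattice_ind_schwartz[of 1] add_subgroupD(1)[OF add_subgroup_polar_lattice] by simp
  qed
qed

lemma Mp_fst_epi: "fst \<in> epi (Mp absv smul chi) (Sp smul)"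
  unfolding epi_def
proof (intro CollectI conjI subset_antisym subsetI)
  show "fst \<in> hom (Mp absv smul chi) (Sp smul)"
    by (rule homI) (auto simp: mem_Mp_iff Mp_mult)
  show "\<sigma> \<in> carrier (Sp smul)" if "\<sigma> \<in> fst ` carrier (Mp absv smul chi)" for \<sigma>
    using that by (auto simp: mem_Mp_iff)
  fix \<sigma> assume \<sigma>: "\<sigma> \<in> carrier (Sp smul)"
  obtain s s' where s: "lin_op s" "lin_op s'" "\<forall>\<Phi>\<in>SX. s' (s \<Phi>) = \<Phi>" "\<forall>\<Phi>\<in>SX. s (s' \<Phi>) = \<Phi>"
    "\<forall>w\<in>W smul. \<forall>\<Phi>\<in>SX. s (weyl w \<Phi>) = weyl (\<sigma> w) (s \<Phi>)"
    by (rule implementedE[OF symplectic_implemented[OF Sp_D(2)[OF \<sigma>]]])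
  have "restrict s SX \<in> carrier AutS" by (rule restrict_AutS[OF s(1,2)]) (use s in simp_all)
  moreover have "intertwines \<sigma> (restrict s SX)"
    unfolding intertwines_def using s(5) weyl_schwartz by simp
  ultimately have "(\<sigma>, restrict s SX) \<in> carrier (Mp absv smul chi)" using \<sigma> by (simp add: mem_Mp_iff)
  then show "\<sigma> \<in> fst ` carrier (Mp absv smul chi)" by (intro image_eqI[of _ _ "(\<sigma>, restrict s SX)"]) simp_all
qed

lemma Mp_fst_kernel:
  "kernel (Mp absv smul chi) (Sp smul) fst = Mp_scalar absv smul ` carrier unit_group"
proof (intro subset_antisym subsetI)
  fix x assume "x \<in> kernel (Mp absv smul chi) (Sp smul) fst"
  moreover obtain \<sigma> s where x: "x = (\<sigma>, s)" by (cases x)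
  ultimately have "(\<lambda>w\<in>W smul. w, s) \<in> carrier (Mp absv smul chi)" "x = (\<lambda>w\<in>W smul. w, s)"
    by (auto simp: kernel_def Sp_one)
  then obtain c where "c dvd 1" "x = Mp_scalar absv smul c"
    using Sp_one_Mp_iff[of s] by (auto simp: Mp_scalar_def)
  then show "x \<in> Mp_scalar absv smul ` carrier unit_group" by (auto simp: unit_group_def)
next
  fix x assume "x \<in> Mp_scalar absv smul ` carrier (unit_group :: 'r monoid)"
  then obtain c where c: "c dvd 1" "x = Mp_scalar absv smul c" by (auto simp: unit_group_def)
  then show "x \<in> kernel (Mp absv smul chi) (Sp smul) fst"
    using Mp_scalar_mem[OF c(1)] by (simp add: kernel_def Sp_one) (simp add: Mp_scalar_def)
qed

end

section \<open>The hypotheses of the theorem in analytic form\<close>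

lemma weil_dataI:
  fixes absv :: "'f::field \<Rightarrow> real" and chi :: "'f \<Rightarrow> 'r::idom"
  assumes "nonarch_local_field absv" "CHAR('f) \<noteq> 2" "(of_nat (residue_char absv) :: 'r) dvd 1"
    and chi: "smooth_character absv chi" "\<exists>a. chi a \<noteq> 1"
    and "finite_dimensional_vector_space smul B"
  shows "weil_data absv smul B chi"
proof -
  interpret nonarch_local_field absv by fact
  have "(2::'f) \<noteq> 0"
  proof
    assume "(2::'f) = 0"
    then have "(of_nat 2 :: 'f) = 0" by simp
    then have "CHAR('f) dvd 2" by (simp only: of_nat_eq_0_iff_char_dvd)
    \<comment> \<open>A characteristic dividing 2 is 1 or 2; the value 2 is excluded by hypothesis
      and 1 cannot occur in a field.\<close>
    then have "CHAR('f) \<le> 2" "CHAR('f) \<noteq> 0" by (auto dest: dvd_imp_le intro!: Nat.gr0I)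
    with assms(2) have "CHAR('f) = 1" by linarith
    then show False by simp
  qed
  moreover have add: "chi (x + y) = chi x * chi y" for x y
    using chi(1) by (simp add: smooth_character_def hom_def additive_group_def unit_group_def)
  moreover have zero: "chi 0 = 1"
  proof -
    have "chi 0 dvd 1" using chi(1) by (simp add: smooth_character_def hom_def additive_group_def unit_group_def Pi_iff)
    then have "chi 0 \<noteq> 0" by auto
    with add[of 0 0] show ?thesis by simp
  qed
  moreover have "\<exists>\<delta>>0. \<forall>z. absv z < \<delta> \<longrightarrow> chi z = 1"
  proof -
    have "openin (field_topology absv) {x. chi x = 1}"
      using chi(1) by (simp add: smooth_character_def kernel_def additive_group_def unit_group_def)
    then show ?thesis using zero unfolding openin_field_topology_iff by force
  qed
  ultimately show ?thesis
    using assms by (intro weil_data.intro local_vector_space.intro weil_data_axioms.intro)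
qed

theorem theorem2p10:
  fixes absv :: "'f::field \<Rightarrow> real"
    and smul :: "'f \<Rightarrow> 'x::ab_group_add \<Rightarrow> 'x"
    and B :: "'x set"
    and chi :: "'f \<Rightarrow> 'r::idom"
    and p q :: nat
  assumes "nonarch_local_field absv"
    and "CHAR('f) \<noteq> 2"
    and "p = residue_char absv"
    and "q = residue_card absv"
    and "(of_nat p :: 'r) dvd 1"
    and "\<exists>s::'r. s\<^sup>2 = of_nat q"
    and "smooth_character absv chi"
    and "\<exists>a. chi a \<noteq> 1"
    and "finite_dimensional_vector_space smul B"
  shows "group (Mp absv smul chi) \<and> group (Sp smul) \<and>
    Mp_scalar absv smul \<in> mon unit_group (Mp absv smul chi) \<and>
    fst \<in> epi (Mp absv smul chi) (Sp smul) \<and>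
    kernel (Mp absv smul chi) (Sp smul) fst = Mp_scalar absv smul ` carrier unit_group"
proof -
  interpret weil_data absv smul B chi
    by (rule weil_dataI) (use assms in simp_all)
  show ?thesis
    using group_Mp group_Sp Mp_scalar_mon Mp_fst_epi Mp_fst_kernel by blast
qed

end
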